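(* Let $n\ge 2$. All eigenvalues in $(-\infty,0)$ are counted with multiplicity. (a) If $(\lambda,\mu)$ lies in one of the following sets, then $H_{\lambda\mu}$ has the indicated number of eigenvalues in $(-\infty,0)$, and $H_{\lambda\mu}$ has neither a threshold eigenvalue nor a threshold resonance: - $D_0=G_0$: $0$ eigenvalues; - $D_1=G_1\cap\mathfrak S_-$: $1$; - $D_2=G_2\cap\mathfrak S_-$: $2$; - $D_{n+1}=G_1\cap\mathfrak S_+\cap\mathfrak C_-$: $n+1$; - $D_{n+2}=G_2\cap\mathfrak S_+\cap\mathfrak C_-$: $n+2$; - $D_{2n}=G_1\cap\mathfrak C_+$: $2n$; - $D_{2n+1}=G_2\cap\mathfrak C_+$: $2n+1$. (b) $0$ is not a super-threshold resonance of $H_{\lambda\mu}$ for any $(\lambda,\mu)\in\mathbb R^2$. (c) On the remaining sets the following holds. - Curves $B$: $H_{\lambda\mu}$ has $0$ eigenvalues in $(-\infty,0)$ on $B_0=\Gamma_l$, $1$ on $B_1=\Gamma_r\cap\mathfrak S_-$, $n+1$ on $B_{n+1}=\Gamma_r\cap\mathfrak S_+\cap\mathfrak C_-$, and $2n$ on $B_{2n}=\Gamma_r\cap\mathfrak C_+$. On each of these curves: if $n=2$, $0$ is neither a threshold resonance nor a threshold eigenvalue; if $n=3,4$, $0$ is a threshold resonance of multiplicity $1$ and not a threshold eigenvalue; if $n\ge5$, $0$ is a threshold eigenvalue of multiplicity $1$ and not a threshold resonance. - Curves $S$: $H_{\lambda\mu}$ has $1$ eigenvalue in $(-\infty,0)$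 on $S_1=\mathfrak S_0\cap G_1$ and $2$ on $S_2=\mathfrak S_0\cap G_2$. On each of these curves: if $n=2$, $0$ is a threshold resonance of multiplicity $2$ and not a threshold eigenvalue; if $n\ge3$, $0$ is a threshold eigenvalue of multiplicity $n$ and not a threshold resonance. - Curves $C$: $H_{\lambda\mu}$ has $n+1$ eigenvalues in $(-\infty,0)$ on $C_{n+1}=\mathfrak C_0\cap G_1$ and $n+2$ on $C_{n+2}=\mathfrak C_0\cap G_2$. On each of these curves, for every $n\ge2$, $0$ is a threshold eigenvalue of multiplicity $n-1$ and not a threshold resonance. - Point $A=\Gamma_r\cap\mathfrak S_0$: $H_{\lambda\mu}$ has $1$ eigenvalue in $(-\infty,0)$. If $n=2$, $0$ is a threshold resonance of multiplicity $2$ and not a threshold eigenvalue; if $n=3,4$, $0$ is a threshold resonance of multiplicity $1$ and a threshold eigenvalue of multiplicity $n$; if $n\ge5$, $0$ is a threshold eigenvalue of multiplicity $n+1$ and not a threshold resonance. - Point $B=\Gamma_r\cap\mathfrak C_0$: $H_{\lambda\mu}$ has $n+1$ eigenvalues in $(-\infty,0)$. If $n=2$, $0$ is a threshold eigenvalue of multiplicity $1$ and not a threshold resonance; if $n=3,4$, $0$ is a threshold resonance of multiplicity $1$ and a threshold eigenvalue of multiplicity $n-1$; if $n\ge5$, $0$ is a threshold eigenvalue of multiplicity $n$ and not a threshold resonance.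
   Context: Let $\mathbb T^n=(-\pi,\pi]^n$ be the $n$-torus with Lebesgue measure $dp$, and $E(p)=\sum_{j=1}^n(1-\cos p_j)$. For $\lambda,\mu\in\mathbb R$, $H_{\lambda\mu}$ is the bounded self-adjoint operator on $L^2(\mathbb T^n)$ $$(H_{\lambda\mu}f)(p)=E(p)f(p)-\frac1{(2\pi)^n}\int_{\mathbb T^n}\Big(\mu+\lambda\sum_{j=1}^n\cos(p_j-s_j)\Big)f(s)\,ds .$$ It is reduced by the subspaces of even and of odd functions (under $p\mapsto-p$), so $H_{\lambda\mu}=H^{\mathrm e}_{\lambda\mu}\oplus H^{\mathrm o}_\lambda$ with $$(H^{\mathrm e}_{\lambda\mu}f)(p)=E(p)f(p)-\frac{\mu}{(2\pi)^n}\int_{\mathbb T^n} f(q)\,dq-\frac{\lambda}{(2\pi)^n}\sum_{j=1}^n\cos p_j\int_{\mathbb T^n}\cos q_j\, f(q)\,dq\quad(f\text{ even}),$$ $$(H^{\mathrm o}_{\lambda}f)(p)=E(p)f(p)-\frac{\lambda}{(2\pi)^n}\sum_{j=1}^n\sin p_j\int_{\mathbb T^n}\sin q_j\, f(q)\,dq\quad(f\text{ odd}).$$ The equations $H^{\mathrm e}_{\lambda\mu}f=0$ and $H^{\mathrm o}_\lambda f=0$ are considered, by these formulas (almost everywhere), also for measurable even (resp. odd) $f$ not in $L^2$; every integral with nonzero coefficient is required to converge absolutely (automatic for $f\in L^1$). $0$ is a (lower) threshold eigenvalue of $H^{\mathrm e}_{\lambda\mu}$ (resp. $H^{\mathrm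 o}_\lambda$) if the corresponding equation has a nonzero even (resp. odd) solution $f\in L^2(\mathbb T^n)$; a (lower) threshold resonance if it has such a solution in $L^1(\mathbb T^n)\setminus L^2(\mathbb T^n)$; a (lower) super-threshold resonance if it has such a solution $f\notin L^1(\mathbb T^n)$ with $f\in L^\epsilon(\mathbb T^n)$ for every $0<\epsilon<1$. $0$ is called a threshold eigenvalue (resonance, super-threshold resonance) of $H_{\lambda\mu}$ if it is one of $H^{\mathrm e}_{\lambda\mu}$ or of $H^{\mathrm o}_\lambda$. The multiplicity of a threshold eigenvalue of $H_{\lambda\mu}$ is the dimension of the space of $L^2$ solutions (even plus odd), and the multiplicity of a threshold resonance is the dimension of the space of $L^1$ solutions modulo $L^2$ solutions (even plus odd). For $z<0$ (and $z=0$ if $n\ge3$) put $a(z)=\frac1{(2\pi)^n}\int_{\mathbb T^n}\frac{dp}{E(p)-z}$ and $b(z)=\frac1{(2\pi)^n}\int_{\mathbb T^n}\frac{\cos p_1}{E(p)-z}dp$. Let $X=1$ if $n=1,2$ and $X=a(0)/b(0)$ if $n\ge3$. Let $\overline{\mathcal H}_0(\lambda,\mu)=(\lambda-X)(\mu-n)-n$, and let $\Gamma_l$ (resp. $\Gamma_r$) be the branch of the hyperbola $\{\overline{\mathcal H}_0=0\}$ with $\lambda<X$ (resp. $\lambda>X$). Put $G_0=\{\overline{\mathcal H}_0>0,\ \lambda<X\}$, $G_1=\{\overline{\mathcal H}_0<0\}$, $G_2=\{\overline{\mathcal H}_0>0,\ \lambda>X\}$, subsets of $\mathbb R^2$. Let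 $\lambda_s=\Big(\frac1{(2\pi)^n}\int_{\mathbb T^n}\frac{\sin^2p_1}{E(p)}dp\Big)^{-1}$ and $\lambda_c=\Big(\frac1{2(2\pi)^n}\int_{\mathbb T^n}\frac{(\cos p_1-\cos p_2)^2}{E(p)}dp\Big)^{-1}$. Then $\mathfrak S_-,\mathfrak S_0,\mathfrak S_+$ are the sets of $(\lambda,\mu)\in\mathbb R^2$ with $\lambda<\lambda_s$, $\lambda=\lambda_s$, $\lambda>\lambda_s$, and $\mathfrak C_-,\mathfrak C_0,\mathfrak C_+$ those with $\lambda<\lambda_c$, $\lambda=\lambda_c$, $\lambda>\lambda_c$. *)

theory Defs
  imports "HOL-Analysis.Analysis" "HOL-Library.Extended_Nat"
begin

text \<open>
  Points of the torus are functions p on the index set {1..n}, so p 1 and p 2 are the first two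
  coordinates. The measure is Borel-Lebesgue measure. Since all equations below hold only almost
  everywhere, nothing is lost against Lebesgue measurable functions: each of them agrees almost
  everywhere with a Borel function.
\<close>

definition torus :: "nat \<Rightarrow> (nat \<Rightarrow> real) measure" where
  "torus n = (\<Pi>\<^sub>M j\<in>{1..n}. restrict_space lborel {-pi<..pi})"

text \<open>The map p to -p modulo 2 pi; the coordinate pi is its own negative.\<close>

definition torus_uminus :: "nat \<Rightarrow> (nat \<Rightarrow> real) \<Rightarrow> (nat \<Rightarrow> real)" where
  "torus_uminus n p = (\<lambda>j\<in>{1..n}. if p j = pi then pi else - p j)"

definition dispersion :: "nat \<Rightarrow> (nat \<Rightarrow> real) \<Rightarrow> real" where
  "dispersion n p = (\<Sum>j=1..n. 1 - cos (p j))"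

subsection \<open>Function spaces\<close>

definition Lp :: "nat \<Rightarrow> real \<Rightarrow> ((nat \<Rightarrow> real) \<Rightarrow> complex) set" where
  "Lp n r = {f \<in> borel_measurable (torus n). integrable (torus n) (\<lambda>p. norm (f p) powr r)}"

definition null_functions :: "nat \<Rightarrow> ((nat \<Rightarrow> real) \<Rightarrow> complex) set" where
  "null_functions n = {f \<in> borel_measurable (torus n). AE p in torus n. f p = 0}"

definition even_functions :: "nat \<Rightarrow> ((nat \<Rightarrow> real) \<Rightarrow> complex) set" where
  "even_functions n =
     {f \<in> borel_measurable (torus n). AE p in torus n. f (torus_uminus n p) = f p}"

definition odd_functions :: "nat \<Rightarrow> ((nat \<Rightarrow> real) \<Rightarrow> complex) set" where
  "odd_functions n =
     {f \<in> borel_measurable (torus n). AE p in torus n. f (torus_uminus n p) = - f p}"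

text \<open>
  Dimension (possibly infinite) of the complex vector space V / W, for spaces V and W of functions
  with W contained in V: the supremum of the lengths of finite families in V that are linearly
  independent modulo W. With W the null functions this is the dimension of V up to
  almost-everywhere equality.
\<close>

definition quotient_dim :: "('a \<Rightarrow> complex) set \<Rightarrow> ('a \<Rightarrow> complex) set \<Rightarrow> enat" where
  "quotient_dim V W =
     Sup {enat k | k. \<exists>f :: nat \<Rightarrow> 'a \<Rightarrow> complex.
            (\<forall>i<k. f i \<in> V) \<and>
            (\<forall>c :: nat \<Rightarrow> complex. (\<lambda>p. \<Sum>i<k. c i * f i p) \<in> W \<longrightarrow> (\<forall>i<k. c i = 0))}"

subsection \<open>The operators\<close>

definition H_op ::
    "nat \<Rightarrow> real \<Rightarrow> real \<Rightarrow> ((nat \<Rightarrow> real) \<Rightarrow> complex) \<Rightarrow> (nat \<Rightarrow> real) \<Rightarrow> complex" where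
  "H_op n lam \<mu> f p =
     of_real (dispersion n p) * f p
     - of_real (1 / (2 * pi) ^ n)
       * (LINT s|torus n. of_real (\<mu> + lam * (\<Sum>j=1..n. cos (p j - s j))) * f s)"

definition He_op ::
    "nat \<Rightarrow> real \<Rightarrow> real \<Rightarrow> ((nat \<Rightarrow> real) \<Rightarrow> complex) \<Rightarrow> (nat \<Rightarrow> real) \<Rightarrow> complex" where
  "He_op n lam \<mu> f p =
     of_real (dispersion n p) * f p
     - of_real (\<mu> / (2 * pi) ^ n) * (LINT q|torus n. f q)
     - of_real (lam / (2 * pi) ^ n)
       * (\<Sum>j=1..n. of_real (cos (p j)) * (LINT q|torus n. of_real (cos (q j)) * f q))"

definition Ho_op ::
    "nat \<Rightarrow> real \<Rightarrow> ((nat \<Rightarrow> real) \<Rightarrow> complex) \<Rightarrow> (nat \<Rightarrow> real) \<Rightarrow> complex" where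
  "Ho_op n lam f p =
     of_real (dispersion n p) * f p
     - of_real (lam / (2 * pi) ^ n)
       * (\<Sum>j=1..n. of_real (sin (p j)) * (LINT q|torus n. of_real (sin (q j)) * f q))"

subsection \<open>Negative eigenvalues, counted with multiplicity\<close>

definition eigenspace ::
    "nat \<Rightarrow> real \<Rightarrow> real \<Rightarrow> real \<Rightarrow> ((nat \<Rightarrow> real) \<Rightarrow> complex) set" where
  "eigenspace n lam \<mu> z =
     {f \<in> Lp n 2. AE p in torus n. H_op n lam \<mu> f p = of_real z * f p}"

definition negative_eigenvalues :: "nat \<Rightarrow> real \<Rightarrow> real \<Rightarrow> real set" where
  "negative_eigenvalues n lam \<mu> = {z. z < 0 \<and> eigenspace n lam \<mu> z - null_functions n \<noteq> {}}"

text \<open>The number is infinite if there are infinitely many eigenvalues or one has infinite multiplicity.\<close>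

definition number_of_negative_eigenvalues :: "nat \<Rightarrow> real \<Rightarrow> real \<Rightarrow> enat" where
  "number_of_negative_eigenvalues n lam \<mu> =
     (if finite (negative_eigenvalues n lam \<mu>)
      then \<Sum>z\<in>negative_eigenvalues n lam \<mu>. quotient_dim (eigenspace n lam \<mu> z) (null_functions n)
      else \<infinity>)"

subsection \<open>Threshold solutions\<close>

text \<open>
  The Bochner integral of a non-integrable function is 0 by convention, so absolute convergence of
  every integral with nonzero coefficient has to be required explicitly.
\<close>

definition even_solutions :: "nat \<Rightarrow> real \<Rightarrow> real \<Rightarrow> ((nat \<Rightarrow> real) \<Rightarrow> complex) set" where
  "even_solutions n lam \<mu> =
     {f \<in> even_functions n.
        (\<mu> \<noteq> 0 \<longrightarrow> integrable (torus n) f) \<and>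
        (lam \<noteq> 0 \<longrightarrow> (\<forall>j\<in>{1..n}. integrable (torus n) (\<lambda>q. of_real (cos (q j)) * f q))) \<and>
        (AE p in torus n. He_op n lam \<mu> f p = 0)}"

definition odd_solutions :: "nat \<Rightarrow> real \<Rightarrow> ((nat \<Rightarrow> real) \<Rightarrow> complex) set" where
  "odd_solutions n lam =
     {f \<in> odd_functions n.
        (lam \<noteq> 0 \<longrightarrow> (\<forall>j\<in>{1..n}. integrable (torus n) (\<lambda>q. of_real (sin (q j)) * f q))) \<and>
        (AE p in torus n. Ho_op n lam f p = 0)}"

definition threshold_eigenvalue :: "nat \<Rightarrow> real \<Rightarrow> real \<Rightarrow> bool" where
  "threshold_eigenvalue n lam \<mu> \<longleftrightarrow>
     (\<exists>f \<in> even_solutions n lam \<mu> \<union> odd_solutions n lam. f \<notin> null_functions n \<and> f \<in> Lp n 2)"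

definition threshold_resonance :: "nat \<Rightarrow> real \<Rightarrow> real \<Rightarrow> bool" where
  "threshold_resonance n lam \<mu> \<longleftrightarrow>
     (\<exists>f \<in> even_solutions n lam \<mu> \<union> odd_solutions n lam.
        f \<notin> null_functions n \<and> f \<in> Lp n 1 - Lp n 2)"

definition super_threshold_resonance :: "nat \<Rightarrow> real \<Rightarrow> real \<Rightarrow> bool" where
  "super_threshold_resonance n lam \<mu> \<longleftrightarrow>
     (\<exists>f \<in> even_solutions n lam \<mu> \<union> odd_solutions n lam.
        f \<notin> null_functions n \<and> f \<notin> Lp n 1 \<and> (\<forall>\<epsilon>. 0 < \<epsilon> \<and> \<epsilon> < 1 \<longrightarrow> f \<in> Lp n \<epsilon>))"

definition threshold_eigenvalue_mult :: "nat \<Rightarrow> real \<Rightarrow> real \<Rightarrow> enat" where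
  "threshold_eigenvalue_mult n lam \<mu> =
     quotient_dim (even_solutions n lam \<mu> \<inter> Lp n 2) (null_functions n)
     + quotient_dim (odd_solutions n lam \<inter> Lp n 2) (null_functions n)"

definition threshold_resonance_mult :: "nat \<Rightarrow> real \<Rightarrow> real \<Rightarrow> enat" where
  "threshold_resonance_mult n lam \<mu> =
     quotient_dim (even_solutions n lam \<mu> \<inter> Lp n 1) (even_solutions n lam \<mu> \<inter> Lp n 2)
     + quotient_dim (odd_solutions n lam \<inter> Lp n 1) (odd_solutions n lam \<inter> Lp n 2)"

definition threshold_eigenvalue_of_mult :: "nat \<Rightarrow> real \<Rightarrow> real \<Rightarrow> nat \<Rightarrow> bool" where
  "threshold_eigenvalue_of_mult n lam \<mu> k \<longleftrightarrow>
     threshold_eigenvalue n lam \<mu> \<and> threshold_eigenvalue_mult n lam \<mu> = enat k"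

definition threshold_resonance_of_mult :: "nat \<Rightarrow> real \<Rightarrow> real \<Rightarrow> nat \<Rightarrow> bool" where
  "threshold_resonance_of_mult n lam \<mu> k \<longleftrightarrow>
     threshold_resonance n lam \<mu> \<and> threshold_resonance_mult n lam \<mu> = enat k"

subsection \<open>Regions of the parameter plane\<close>

definition a_int :: "nat \<Rightarrow> real \<Rightarrow> real" where
  "a_int n z = 1 / (2 * pi) ^ n * (LINT p|torus n. 1 / (dispersion n p - z))"

definition b_int :: "nat \<Rightarrow> real \<Rightarrow> real" where
  "b_int n z = 1 / (2 * pi) ^ n * (LINT p|torus n. cos (p 1) / (dispersion n p - z))"

definition X_asym :: "nat \<Rightarrow> real" where
  "X_asym n = (if n \<le> 2 then 1 else a_int n 0 / b_int n 0)"

definition H0_bar :: "nat \<Rightarrow> real \<Rightarrow> real \<Rightarrow> real" where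
  "H0_bar n lam \<mu> = (lam - X_asym n) * (\<mu> - real n) - real n"

definition \<Gamma>l :: "nat \<Rightarrow> (real \<times> real) set" where
  "\<Gamma>l n = {(lam, \<mu>). H0_bar n lam \<mu> = 0 \<and> lam < X_asym n}"

definition \<Gamma>r :: "nat \<Rightarrow> (real \<times> real) set" where
  "\<Gamma>r n = {(lam, \<mu>). H0_bar n lam \<mu> = 0 \<and> lam > X_asym n}"

definition G0 :: "nat \<Rightarrow> (real \<times> real) set" where
  "G0 n = {(lam, \<mu>). H0_bar n lam \<mu> > 0 \<and> lam < X_asym n}"

definition G1 :: "nat \<Rightarrow> (real \<times> real) set" where
  "G1 n = {(lam, \<mu>). H0_bar n lam \<mu> < 0}"

definition G2 :: "nat \<Rightarrow> (real \<times> real) set" where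
  "G2 n = {(lam, \<mu>). H0_bar n lam \<mu> > 0 \<and> lam > X_asym n}"

definition lam_s :: "nat \<Rightarrow> real" where
  "lam_s n = inverse (1 / (2 * pi) ^ n * (LINT p|torus n. (sin (p 1))\<^sup>2 / dispersion n p))"

definition lam_c :: "nat \<Rightarrow> real" where
  "lam_c n =
     inverse (1 / (2 * (2 * pi) ^ n)
       * (LINT p|torus n. (cos (p 1) - cos (p 2))\<^sup>2 / dispersion n p))"

definition S_minus :: "nat \<Rightarrow> (real \<times> real) set" where
  "S_minus n = {(lam, \<mu>). lam < lam_s n}"

definition S_zero :: "nat \<Rightarrow> (real \<times> real) set" where
  "S_zero n = {(lam, \<mu>). lam = lam_s n}"

definition S_plus :: "nat \<Rightarrow> (real \<times> real) set" where
  "S_plus n = {(lam, \<mu>). lam > lam_s n}"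

definition C_minus :: "nat \<Rightarrow> (real \<times> real) set" where
  "C_minus n = {(lam, \<mu>). lam < lam_c n}"

definition C_zero :: "nat \<Rightarrow> (real \<times> real) set" where
  "C_zero n = {(lam, \<mu>). lam = lam_c n}"

definition C_plus :: "nat \<Rightarrow> (real \<times> real) set" where
  "C_plus n = {(lam, \<mu>). lam > lam_c n}"

end

theory Submission
  imports Defs "HOL-Combinatorics.Permutations"
begin

text \<open>
  A solution of the eigenvalue equation at \<open>z \<le> 0\<close> has the form
  \<open>(\<mu> A + \<lambda> \<Sum>\<^sub>j (C\<^sub>j cos p\<^sub>j + S\<^sub>j sin p\<^sub>j)) / (E - z)\<close>, where \<open>A\<close>, \<open>C\<^sub>j\<close>, \<open>S\<^sub>j\<close> are its averages against
  \<open>1\<close>, \<open>cos p\<^sub>j\<close>, \<open>sin p\<^sub>j\<close>. Permutations and reflections of the coordinates split the resulting linear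
  system into three sectors: \<open>S\<^sub>j = \<lambda> s S\<^sub>j\<close>; \<open>C\<^sub>i - C\<^sub>j = \<lambda> c (C\<^sub>i - C\<^sub>j)\<close>; and a scalar equation
  \<open>\<Delta>(z) A = 0\<close>, with \<open>\<Delta>(z) = 0\<close> equivalent to \<open>(\<lambda> - a/b) (\<mu> - (n - z)) = n\<close>. Here \<open>s\<close>, \<open>c\<close>
  are the averages of \<open>sin\<^sup>2 p\<^sub>1\<close> and \<open>(cos p\<^sub>1 - cos p\<^sub>2)\<^sup>2 / 2\<close> against \<open>1 / (E - z)\<close>. As functions of \<open>z\<close>,
  \<open>s\<close> and \<open>c\<close> increase, and \<open>a/b\<close> decreases by Chebyshev's correlation inequality, so the intermediate
  value theorem counts the roots. At \<open>z = 0\<close> the integrability of \<open>1/E\<close> (for \<open>n \<ge> 3\<close>) and of \<open>1/E\<^sup>2\<close> (for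
  \<open>n \<ge> 5\<close>) decides between eigenvalues and resonances. The critical couplings satisfy
  \<open>X < \<lambda>\<^sub>s < \<lambda>\<^sub>c\<close>: for \<open>n \<ge> 3\<close> the first inequality is Chebyshev's inequality after
  integrating out one coordinate, the second follows by averaging over a group of order four of measure-preserving maps.
\<close>

text \<open>The delicate case is n = 2 at z = 0, where 1/E is not integrable and the determinant
  loses its meaning. Two devices cover it. The ratio a/b is rewritten as n / (n - z - 1/a), using n
  b = (n - z) a - 1; with the conventions that a non-integrable function has integral 0 and that 1/0
  = 0, this formula takes its limit value 1 at z = 0, so one continuous decreasing function serves
  all n \<ge> 2, and its value at 0 is X. At the threshold, moments are taken only against weights
  that tame 1/E: sines are bounded by a multiple of sqrt E, and 1 - cos p_j and cosine differences
  by E. The missing relation comes from averaging the equation without dividing by E: the cosines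
  sum to n - E, hence the C_j sum to (n - z - \<mu>) A. Every threshold solution turns out to be
  integrable, which excludes super-threshold resonances. The numerator at the origin, \<mu> A +
  \<lambda> \<Sum> C_j, decides whether an even solution is bounded or of size 1/E. Multiplicities
  come from pairing explicit solutions with moment functionals dual to them.\<close>

definition circle :: "real measure" where
  "circle = restrict_space lborel {-pi<..pi}"

lemma space_circle [simp]: "space circle = {-pi<..pi}"
  by (simp add: circle_def space_restrict_space)

lemma sets_circle: "A \<in> sets circle \<longleftrightarrow> A \<in> sets borel \<and> A \<subseteq> {-pi<..pi}"
  by (auto simp: circle_def sets_restrict_space_iff)

lemma emeasure_circle: "A \<in> sets circle \<Longrightarrow> emeasure circle A = emeasure lborel A"
  by (auto simp: circle_def sets_restrict_space_iff intro!: emeasure_restrict_space)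

lemma measurable_circleI [measurable_dest]:
  "f \<in> borel_measurable borel \<Longrightarrow> f \<in> borel_measurable circle"
  by (simp add: circle_def measurable_restrict_space1)

lemma finite_measure_circle: "finite_measure circle"
  by (rule finite_measureI) (subst emeasure_circle, auto simp: sets_circle)

lemma measure_circle: "measure circle (space circle) = 2 * pi"
  by (simp add: measure_def emeasure_circle sets_circle)

interpretation circle: finite_measure circle
  by (rule finite_measure_circle)

interpretation tor: product_sigma_finite "\<lambda>_::nat. circle"
  by (simp add: product_sigma_finite_def circle.sigma_finite_measure_axioms)

lemma torus_eq: "torus n = PiM {1..n} (\<lambda>_. circle)"
  by (simp add: torus_def circle_def)

lemma space_torus: "space (torus n) = (\<Pi>\<^sub>E j\<in>{1..n}. {-pi<..pi})"
  by (simp add: torus_eq space_PiM)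

lemma coord_measurable:
  assumes "j \<in> {1..n}"
  shows "(\<lambda>p. p j) \<in> borel_measurable (torus n)"
proof -
  have "(\<lambda>p. p j) \<in> measurable (torus n) circle"
    unfolding torus_eq using assms by (rule measurable_component_singleton)
  moreover have "(\<lambda>x. x) \<in> borel_measurable circle"
    by (rule measurable_circleI) simp
  ultimately show ?thesis
    by (rule measurable_compose)
qed

lemma finite_measure_torus: "finite_measure (torus n)"
proof (rule finite_measureI)
  have "emeasure (torus n) (\<Pi>\<^sub>E j\<in>{1..n}. space circle) = (\<Prod>j\<in>{1..n}. emeasure circle (space circle))"
    unfolding torus_eq by (rule tor.emeasure_PiM) (simp_all add: sets_circle)
  also have "\<dots> = ennreal (2 * pi) ^ n"
    by (simp add: emeasure_circle sets_circle)
  finally show "emeasure (torus n) (space (torus n)) \<noteq> \<infinity>"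
    by (simp add: space_torus ennreal_power)
qed

lemma measure_torus: "measure (torus n) (space (torus n)) = (2 * pi) ^ n"
proof -
  have "emeasure (torus n) (\<Pi>\<^sub>E j\<in>{1..n}. space circle) = (\<Prod>j\<in>{1..n}. emeasure circle (space circle))"
    unfolding torus_eq by (rule tor.emeasure_PiM) (simp_all add: sets_circle)
  also have "\<dots> = ennreal ((2 * pi) ^ n)"
    by (simp add: emeasure_circle sets_circle ennreal_power)
  finally show ?thesis
    by (simp add: space_torus measure_def)
qed

interpretation torus: finite_measure "torus n" for n
  by (rule finite_measure_torus)

subsection \<open>Measure-preserving maps\<close>

definition circle_map :: "(real \<Rightarrow> real) \<Rightarrow> bool" where
  "circle_map \<phi> \<longleftrightarrow> \<phi> \<in> measurable circle circle \<and> distr circle circle \<phi> = circle"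

text \<open>One family for all symmetries in use: coordinate permutations, reflections of single
  coordinates, p to -p and translations modulo 2 pi. Invariance of the measure is then proved only
  once.\<close>

definition torus_map :: "nat \<Rightarrow> (nat \<Rightarrow> nat) \<Rightarrow> (nat \<Rightarrow> real \<Rightarrow> real) \<Rightarrow> (nat \<Rightarrow> real) \<Rightarrow> nat \<Rightarrow> real"
  where "torus_map n \<sigma> \<phi> p = (\<lambda>j\<in>{1..n}. \<phi> j (p (\<sigma> j)))"

lemma circle_map_measurable: "circle_map \<phi> \<Longrightarrow> \<phi> \<in> measurable circle circle"
  by (simp add: circle_map_def)

lemma circle_map_vimage:
  assumes "circle_map \<phi>" "A \<in> sets circle"
  shows "\<phi> -` A \<inter> {-pi<..pi} \<in> sets circle"
    and "emeasure circle (\<phi> -` A \<inter> {-pi<..pi}) = emeasure circle A"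
proof -
  show "\<phi> -` A \<inter> {-pi<..pi} \<in> sets circle"
    using measurable_sets[OF circle_map_measurable[OF assms(1)] assms(2)] by simp
  have "emeasure circle A = emeasure (distr circle circle \<phi>) A"
    using assms(1) by (simp add: circle_map_def)
  also have "\<dots> = emeasure circle (\<phi> -` A \<inter> space circle)"
    by (rule emeasure_distr[OF circle_map_measurable[OF assms(1)] assms(2)])
  finally show "emeasure circle (\<phi> -` A \<inter> {-pi<..pi}) = emeasure circle A"
    by simp
qed

lemma circle_mapI:
  assumes [measurable]: "\<phi> \<in> borel_measurable borel"
    and "\<And>x. x \<in> {-pi<..pi} \<Longrightarrow> \<phi> x \<in> {-pi<..pi}"
    and "\<And>A. A \<in> sets circle \<Longrightarrow> emeasure lborel (\<phi> -` A \<inter> {-pi<..pi}) = emeasure lborel A"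
  shows "circle_map \<phi>"
proof -
  have m: "\<phi> \<in> measurable circle circle"
    unfolding circle_def
    by (rule measurable_restrict_space3) (use assms in auto)
  moreover have "distr circle circle \<phi> = circle"
  proof (rule measure_eqI)
    fix A assume "A \<in> sets (distr circle circle \<phi>)"
    then have A: "A \<in> sets circle" by simp
    have "\<phi> -` A \<inter> {-pi<..pi} \<in> sets circle"
      using measurable_sets[OF m A] by simp
    then show "emeasure (distr circle circle \<phi>) A = emeasure circle A"
      using assms(3)[OF A] A by (simp add: emeasure_distr[OF m A] emeasure_circle)
  qed simp
  ultimately show ?thesis
    by (simp add: circle_map_def)
qed

lemma circle_map_id: "circle_map (\<lambda>x. x)"
  by (rule circle_mapI) (auto simp: sets_circle Int_absorb2 )

definition circle_neg :: "real \<Rightarrow> real" where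
  "circle_neg x = (if x = pi then pi else - x)"

text \<open>Translation modulo 2 pi with at most one wrap, so shifts are taken in [0, 2 pi); a shift
  by -pi/2 appears as 3 pi/2.\<close>

definition circle_shift :: "real \<Rightarrow> real \<Rightarrow> real" where
  "circle_shift s x = (if x + s \<le> pi then x + s else x + s - 2 * pi)"

lemma emeasure_lborel_vimage_plus:
  assumes "A \<in> sets borel"
  shows "emeasure lborel ((\<lambda>x::real. x + c) -` A) = emeasure lborel A"
proof -
  have "(\<lambda>x. x + c) = (+) c"
    by (simp add: fun_eq_iff)
  then show ?thesis
    using emeasure_distr[of "(+) c" lborel borel A] lborel_distr_plus[of c] assms by simp
qed

lemma emeasure_lborel_vimage_minus:
  "A \<in> sets borel \<Longrightarrow> emeasure lborel ((\<lambda>x::real. - x) -` A) = emeasure lborel A"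
  using emeasure_distr[of uminus lborel borel A] lborel_distr_uminus by simp

lemma circle_map_neg: "circle_map circle_neg"
proof (rule circle_mapI)
  show [measurable]: "circle_neg \<in> borel_measurable borel"
    unfolding circle_neg_def by measurable
  fix A assume A: "A \<in> sets circle"
  then have Ab [measurable]: "A \<in> sets borel" and sub: "A \<subseteq> {-pi<..pi}"
    by (auto simp: sets_circle)
  \<comment> \<open>The two preimages can differ only at \<plusminus>pi, because the half-open
    interval contains pi but not -pi.\<close>
  have eq: "AE x in lborel. x \<in> circle_neg -` A \<inter> {-pi<..pi} \<longleftrightarrow> x \<in> uminus -` A"
    using AE_lborel_singleton[of pi] AE_lborel_singleton[of "-pi"]
  proof eventually_elim
    case (elim x)
    then show ?case using sub by (auto simp: circle_neg_def)
  qed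
  have "emeasure lborel (circle_neg -` A \<inter> {-pi<..pi}) = emeasure lborel (uminus -` A)"
    by (rule emeasure_eq_AE[OF eq])
      (auto intro!: measurable_sets_borel[where M = lborel] sets.Int simp: measurable_lborel1)
  then show "emeasure lborel (circle_neg -` A \<inter> {-pi<..pi}) = emeasure lborel A"
    using emeasure_lborel_vimage_minus[OF Ab] by simp
qed (auto simp: circle_neg_def)

lemma circle_map_shift:
  assumes s: "0 \<le> s" "s < 2 * pi"
  shows "circle_map (circle_shift s)"
proof (rule circle_mapI)
  show [measurable]: "circle_shift s \<in> borel_measurable borel"
    unfolding circle_shift_def by measurable
  fix A assume A: "A \<in> sets circle"
  then have Ab [measurable]: "A \<in> sets borel" and sub: "A \<subseteq> {-pi<..pi}"
    by (auto simp: sets_circle)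
  \<comment> \<open>The cut at -pi + s separates the values reached without wrapping from those
    reached after subtracting 2 pi; the preimage of each piece is a plain translate.\<close>
  let ?A1 = "A \<inter> {-pi+s<..}" and ?A2 = "A \<inter> {..-pi+s}"
  have mem: "-pi < y \<and> y \<le> pi" if "y \<in> A" for y
    using sub that by auto
  have eq: "circle_shift s -` A \<inter> {-pi<..pi} =
      (\<lambda>x. x + s) -` ?A1 \<union> (\<lambda>x. x + (s - 2 * pi)) -` ?A2"
  proof (intro set_eqI iffI)
    fix x assume "x \<in> circle_shift s -` A \<inter> {-pi<..pi}"
    then show "x \<in> (\<lambda>x. x + s) -` ?A1 \<union> (\<lambda>x. x + (s - 2 * pi)) -` ?A2"
      by (auto simp: circle_shift_def add_diff_eq split: if_splits)
  next
    fix x assume "x \<in> (\<lambda>x. x + s) -` ?A1 \<union> (\<lambda>x. x + (s - 2 * pi)) -` ?A2"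
    then show "x \<in> circle_shift s -` A \<inter> {-pi<..pi}"
      using mem[of "x + s"] mem[of "x + s - 2 * pi"] s
      by (auto simp: circle_shift_def add_diff_eq)
  qed
  have "emeasure lborel (circle_shift s -` A \<inter> {-pi<..pi}) =
      emeasure lborel ((\<lambda>x. x + s) -` ?A1) + emeasure lborel ((\<lambda>x. x + (s - 2 * pi)) -` ?A2)"
    unfolding eq
  proof (rule plus_emeasure[symmetric])
    show "(\<lambda>x. x + s) -` ?A1 \<in> sets lborel" "(\<lambda>x. x + (s - 2 * pi)) -` ?A2 \<in> sets lborel"
      by (auto intro!: measurable_sets_borel[where M = lborel] simp: measurable_lborel1)
    show "(\<lambda>x. x + s) -` ?A1 \<inter> (\<lambda>x. x + (s - 2 * pi)) -` ?A2 = {}"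
    proof -
      have False if "x + s \<in> A" "x + (s - 2 * pi) \<in> A" for x
        using mem[OF that(1)] mem[OF that(2)] by simp
      then show ?thesis by blast
    qed
  qed
  also have "\<dots> = emeasure lborel ?A1 + emeasure lborel ?A2"
    by (subst (1 2) emeasure_lborel_vimage_plus) auto
  also have "\<dots> = emeasure lborel (?A1 \<union> ?A2)"
    by (rule plus_emeasure) auto
  also have "?A1 \<union> ?A2 = A"
    by auto
  finally show "emeasure lborel (circle_shift s -` A \<inter> {-pi<..pi}) = emeasure lborel A" .
qed (use s in \<open>auto simp: circle_shift_def\<close>)

lemma cos_circle_neg [simp]: "cos (circle_neg x) = cos x"
  and sin_circle_neg [simp]: "sin (circle_neg x) = - sin x"
  by (auto simp: circle_neg_def)

lemma cos_circle_shift: "cos (circle_shift s x) = cos (x + s)"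
  and sin_circle_shift: "sin (circle_shift s x) = sin (x + s)"
  by (auto simp: circle_shift_def sin_diff cos_diff)

lemma torus_map_measurable:
  assumes "\<sigma> permutes {1..n}" "\<And>j. j \<in> {1..n} \<Longrightarrow> circle_map (\<phi> j)"
  shows "torus_map n \<sigma> \<phi> \<in> measurable (torus n) (torus n)"
  unfolding torus_map_def torus_eq
proof (rule measurable_restrict)
  fix j assume j: "j \<in> {1..n}"
  then have "\<sigma> j \<in> {1..n}"
    using permutes_in_image[OF assms(1)] by blast
  then have "(\<lambda>p. p (\<sigma> j)) \<in> measurable (PiM {1..n} (\<lambda>_. circle)) circle"
    by (rule measurable_component_singleton)
  then show "(\<lambda>p. \<phi> j (p (\<sigma> j))) \<in> measurable (PiM {1..n} (\<lambda>_. circle)) circle"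
    by (rule measurable_compose) (rule circle_map_measurable[OF assms(2)[OF j]])
qed

text \<open>A product measure is determined by its values on boxes, and the preimage of a box is
  again a box: its factors are pulled back by the circle maps and permuted by
  \<open>inv \<sigma>\<close>, which leaves the product of their measures unchanged.\<close>

lemma distr_torus_map:
  assumes \<sigma>: "\<sigma> permutes {1..n}" and \<phi>: "\<And>j. j \<in> {1..n} \<Longrightarrow> circle_map (\<phi> j)"
  shows "distr (torus n) (torus n) (torus_map n \<sigma> \<phi>) = torus n"
proof -
  have "distr (torus n) (torus n) (torus_map n \<sigma> \<phi>) = PiM {1..n} (\<lambda>_. circle)"
  proof (rule tor.PiM_eqI)
    fix A :: "nat \<Rightarrow> real set"
    assume A: "\<And>i. i \<in> {1..n} \<Longrightarrow> A i \<in> sets circle"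
    let ?B = "\<lambda>i. \<phi> (inv \<sigma> i) -` A (inv \<sigma> i) \<inter> {-pi<..pi}"
    have inv_in: "inv \<sigma> i \<in> {1..n}" if "i \<in> {1..n}" for i
      using permutes_in_image[OF permutes_inv[OF \<sigma>]] that by blast
    have \<sigma>_in: "\<sigma> i \<in> {1..n}" if "i \<in> {1..n}" for i
      using permutes_in_image[OF \<sigma>] that by blast
    have set_eq: "torus_map n \<sigma> \<phi> -` (\<Pi>\<^sub>E i\<in>{1..n}. A i) \<inter> space (torus n) = (\<Pi>\<^sub>E i\<in>{1..n}. ?B i)"
    proof (intro set_eqI iffI)
      fix p assume p: "p \<in> torus_map n \<sigma> \<phi> -` (\<Pi>\<^sub>E i\<in>{1..n}. A i) \<inter> space (torus n)"
      then have "\<phi> j (p (\<sigma> j)) \<in> A j" if "j \<in> {1..n}" for j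
        using that by (auto simp: torus_map_def PiE_def Pi_def)
      from this[OF inv_in] have "\<phi> (inv \<sigma> i) (p i) \<in> A (inv \<sigma> i)" if "i \<in> {1..n}" for i
        using that by (simp add: permutes_inverses[OF \<sigma>])
      then show "p \<in> (\<Pi>\<^sub>E i\<in>{1..n}. ?B i)"
        using p by (auto simp: space_torus PiE_def Pi_def)
    next
      fix p assume p: "p \<in> (\<Pi>\<^sub>E i\<in>{1..n}. ?B i)"
      have "\<phi> j (p (\<sigma> j)) \<in> A j" if "j \<in> {1..n}" for j
        using PiE_mem[OF p \<sigma>_in[OF that]] by (simp add: permutes_inverses[OF \<sigma>])
      then show "p \<in> torus_map n \<sigma> \<phi> -` (\<Pi>\<^sub>E i\<in>{1..n}. A i) \<inter> space (torus n)"
        using p by (auto simp: torus_map_def space_torus PiE_def Pi_def)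
    qed
    have "(\<Pi>\<^sub>E i\<in>{1..n}. A i) \<in> sets (torus n)"
      unfolding torus_eq using A by (intro sets_PiM_I_finite) auto
    then have "emeasure (distr (torus n) (torus n) (torus_map n \<sigma> \<phi>)) (\<Pi>\<^sub>E i\<in>{1..n}. A i)
        = emeasure (torus n) (\<Pi>\<^sub>E i\<in>{1..n}. ?B i)"
      by (simp only: emeasure_distr[OF torus_map_measurable[OF \<sigma> \<phi>]] set_eq)
    also have "\<dots> = (\<Prod>i\<in>{1..n}. emeasure circle (?B i))"
      unfolding torus_eq
      by (rule tor.emeasure_PiM) (use circle_map_vimage(1)[OF \<phi> A] inv_in in auto)
    also have "\<dots> = (\<Prod>i\<in>{1..n}. emeasure circle (A (inv \<sigma> i)))"
      by (rule prod.cong[OF refl]) (use circle_map_vimage(2)[OF \<phi> A] inv_in in auto)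
    also have "\<dots> = (\<Prod>i\<in>{1..n}. emeasure circle (A i))"
      using prod.permute[OF permutes_inv[OF \<sigma>], of "\<lambda>i. emeasure circle (A i)"]
      by (simp add: comp_def)
    finally show "emeasure (distr (torus n) (torus n) (torus_map n \<sigma> \<phi>)) (\<Pi>\<^sub>E i\<in>{1..n}. A i)
        = (\<Prod>i\<in>{1..n}. emeasure circle (A i))" .
  qed (auto simp: torus_eq)
  then show ?thesis
    by (simp add: torus_eq)
qed

lemma
  fixes f :: "(nat \<Rightarrow> real) \<Rightarrow> 'b :: {banach, second_countable_topology}"
  assumes \<sigma>: "\<sigma> permutes {1..n}" and \<phi>: "\<And>j. j \<in> {1..n} \<Longrightarrow> circle_map (\<phi> j)"
    and [measurable]: "f \<in> borel_measurable (torus n)"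
  shows integral_torus_map: "(LINT p|torus n. f (torus_map n \<sigma> \<phi> p)) = integral\<^sup>L (torus n) f"
    and integrable_torus_map: "integrable (torus n) (\<lambda>p. f (torus_map n \<sigma> \<phi> p)) \<longleftrightarrow> integrable (torus n) f"
    and measurable_torus_map: "(\<lambda>p. f (torus_map n \<sigma> \<phi> p)) \<in> borel_measurable (torus n)"
proof -
  note m = torus_map_measurable[OF \<sigma> \<phi>]
  show "(LINT p|torus n. f (torus_map n \<sigma> \<phi> p)) = integral\<^sup>L (torus n) f"
    using integral_distr[OF m, where f = f] distr_torus_map[OF \<sigma> \<phi>] by simp
  show "integrable (torus n) (\<lambda>p. f (torus_map n \<sigma> \<phi> p)) \<longleftrightarrow> integrable (torus n) f"
    using integrable_distr_eq[OF m, where f = f] distr_torus_map[OF \<sigma> \<phi>] by simp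
  show "(\<lambda>p. f (torus_map n \<sigma> \<phi> p)) \<in> borel_measurable (torus n)"
    using m by measurable
qed

lemma AE_torus_map:
  assumes \<sigma>: "\<sigma> permutes {1..n}" and \<phi>: "\<And>j. j \<in> {1..n} \<Longrightarrow> circle_map (\<phi> j)"
    and "AE p in torus n. P p"
  shows "AE p in torus n. P (torus_map n \<sigma> \<phi> p)"
  by (rule AE_distrD[OF torus_map_measurable[OF \<sigma> \<phi>]])
    (simp_all only: distr_torus_map[OF \<sigma> \<phi>] assms)

subsection \<open>The dispersion relation near its zero\<close>

lemma cos_coord_measurable [measurable]: "j \<in> {1..n} \<Longrightarrow> (\<lambda>p. cos (p j)) \<in> borel_measurable (torus n)"
  and sin_coord_measurable [measurable]: "j \<in> {1..n} \<Longrightarrow> (\<lambda>p. sin (p j)) \<in> borel_measurable (torus n)"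
  using measurable_compose[OF coord_measurable, of j n cos borel]
    measurable_compose[OF coord_measurable, of j n sin borel] by simp_all

lemma dispersion_measurable [measurable]: "dispersion n \<in> borel_measurable (torus n)"
  unfolding dispersion_def by measurable

lemma dispersion_nonneg: "0 \<le> dispersion n p"
  unfolding dispersion_def by (intro sum_nonneg) simp

lemma one_minus_cos_le_dispersion: "j \<in> {1..n} \<Longrightarrow> 1 - cos (p j) \<le> dispersion n p"
  unfolding dispersion_def by (rule member_le_sum) auto

lemma dispersion_le: "dispersion n p \<le> 2 * real n"
proof -
  have "dispersion n p \<le> (\<Sum>j=1..n. 2)"
    unfolding dispersion_def by (intro sum_mono) (smt (verit) cos_ge_minus_one)
  then show ?thesis by simp
qed

lemma sum_cos_eq: "(\<Sum>j=1..n. cos (p j)) = real n - dispersion n p"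
  by (simp add: dispersion_def sum_subtractf)

lemma one_minus_cos_eq: "1 - cos x = 2 * (sin (x / 2))\<^sup>2" for x :: real
  using cos_double_sin[of "x / 2"] by simp

text \<open>Concavity of sine gives Jordan's inequality sin (x/2) \<ge> x/pi on [0, pi], which is
  then squared in the half-angle formula. This quadratic lower bound yields the integrability
  results for powers of 1/E; the quadratic upper bound that follows it yields the divergence
  results.\<close>

lemma one_minus_cos_ge:
  assumes "\<bar>x\<bar> \<le> pi"
  shows "2 * (x / pi)\<^sup>2 \<le> 1 - cos x"
proof -
  have "convex_on {0..pi} (\<lambda>x. - sin x)"
    by (rule f''_ge0_imp_convex[where f' = "\<lambda>x. - cos x" and f'' = sin])
      (auto intro!: derivative_eq_intros simp: sin_ge_zero)
  from convex_onD[OF this, of "\<bar>x\<bar> / pi" 0 "pi / 2"]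
  have "\<bar>x\<bar> / pi \<le> sin (\<bar>x\<bar> / 2)"
    using assms by simp
  then have "(\<bar>x\<bar> / pi)\<^sup>2 \<le> (sin (\<bar>x\<bar> / 2))\<^sup>2"
    by (intro power_mono) auto
  moreover have "(sin (\<bar>x\<bar> / 2))\<^sup>2 = (sin (x / 2))\<^sup>2"
    by (cases "x \<ge> 0") auto
  ultimately show ?thesis
    by (simp add: one_minus_cos_eq power_divide)
qed

lemma one_minus_cos_le: "1 - cos x \<le> x\<^sup>2 / 2" for x :: real
proof -
  have "\<bar>sin (x / 2)\<bar>\<^sup>2 \<le> \<bar>x / 2\<bar>\<^sup>2"
    by (intro power_mono abs_sin_x_le_abs_x) auto
  then show ?thesis
    by (simp add: one_minus_cos_eq power_divide)
qed

section \<open>Null hyperplanes and boxes of positive measure\<close>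

lemma emeasure_torus_box:
  assumes "\<And>j. j \<in> {1..n} \<Longrightarrow> A j \<in> sets circle"
  shows "(\<Pi>\<^sub>E j\<in>{1..n}. A j) \<in> sets (torus n)"
    and "emeasure (torus n) (\<Pi>\<^sub>E j\<in>{1..n}. A j) = (\<Prod>j\<in>{1..n}. emeasure circle (A j))"
  unfolding torus_eq using assms by (auto intro!: sets_PiM_I_finite tor.emeasure_PiM)

lemma AE_coord_neq:
  assumes j: "j \<in> {1..n}"
  shows "AE p in torus n. p j \<noteq> c"
proof -
  let ?A = "\<lambda>i. if i = j then {c} \<inter> {-pi<..pi} else {-pi<..pi}"
  have s: "?A i \<in> sets circle" for i
    by (auto simp: sets_circle)
  have "emeasure (torus n) (\<Pi>\<^sub>E i\<in>{1..n}. ?A i) = (\<Prod>i\<in>{1..n}. emeasure circle (?A i))"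
    using s by (intro emeasure_torus_box) auto
  also have "\<dots> = 0"
  proof (rule prod_zero)
    have "emeasure circle (?A j) = emeasure lborel (?A j)"
      by (rule emeasure_circle[OF s])
    also have "\<dots> \<le> emeasure lborel {c}"
      by (intro emeasure_mono) auto
    finally show "\<exists>i\<in>{1..n}. emeasure circle (?A i) = 0"
      using j by auto
  qed simp
  finally have "(\<Pi>\<^sub>E i\<in>{1..n}. ?A i) \<in> null_sets (torus n)"
    using emeasure_torus_box(1)[of n ?A] s by auto
  then show ?thesis
    by (rule AE_I') (use j in \<open>auto simp: space_torus PiE_def Pi_def\<close>)
qed

lemma AE_all_coord_neq: "AE p in torus n. \<forall>j\<in>{1..n}. p j \<noteq> c"
  by (subst AE_finite_all) (auto intro: AE_coord_neq)

lemma one_minus_cos_pos: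
  assumes "x \<in> {-pi<..pi}" "x \<noteq> 0"
  shows "0 < 1 - cos x"
proof -
  have "0 < 2 * (x / pi)\<^sup>2" using assms by simp
  also have "\<dots> \<le> 1 - cos x" using assms by (intro one_minus_cos_ge) auto
  finally show ?thesis .
qed

lemma AE_one_minus_cos_pos: "AE p in torus n. \<forall>j\<in>{1..n}. 0 < 1 - cos (p j)"
  using AE_all_coord_neq[of n 0] AE_space
proof eventually_elim
  case (elim p)
  then show ?case
    by (auto simp only: space_torus PiE_iff intro!: one_minus_cos_pos)
qed

lemma AE_dispersion_pos:
  assumes "n \<ge> 1"
  shows "AE p in torus n. 0 < dispersion n p"
  using AE_one_minus_cos_pos
proof eventually_elim
  case (elim p)
  then have "0 < 1 - cos (p 1)" using assms by auto
  then show ?case using one_minus_cos_le_dispersion[of 1 n p] assms by simp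
qed

text \<open>A nondegenerate box has positive measure and so meets every set of full measure. This is
  the device for refuting almost-everywhere identities, on which the strictness of the later
  inequalities rests.\<close>

lemma AE_torus_box_ex:
  assumes "AE p in torus n. P p" "\<And>j. j \<in> {1..n} \<Longrightarrow> l j < u j \<and> -pi \<le> l j \<and> u j \<le> pi"
  obtains p where "P p" "\<And>j. j \<in> {1..n} \<Longrightarrow> l j < p j \<and> p j \<le> u j"
proof -
  let ?B = "\<Pi>\<^sub>E j\<in>{1..n}. {l j<..u j}"
  have s: "{l j<..u j} \<in> sets circle" if "j \<in> {1..n}" for j
    using assms(2)[OF that] by (auto simp: sets_circle)
  have "emeasure (torus n) ?B = (\<Prod>j\<in>{1..n}. emeasure circle {l j<..u j})"
    by (rule emeasure_torus_box(2)) (rule s)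
  also have "\<dots> \<noteq> 0"
    using assms(2) by (force simp: emeasure_circle[OF s] prod_zero_iff less_imp_le)
  finally have ne: "emeasure (torus n) ?B \<noteq> 0" .
  have "\<not> (AE p in torus n. p \<notin> ?B)"
  proof
    assume "AE p in torus n. p \<notin> ?B"
    then have "?B \<in> null_sets (torus n)"
      using emeasure_torus_box(1)[of n "\<lambda>j. {l j<..u j}", OF s] by (simp add: AE_iff_null_sets)
    then show False using ne by auto
  qed
  moreover have "AE p in torus n. p \<notin> ?B" if "\<And>p. P p \<Longrightarrow> p \<notin> ?B"
    using assms(1) by eventually_elim (rule that)
  ultimately obtain p where "P p" "p \<in> ?B"
    by blast
  then show ?thesis
    using that by (auto simp: PiE_iff)
qed

section \<open>Integrability of powers of the dispersion relation\<close>

lemma integrable_abs_powr: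
  assumes "a > -1"
  shows "integrable circle (\<lambda>x. \<bar>x\<bar> powr a)"
proof -
  let ?g = "\<lambda>x::real. indicator {0..pi} x *\<^sub>R (x powr a)"
  have "(\<lambda>x. x powr a) absolutely_integrable_on {0..pi}"
    using has_integral_powr_from_0[OF assms, of pi] nonnegative_absolutely_integrable_1
    by (auto simp: integrable_on_def intro!: nonnegative_absolutely_integrable_1)
  then have g: "integrable lborel ?g"
    unfolding set_integrable_def by (subst integrable_completion[symmetric]) auto
  have "integrable lborel (\<lambda>x. ?g x + ?g (0 + (-1) * x))"
    using g lborel_integrable_real_affine[OF g, of "-1" 0] by (intro Bochner_Integration.integrable_add) auto
  then have "integrable lborel (\<lambda>x. indicator {-pi<..pi} x *\<^sub>R (\<bar>x\<bar> powr a))"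
    by (rule Bochner_Integration.integrable_bound) (auto simp: indicator_def)
  then show ?thesis
    unfolding circle_def by (subst integrable_restrict_space) auto
qed

lemma integrable_one_minus_cos_powr:
  assumes "0 \<le> k" "k < 1 / 2"
  shows "integrable circle (\<lambda>x. (1 - cos x) powr (- k))"
proof (rule Bochner_Integration.integrable_bound)
  show "integrable circle (\<lambda>x. (2 / pi\<^sup>2) powr (- k) * \<bar>x\<bar> powr (- 2 * k))"
    using assms by (intro integrable_mult_right integrable_abs_powr) auto
  show "(\<lambda>x. (1 - cos x) powr (- k)) \<in> borel_measurable circle"
    by (rule measurable_circleI) measurable
  have "(1 - cos x) powr (- k) \<le> (2 / pi\<^sup>2) powr (- k) * \<bar>x\<bar> powr (- 2 * k)"
    if x: "x \<in> {-pi<..pi}" for x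
  proof (cases "x = 0")
    case False
    have "(1 - cos x) powr (- k) \<le> (2 / pi\<^sup>2 * \<bar>x\<bar>\<^sup>2) powr (- k)"
      using one_minus_cos_ge[of x] x False assms
      by (intro powr_mono2') (auto simp: power_divide)
    also have "\<dots> = (2 / pi\<^sup>2) powr (- k) * (\<bar>x\<bar>\<^sup>2) powr (- k)"
      by (subst powr_mult) auto
    also have "(\<bar>x\<bar>\<^sup>2) powr (- k) = \<bar>x\<bar> powr (- 2 * k)"
    proof -
      have "(\<bar>x\<bar> powr 2) powr (- k) = \<bar>x\<bar> powr (- 2 * k)"
        by (subst powr_powr) simp
      moreover have "\<bar>x\<bar> powr 2 = \<bar>x\<bar>\<^sup>2"
        using False by (subst powr_numeral) auto
      ultimately show ?thesis
        by (simp only:)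
    qed
    finally show ?thesis .
  qed simp
  then show "AE x in circle. norm ((1 - cos x) powr (- k)) \<le>
      norm ((2 / pi\<^sup>2) powr (- k) * \<bar>x\<bar> powr (- 2 * k))"
    by (intro AE_I2) auto
qed

text \<open>With m = card J, the power -k of the sum splits into m equal factors of exponent -k/m,
  and in the j-th one the sum may be replaced by its j-th summand. The resulting product of
  one-variable functions is integrable since k/m < 1/2, so no polar coordinates are required.
  Besides the full index set, J = {2..n} occurs when the first coordinate is integrated out.\<close>

lemma integrable_partial_dispersion_powr:
  fixes k :: real
  assumes k: "0 \<le> k" "2 * k < card J" and J: "J \<subseteq> {1..n}"
  shows "integrable (torus n) (\<lambda>p. (\<Sum>j\<in>J. 1 - cos (p j)) powr (- k))"
proof (rule Bochner_Integration.integrable_bound)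
  define m where "m = card J"
  have fin: "finite J" using J by (rule finite_subset) simp
  have m: "0 < m" using k by (cases "card J") (auto simp: m_def)
  show "integrable (torus n) (\<lambda>p. \<Prod>j\<in>{1..n}. if j \<in> J then (1 - cos (p j)) powr (- (k / m)) else 1)"
    unfolding torus_eq
  proof (rule tor.product_integrable_prod)
    fix j
    show "integrable circle (\<lambda>x. if j \<in> J then (1 - cos x) powr (- (k / m)) else 1)"
    proof (cases "j \<in> J")
      case True
      have "integrable circle (\<lambda>x. (1 - cos x) powr (- (k / m)))"
        using k m by (intro integrable_one_minus_cos_powr) (auto simp: field_simps m_def)
      then show ?thesis using True by simp
    qed simp
  qed simp
  show "AE p in torus n. norm ((\<Sum>j\<in>J. 1 - cos (p j)) powr (- k)) \<le>
      norm (\<Prod>j\<in>{1..n}. if j \<in> J then (1 - cos (p j)) powr (- (k / m)) else 1)"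
    using AE_one_minus_cos_pos
  proof eventually_elim
    case (elim p)
    let ?E = "\<Sum>j\<in>J. 1 - cos (p j)"
    have le: "1 - cos (p j) \<le> ?E" if "j \<in> J" for j
      using that fin by (intro member_le_sum) auto
    have pos: "0 < 1 - cos (p j)" if "j \<in> J" for j
      using elim J that by auto
    obtain i where "i \<in> J" using m by (fastforce simp: m_def)
    then have E: "0 < ?E" using le pos by fastforce
    have "?E powr (- k) = (\<Prod>j\<in>J. ?E powr (- (k / m)))"
      using E m by (simp add: powr_power m_def)
    also have "\<dots> \<le> (\<Prod>j\<in>J. (1 - cos (p j)) powr (- (k / m)))"
      using k le pos by (intro prod_mono conjI powr_mono2') auto
    also have "\<dots> = (\<Prod>j\<in>{1..n}. if j \<in> J then (1 - cos (p j)) powr (- (k / m)) else 1)"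
      using J by (simp add: prod.If_cases Int_absorb1)
    finally show ?case
      by (simp add: prod_nonneg)
  qed
  show "(\<lambda>p. (\<Sum>j\<in>J. 1 - cos (p j)) powr (- k)) \<in> borel_measurable (torus n)"
  proof -
    have [measurable]: "(\<lambda>p. \<Sum>j\<in>J. 1 - cos (p j)) \<in> borel_measurable (torus n)"
      using J by (intro borel_measurable_sum borel_measurable_diff) auto
    show ?thesis by measurable
  qed
qed

lemma integrable_dispersion_powr:
  assumes "0 \<le> k" "2 * k < real n"
  shows "integrable (torus n) (\<lambda>p. dispersion n p powr (- k))"
  unfolding dispersion_def using assms by (intro integrable_partial_dispersion_powr) auto

lemma integrable_inverse_dispersion:
  assumes "2 * k < n"
  shows "integrable (torus n) (\<lambda>p. 1 / dispersion n p ^ k)"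
proof (rule Bochner_Integration.integrable_bound)
  show "integrable (torus n) (\<lambda>p. dispersion n p powr (- real k))"
    using assms by (intro integrable_dispersion_powr) auto
  have "n \<ge> 1" using assms by auto
  then show "AE p in torus n. norm (1 / dispersion n p ^ k) \<le> norm (dispersion n p powr (- real k))"
    by (rule AE_mp[OF AE_dispersion_pos])
      (auto intro!: AE_I2 simp: powr_minus powr_realpow field_simps)
qed measurable

text \<open>On the cube of half side r around 0 the dispersion is at most n r^2 / 2, so the integral
  over that cube is at least (2 / (n r^2))^k (2 r)^n. For n \<le> 2 k and r \<le> 1 this stays above
  a positive constant, whereas dominated convergence would send it to 0 with r.\<close>

lemma not_integrable_inverse_dispersion:
  assumes n: "1 \<le> n" "n \<le> 2 * k"
  shows "\<not> integrable (torus n) (\<lambda>p. 1 / dispersion n p ^ k)"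
proof
  assume int: "integrable (torus n) (\<lambda>p. 1 / dispersion n p ^ k)"
  define r where "r i = 1 / real (Suc i)" for i
  have r: "0 < r i" "r i \<le> 1" for i
    by (auto simp: r_def)
  define Q where "Q i = (\<Pi>\<^sub>E j\<in>{1..n}. {- r i<..r i})" for i
  \<comment> \<open>The lower bound at r = 1; for smaller r it is multiplied by r^n / r^(2k) \<ge>
    1.\<close>
  define c where "c = (2 / n) ^ k * 2 ^ n"
  have c: "c > 0" using n by (simp add: c_def)
  have rpi: "r i < pi" for i
    using r(2)[of i] pi_gt3 by linarith
  have s: "{- r i<..r i} \<in> sets circle" for i
    using rpi[of i] by (auto simp: sets_circle)
  have Q [measurable]: "Q i \<in> sets (torus n)" for i
    unfolding Q_def using s by (intro emeasure_torus_box) auto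
  have mQ: "measure (torus n) (Q i) = (2 * r i) ^ n" for i
  proof -
    have "emeasure (torus n) (Q i) = (\<Prod>j\<in>{1..n}. emeasure circle {- r i<..r i})"
      unfolding Q_def using s by (intro emeasure_torus_box) auto
    also have "\<dots> = ennreal ((2 * r i) ^ n)"
      using r(1)[of i] s[of i] by (simp add: emeasure_circle ennreal_power)
    finally show ?thesis
      using r(1)[of i] by (simp add: measure_def)
  qed
  let ?s = "\<lambda>i p. indicator (Q i) p * (1 / dispersion n p ^ k)"
  have "(\<lambda>i. LINT p|torus n. ?s i p) \<longlonglongrightarrow> (LINT p|torus n. 0)"
  proof (rule integral_dominated_convergence[OF _ _ int])
    show "AE p in torus n. (\<lambda>i. ?s i p) \<longlonglongrightarrow> 0"
      using AE_all_coord_neq[of n 0]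
    proof eventually_elim
      case (elim p)
      then have p: "\<bar>p 1\<bar> > 0" using n by auto
      have "r \<longlonglongrightarrow> 0"
        unfolding r_def using LIMSEQ_inverse_real_of_nat by (simp add: inverse_eq_divide)
      from order_tendstoD(2)[OF this p] have "eventually (\<lambda>i. ?s i p = 0) sequentially"
      proof eventually_elim
        case (elim i)
        then have "p 1 \<notin> {- r i<..r i}" by auto
        then have "p \<notin> Q i" using n by (auto simp: Q_def PiE_iff)
        then show ?case by simp
      qed
      then show ?case by (rule tendsto_eventually)
    qed
    show "AE p in torus n. norm (?s i p) \<le> 1 / dispersion n p ^ k" for i
      by (intro AE_I2) (auto simp: indicator_def dispersion_nonneg)
  qed measurable
  moreover have "c \<le> (LINT p|torus n. ?s i p)" for i
  proof -
    have "c \<le> (2 / (n * (r i)\<^sup>2)) ^ k * (2 * r i) ^ n"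
    proof -
      have "r i ^ (2 * k) \<le> r i ^ n"
        using r[of i] n by (intro power_decreasing) auto
      then have "1 \<le> r i ^ n / r i ^ (2 * k)"
        using r(1)[of i] by simp
      then have "c * 1 \<le> c * (r i ^ n / r i ^ (2 * k))"
        using c by (intro mult_left_mono) auto
      then show ?thesis
        using r(1)[of i] n by (simp add: c_def power_divide power_mult_distrib power_mult)
    qed
    also have "\<dots> = (LINT p|torus n. indicator (Q i) p * (2 / (n * (r i)\<^sup>2)) ^ k)"
      using mQ[of i] sets.sets_into_space[OF Q[of i]] by (simp add: Int_absorb2)
    also have "\<dots> \<le> (LINT p|torus n. ?s i p)"
    proof (rule integral_mono_AE)
      show "integrable (torus n) (\<lambda>p. indicator (Q i) p * (2 / (n * (r i)\<^sup>2)) ^ k)"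
        by (intro integrable_mult_left integrable_real_indicator)
          (auto simp: less_top[symmetric])
      show "integrable (torus n) (?s i)"
        using int by (rule Bochner_Integration.integrable_bound) (auto simp: indicator_def)
      show "AE p in torus n. indicator (Q i) p * (2 / (n * (r i)\<^sup>2)) ^ k \<le> ?s i p"
        using AE_dispersion_pos[OF n(1)]
      proof eventually_elim
        case (elim p)
        show ?case
        proof (cases "p \<in> Q i")
          case True
          have "dispersion n p \<le> (\<Sum>j=1..n. (r i)\<^sup>2 / 2)"
            unfolding dispersion_def
          proof (rule sum_mono)
            fix j assume "j \<in> {1..n}"
            then have "\<bar>p j\<bar> \<le> r i" using True by (auto simp: Q_def PiE_iff abs_le_iff dest!: bspec)
            then have "(p j)\<^sup>2 \<le> (r i)\<^sup>2" by (simp add: abs_le_square_iff[symmetric])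
            then show "1 - cos (p j) \<le> (r i)\<^sup>2 / 2" using one_minus_cos_le[of "p j"] by simp
          qed
          then have "dispersion n p \<le> n * (r i)\<^sup>2 / 2" by simp
          then have "2 / (n * (r i)\<^sup>2) \<le> 1 / dispersion n p"
            using elim r(1)[of i] n by (simp add: field_simps)
          then have "(2 / (n * (r i)\<^sup>2)) ^ k \<le> (1 / dispersion n p) ^ k"
            by (intro power_mono) auto
          then show ?thesis using True by (simp add: power_one_over)
        qed simp
      qed
    qed
    finally show ?thesis .
  qed
  ultimately have "c \<le> (LINT p|torus n. (0::real))"
    by (intro LIMSEQ_le_const) auto
  then show False using c by simp
qed

subsection \<open>Averages and moments of the resolvent kernel\<close>

definition avg :: "nat \<Rightarrow> ((nat \<Rightarrow> real) \<Rightarrow> 'b) \<Rightarrow> 'b :: {banach, second_countable_topology}" where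
  "avg n f = (1 / (2 * pi) ^ n) *\<^sub>R (LINT p|torus n. f p)"

lemma avg_torus_map:
  assumes "\<sigma> permutes {1..n}" "\<And>j. j \<in> {1..n} \<Longrightarrow> circle_map (\<phi> j)" "f \<in> borel_measurable (torus n)"
  shows "avg n (\<lambda>p. f (torus_map n \<sigma> \<phi> p)) = avg n f"
  unfolding avg_def using integral_torus_map[OF assms] by simp

lemma avg_const [simp]: "avg n (\<lambda>_. c) = c" for c :: "'b :: {banach, second_countable_topology}"
  by (simp add: avg_def measure_torus)

lemma avg_minus [simp]: "avg n (\<lambda>p. - f p) = - avg n f"
  by (simp add: avg_def)

lemma avg_add: "integrable (torus n) f \<Longrightarrow> integrable (torus n) g \<Longrightarrow>
    avg n (\<lambda>p. f p + g p) = avg n f + avg n g"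
  by (simp add: avg_def scaleR_add_right)

lemma avg_diff: "integrable (torus n) f \<Longrightarrow> integrable (torus n) g \<Longrightarrow>
    avg n (\<lambda>p. f p - g p) = avg n f - avg n g"
  by (simp add: avg_def scaleR_diff_right)

lemma avg_sum: "(\<And>i. i \<in> I \<Longrightarrow> integrable (torus n) (f i)) \<Longrightarrow>
    avg n (\<lambda>p. \<Sum>i\<in>I. f i p) = (\<Sum>i\<in>I. avg n (f i))"
  by (simp add: avg_def scaleR_sum_right)

lemma avg_mult_left [simp]: "avg n (\<lambda>p. c * f p) = c * avg n f"
  for f :: "_ \<Rightarrow> 'b :: {real_normed_field, banach, second_countable_topology}"
  by (simp add: avg_def)

lemma avg_mult_right [simp]: "avg n (\<lambda>p. f p * c) = avg n f * c"
  for f :: "_ \<Rightarrow> 'b :: {real_normed_field, banach, second_countable_topology}"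
  by (simp add: avg_def)

lemma avg_divide [simp]: "avg n (\<lambda>p. f p / c) = avg n f / c" for f :: "_ \<Rightarrow> real"
  by (simp add: avg_def)

lemma avg_of_real [simp]: "avg n (\<lambda>p. complex_of_real (f p)) = complex_of_real (avg n f)"
  by (simp add: avg_def scaleR_conv_of_real)

lemma avg_cong_AE:
  assumes "AE p in torus n. f p = g p" "f \<in> borel_measurable (torus n)" "g \<in> borel_measurable (torus n)"
  shows "avg n f = avg n g"
  unfolding avg_def using integral_cong_AE[OF assms(2,3,1)] by simp

lemma avg_mono_AE:
  fixes f g :: "_ \<Rightarrow> real"
  assumes "integrable (torus n) f" "integrable (torus n) g" "AE p in torus n. f p \<le> g p"
  shows "avg n f \<le> avg n g"
  unfolding avg_def using integral_mono_AE[OF assms] by (simp add: divide_right_mono)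

lemma avg_pos:
  fixes f :: "_ \<Rightarrow> real"
  assumes f: "integrable (torus n) f" "AE p in torus n. 0 \<le> f p" and nz: "\<not> (AE p in torus n. f p = 0)"
  shows "0 < avg n f"
proof -
  have "0 \<le> integral\<^sup>L (torus n) f"
    using f(2) by (rule integral_nonneg_AE)
  moreover have "integral\<^sup>L (torus n) f \<noteq> 0"
    using integral_nonneg_eq_0_iff_AE[OF f] nz by simp
  ultimately show ?thesis
    by (simp add: avg_def)
qed

lemma avg_less_AE:
  fixes f g :: "_ \<Rightarrow> real"
  assumes "integrable (torus n) f" "integrable (torus n) g" "AE p in torus n. f p \<le> g p"
    and "\<not> (AE p in torus n. f p = g p)"
  shows "avg n f < avg n g"
proof -
  have "0 < avg n (\<lambda>p. g p - f p)"
  proof (rule avg_pos)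
    show "integrable (torus n) (\<lambda>p. g p - f p)"
      using assms by auto
    show "AE p in torus n. 0 \<le> g p - f p"
      using assms(3) by eventually_elim simp
    show "\<not> (AE p in torus n. g p - f p = 0)"
      using assms(4) by (simp add: eq_commute[of "g _"])
  qed
  then show ?thesis
    using assms by (simp add: avg_diff)
qed

text \<open>Chebyshev's correlation inequality.\<close>

lemma avg_mult_greater:
  fixes f g :: "_ \<Rightarrow> real"
  assumes int: "integrable (torus n) f" "integrable (torus n) g" "integrable (torus n) (\<lambda>p. f p * g p)"
    and nonneg: "AE p in torus n. 0 \<le> (f p - avg n f) * (g p - \<beta>)"
    and nz: "\<not> (AE p in torus n. (f p - avg n f) * (g p - \<beta>) = 0)"
  shows "avg n f * avg n g < avg n (\<lambda>p. f p * g p)"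
proof -
  let ?h = "\<lambda>p. (f p * g p - f p * \<beta>) - (avg n f * g p - avg n f * \<beta>)"
  have eq: "(f p - avg n f) * (g p - \<beta>) = ?h p" for p
    by (simp add: algebra_simps)
  have "0 < avg n ?h"
    by (rule avg_pos) (use int nonneg nz in \<open>auto simp only: eq intro!: Bochner_Integration.integrable_diff
        integrable_mult_left integrable_mult_right torus.integrable_const\<close>)
  also have "avg n ?h = avg n (\<lambda>p. f p * g p) - avg n f * avg n g"
    using int by (simp add: avg_diff)
  finally show ?thesis by simp
qed

lemma torus_map_apply: "j \<in> {1..n} \<Longrightarrow> torus_map n \<sigma> \<phi> p j = \<phi> j (p (\<sigma> j))"
  by (simp add: torus_map_def)

lemma dispersion_torus_map:
  assumes "\<sigma> permutes {1..n}" "\<And>j x. cos (\<phi> j x) = cos x"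
  shows "dispersion n (torus_map n \<sigma> \<phi> p) = dispersion n p"
proof -
  have "dispersion n (torus_map n \<sigma> \<phi> p) = (\<Sum>j=1..n. 1 - cos (p (\<sigma> j)))"
    unfolding dispersion_def by (intro sum.cong) (auto simp: torus_map_apply assms)
  also have "\<dots> = dispersion n p"
    unfolding dispersion_def using sum.permute[OF assms(1), of "\<lambda>j. 1 - cos (p j)"]
    by (simp add: comp_def)
  finally show ?thesis .
qed

definition mom :: "nat \<Rightarrow> real \<Rightarrow> ((nat \<Rightarrow> real) \<Rightarrow> real) \<Rightarrow> real" where
  "mom n z g = avg n (\<lambda>p. g p / (dispersion n p - z))"

text \<open>Marks the moments that are genuine integrals rather than the default value 0. At z = 0
  this depends on how fast g vanishes at the origin.\<close>

definition kint :: "nat \<Rightarrow> real \<Rightarrow> ((nat \<Rightarrow> real) \<Rightarrow> real) \<Rightarrow> bool" where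
  "kint n z g \<longleftrightarrow> g \<in> borel_measurable (torus n) \<and>
     integrable (torus n) (\<lambda>p. g p / (dispersion n p - z))"

lemma mom_torus_map:
  assumes "\<sigma> permutes {1..n}" "\<And>j. j \<in> {1..n} \<Longrightarrow> circle_map (\<phi> j)"
    and "\<And>j x. cos (\<phi> j x) = cos x"
    and [measurable]: "g \<in> borel_measurable (torus n)"
  shows "mom n z (\<lambda>p. g (torus_map n \<sigma> \<phi> p)) = mom n z g"
proof -
  have "mom n z (\<lambda>p. g (torus_map n \<sigma> \<phi> p)) =
      avg n (\<lambda>p. (\<lambda>p. g p / (dispersion n p - z)) (torus_map n \<sigma> \<phi> p))"
    by (simp add: mom_def dispersion_torus_map[OF assms(1,3)])
  also have "\<dots> = mom n z g"
    unfolding mom_def by (rule avg_torus_map[OF assms(1,2)]) auto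
  finally show ?thesis .
qed

lemma mom_minus [simp]: "mom n z (\<lambda>p. - g p) = - mom n z g"
  using avg_minus[of n "\<lambda>p. g p / (dispersion n p - z)"] by (simp add: mom_def)

lemma mom_swap:
  assumes "i \<in> {1..n}" "j \<in> {1..n}" "g \<in> borel_measurable (torus n)"
  shows "mom n z (\<lambda>p. g (torus_map n (Transposition.transpose i j) (\<lambda>_ x. x) p)) = mom n z g"
  using assms by (intro mom_torus_map permutes_swap_id circle_map_id) auto

definition flip :: "nat \<Rightarrow> nat \<Rightarrow> (nat \<Rightarrow> real) \<Rightarrow> nat \<Rightarrow> real" where
  "flip n j = torus_map n id (\<lambda>k. if k = j then circle_neg else (\<lambda>x. x))"

lemma flip_map: "circle_map (if k = j then circle_neg else (\<lambda>x. x))"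
  by (simp add: circle_map_id circle_map_neg)

lemma mom_flip:
  assumes "g \<in> borel_measurable (torus n)"
  shows "mom n z (\<lambda>p. g (flip n j p)) = mom n z g"
  unfolding flip_def using assms by (intro mom_torus_map permutes_id flip_map) auto

lemma cos_flip: "k \<in> {1..n} \<Longrightarrow> cos (flip n j p k) = cos (p k)"
  and sin_flip: "k \<in> {1..n} \<Longrightarrow> sin (flip n j p k) = (if k = j then - sin (p k) else sin (p k))"
  by (auto simp: flip_def torus_map_apply)

section \<open>Moments related by permutations and reflections\<close>

lemma a_int_mom: "a_int n z = mom n z (\<lambda>_. 1)"
  by (simp add: a_int_def mom_def avg_def)

lemma b_int_mom: "b_int n z = mom n z (\<lambda>p. cos (p 1))"
  by (simp add: b_int_def mom_def avg_def)

definition s_int :: "nat \<Rightarrow> real \<Rightarrow> real" where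
  "s_int n z = mom n z (\<lambda>p. (sin (p 1))\<^sup>2)"

definition c_int :: "nat \<Rightarrow> real \<Rightarrow> real" where
  "c_int n z = mom n z (\<lambda>p. (cos (p 1) - cos (p 2))\<^sup>2) / 2"

lemma lam_s_eq: "lam_s n = inverse (s_int n 0)"
  by (simp add: lam_s_def s_int_def mom_def avg_def)

lemma lam_c_eq: "lam_c n = inverse (c_int n 0)"
  by (simp add: lam_c_def c_int_def mom_def avg_def)

lemma mom_cos:
  assumes j: "j \<in> {1..n}"
  shows "mom n z (\<lambda>p. cos (p j)) = b_int n z"
proof -
  have 1: "1 \<in> {1..n}" using j by auto
  have "mom n z (\<lambda>p. cos (torus_map n (Transposition.transpose 1 j) (\<lambda>_ x. x) p 1)) = mom n z (\<lambda>p. cos (p 1))"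
    using 1 j by (intro mom_swap) auto
  then show ?thesis
    using 1 by (simp add: torus_map_apply b_int_mom)
qed

lemma mom_sin_sq:
  assumes j: "j \<in> {1..n}"
  shows "mom n z (\<lambda>p. (sin (p j))\<^sup>2) = s_int n z"
proof -
  have 1: "1 \<in> {1..n}" using j by auto
  have "mom n z (\<lambda>p. (sin (torus_map n (Transposition.transpose 1 j) (\<lambda>_ x. x) p 1))\<^sup>2) = mom n z (\<lambda>p. (sin (p 1))\<^sup>2)"
    using 1 j by (intro mom_swap[where g = "\<lambda>p. (sin (p 1))\<^sup>2"] borel_measurable_power) auto
  then show ?thesis
    using 1 by (simp add: torus_map_apply s_int_def)
qed

text \<open>Reflecting the j-th coordinate preserves measure and kernel but changes the sign of the
  integrand. The argument also covers non-integrable integrands, whose integral is 0 by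
  convention.\<close>

lemma mom_sin_mult_eq_0:
  assumes j: "j \<in> {1..n}" and [measurable]: "h \<in> borel_measurable (torus n)"
    and h: "\<And>p. h (flip n j p) = h p"
  shows "mom n z (\<lambda>p. sin (p j) * h p) = 0"
proof -
  have "mom n z (\<lambda>p. sin (p j) * h p) = mom n z (\<lambda>p. sin (flip n j p j) * h (flip n j p))"
    by (rule mom_flip[where g = "\<lambda>p. sin (p j) * h p", symmetric]) (use j in measurable)
  also have "\<dots> = mom n z (\<lambda>p. - (sin (p j) * h p))"
    using j by (simp add: sin_flip h)
  finally show ?thesis by simp
qed

lemma mom_sin_sin:
  assumes "j \<in> {1..n}" "k \<in> {1..n}"
  shows "mom n z (\<lambda>p. sin (p j) * sin (p k)) = (if j = k then s_int n z else 0)"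
proof (cases "j = k")
  case True
  then show ?thesis using mom_sin_sq[OF assms(2)] by (simp add: power2_eq_square)
next
  case False
  then show ?thesis
    using assms mom_sin_mult_eq_0[of j n "\<lambda>p. sin (p k)" z] by (simp add: sin_flip)
qed

lemma mom_sin_cos:
  assumes "j \<in> {1..n}" "k \<in> {1..n}"
  shows "mom n z (\<lambda>p. sin (p j) * cos (p k)) = 0"
  using assms mom_sin_mult_eq_0[of j n "\<lambda>p. cos (p k)" z] by (simp add: cos_flip)

lemma mom_sin:
  assumes "j \<in> {1..n}"
  shows "mom n z (\<lambda>p. sin (p j)) = 0"
  using assms mom_sin_mult_eq_0[of j n "\<lambda>_. 1" z] by simp

lemma mom_cos_diff_sq:
  assumes i: "i \<in> {1..n}" and j: "j \<in> {1..n}" and ij: "i \<noteq> j"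
  shows "mom n z (\<lambda>p. (cos (p j) - cos (p i))\<^sup>2) = 2 * c_int n z"
proof -
  have n: "1 \<in> {1..n}" "2 \<in> {1..n}" using assms by auto
  \<comment> \<open>The preimage of i under the first transposition; composing in this way sends 1
    to j and 2 to i even when {1, 2} and {i, j} overlap.\<close>
  define t where "t = Transposition.transpose 1 j i"
  have t: "t \<in> {1..n}" "t \<noteq> 1"
    using i j n ij by (auto simp: t_def Transposition.transpose_def)
  define \<sigma> where "\<sigma> = Transposition.transpose 1 j \<circ> Transposition.transpose 2 t"
  have \<sigma>: "\<sigma> permutes {1..n}"
    unfolding \<sigma>_def using n j t by (intro permutes_compose permutes_swap_id) auto
  have v: "\<sigma> 1 = j" "\<sigma> 2 = i"
    using t by (auto simp: \<sigma>_def t_def)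
  let ?g = "\<lambda>p. (cos (p 1) - cos (p 2))\<^sup>2"
  have "mom n z (\<lambda>p. ?g (torus_map n \<sigma> (\<lambda>_ x. x) p)) = mom n z ?g"
    using n by (intro mom_torus_map[where g = ?g] \<sigma> circle_map_id borel_measurable_power borel_measurable_diff) auto
  then show ?thesis
    using n v by (simp add: torus_map_apply c_int_def)
qed

lemma mom_cos_diff_mult_eq_0:
  assumes ij: "i \<in> {1..n}" "j \<in> {1..n}" and [measurable]: "h \<in> borel_measurable (torus n)"
    and h: "\<And>p. h (torus_map n (Transposition.transpose i j) (\<lambda>_ x. x) p) = h p"
  shows "mom n z (\<lambda>p. (cos (p j) - cos (p i)) * h p) = 0"
proof -
  let ?t = "torus_map n (Transposition.transpose i j) (\<lambda>_ x. x)"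
  have "mom n z (\<lambda>p. (cos (p j) - cos (p i)) * h p) = mom n z (\<lambda>p. (cos (?t p j) - cos (?t p i)) * h (?t p))"
    by (rule mom_swap[where g = "\<lambda>p. (cos (p j) - cos (p i)) * h p", symmetric]) (use ij in measurable)
  also have "\<dots> = mom n z (\<lambda>p. - ((cos (p j) - cos (p i)) * h p))"
    using ij by (simp add: torus_map_apply h algebra_simps)
  finally show ?thesis by simp
qed

lemma mom_cos_diff:
  assumes "i \<in> {1..n}" "j \<in> {1..n}"
  shows "mom n z (\<lambda>p. cos (p j) - cos (p i)) = 0"
  using mom_cos_diff_mult_eq_0[OF assms, of "\<lambda>_. 1"] by simp

lemma mom_cos_diff_sin:
  assumes "i \<in> {1..n}" "j \<in> {1..n}" "k \<in> {1..n}"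
  shows "mom n z (\<lambda>p. (cos (p j) - cos (p i)) * sin (p k)) = 0"
  using assms mom_sin_mult_eq_0[of k n "\<lambda>p. cos (p j) - cos (p i)" z]
  by (simp add: cos_flip mult.commute)

subsection \<open>Integrability\<close>

lemma kint_meas: "kint n z g \<Longrightarrow> g \<in> borel_measurable (torus n)"
  and kint_int: "kint n z g \<Longrightarrow> integrable (torus n) (\<lambda>p. g p / (dispersion n p - z))"
  by (auto simp: kint_def)

lemma kint_bound:
  assumes "kint n z g" "h \<in> borel_measurable (torus n)" "\<And>p. \<bar>h p\<bar> \<le> K * \<bar>g p\<bar>"
  shows "kint n z h"
  unfolding kint_def
proof
  have [measurable]: "g \<in> borel_measurable (torus n)" "h \<in> borel_measurable (torus n)"
    using assms by (auto simp: kint_def)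
  show "integrable (torus n) (\<lambda>p. h p / (dispersion n p - z))"
  proof (rule Bochner_Integration.integrable_bound)
    show "integrable (torus n) (\<lambda>p. K * (g p / (dispersion n p - z)))"
      using kint_int[OF assms(1)] by (rule integrable_mult_right)
    have "norm (h p / (dispersion n p - z)) \<le> norm (K * (g p / (dispersion n p - z)))" for p
    proof -
      have "\<bar>h p\<bar> \<le> \<bar>K\<bar> * \<bar>g p\<bar>"
        using assms(3)[of p] by (smt (verit) abs_ge_zero mult_right_mono)
      then have "\<bar>h p\<bar> / \<bar>dispersion n p - z\<bar> \<le> \<bar>K\<bar> * \<bar>g p\<bar> / \<bar>dispersion n p - z\<bar>"
        by (rule divide_right_mono) simp
      then show ?thesis by (simp add: abs_mult)
    qed
    then show "AE p in torus n. norm (h p / (dispersion n p - z)) \<le> norm (K * (g p / (dispersion n p - z)))"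
      by simp
  qed measurable
qed fact

lemma kint_mult:
  assumes "kint n z g" "h \<in> borel_measurable (torus n)" "\<And>p. \<bar>h p\<bar> \<le> K"
  shows "kint n z (\<lambda>p. g p * h p)"
proof (rule kint_bound[OF assms(1)])
  show "(\<lambda>p. g p * h p) \<in> borel_measurable (torus n)"
    using kint_meas[OF assms(1)] assms(2) by measurable
  show "\<bar>g p * h p\<bar> \<le> K * \<bar>g p\<bar>" for p
    using mult_right_mono[OF assms(3)[of p], of "\<bar>g p\<bar>"] by (simp add: abs_mult mult.commute)
qed

lemma kint_antimono:
  assumes "kint n z g" "y \<le> z" "z \<le> 0" "n \<ge> 1"
  shows "kint n y g"
  unfolding kint_def
proof
  show [measurable]: "g \<in> borel_measurable (torus n)"
    using assms by (auto simp: kint_def)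
  show "integrable (torus n) (\<lambda>p. g p / (dispersion n p - y))"
  proof (rule Bochner_Integration.integrable_bound[OF kint_int[OF assms(1)]])
    show "AE p in torus n. norm (g p / (dispersion n p - y)) \<le> norm (g p / (dispersion n p - z))"
      using AE_dispersion_pos[OF assms(4)]
      by eventually_elim (use assms in \<open>auto simp: abs_divide intro!: divide_left_mono mult_pos_pos\<close>)
  qed measurable
qed

text \<open>A weight dominated by a multiple of E cancels the pole of 1/E in every dimension. This
  keeps 1 - cos p_j and cosine differences available at the threshold even for n = 2.\<close>

lemma kint_bounded:
  assumes [measurable]: "g \<in> borel_measurable (torus n)" and "\<And>p. \<bar>g p\<bar> \<le> K * dispersion n p" "z \<le> 0"
  shows "kint n z g"
  unfolding kint_def
proof
  show "integrable (torus n) (\<lambda>p. g p / (dispersion n p - z))"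
  proof (rule torus.integrable_const_bound)
    have "norm (g p / (dispersion n p - z)) \<le> \<bar>K\<bar>" for p
    proof -
      have "\<bar>g p\<bar> \<le> \<bar>K\<bar> * dispersion n p"
        using assms(2)[of p] dispersion_nonneg[of n p] by (smt (verit) mult_right_mono)
      also have "\<dots> \<le> \<bar>K\<bar> * (dispersion n p - z)"
        using assms(3) by (intro mult_left_mono) auto
      finally show ?thesis
        using dispersion_nonneg[of n p] assms(3)
        by (cases "dispersion n p - z = 0") (auto simp: abs_divide divide_le_eq)
    qed
    then show "AE p in torus n. norm (g p / (dispersion n p - z)) \<le> \<bar>K\<bar>"
      by simp
  qed measurable
qed fact

lemma kint_neg:
  assumes "z < 0" and [measurable]: "g \<in> borel_measurable (torus n)" and "\<And>p. \<bar>g p\<bar> \<le> K"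
  shows "kint n z g"
  unfolding kint_def
proof
  show "integrable (torus n) (\<lambda>p. g p / (dispersion n p - z))"
  proof (rule torus.integrable_const_bound)
    have "norm (g p / (dispersion n p - z)) \<le> K / (- z)" for p
    proof -
      have "\<bar>g p\<bar> / (dispersion n p - z) \<le> K / (- z)"
        using assms(1) assms(3)[of p] dispersion_nonneg[of n p] by (intro frac_le) auto
      then show ?thesis
        using assms(1) dispersion_nonneg[of n p] by (simp add: abs_divide)
    qed
    then show "AE p in torus n. norm (g p / (dispersion n p - z)) \<le> K / (- z)"
      by simp
  qed measurable
qed fact

lemma kint_one:
  assumes "z \<le> 0" "z < 0 \<or> n \<ge> 3" "n \<ge> 1"
  shows "kint n z (\<lambda>_. 1)"
proof (cases "z < 0")
  case True
  then show ?thesis by (intro kint_neg[where K = 1]) auto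
next
  case False
  then have "n \<ge> 3" using assms by auto
  then have "kint n 0 (\<lambda>_. 1)"
    using integrable_inverse_dispersion[of 1 n] by (simp add: kint_def)
  then show ?thesis
    by (rule kint_antimono) (use assms in auto)
qed

lemma sin_sq_le: "(sin x)\<^sup>2 \<le> 2 * (1 - cos x)" for x :: real
proof -
  have "(sin x)\<^sup>2 = (1 - cos x) * (1 + cos x)"
    by (simp add: sin_squared_eq power2_eq_square algebra_simps)
  also have "\<dots> \<le> (1 - cos x) * 2"
    by (intro mult_left_mono) auto
  finally show ?thesis by simp
qed

text \<open>Since (sin p_j)^2 \<le> 2 E, the quotient by E grows no faster than E^(-1/2), which is
  integrable from dimension two on. The odd sector therefore has honest moments at the threshold for
  all n \<ge> 2.\<close>

lemma kint_sin:
  assumes j: "j \<in> {1..n}" and n: "n \<ge> 2" and z: "z \<le> 0"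
  shows "kint n z (\<lambda>p. sin (p j))"
proof (rule kint_antimono)
  show "kint n 0 (\<lambda>p. sin (p j))"
    unfolding kint_def
  proof
    show "integrable (torus n) (\<lambda>p. sin (p j) / (dispersion n p - 0))"
    proof (rule Bochner_Integration.integrable_bound)
      show "integrable (torus n) (\<lambda>p. sqrt 2 * dispersion n p powr (- (1 / 2)))"
        using n by (intro integrable_mult_right integrable_dispersion_powr) auto
      show "(\<lambda>p. sin (p j) / (dispersion n p - 0)) \<in> borel_measurable (torus n)"
        using j by measurable
      have "1 \<le> n" using n by simp
      from AE_dispersion_pos[OF this]
      show "AE p in torus n. norm (sin (p j) / (dispersion n p - 0)) \<le>
          norm (sqrt 2 * dispersion n p powr (- (1 / 2)))"
      proof eventually_elim
        case E: (elim p)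
        have "(sin (p j))\<^sup>2 \<le> 2 * dispersion n p"
          using sin_sq_le[of "p j"] one_minus_cos_le_dispersion[OF j, of p] by simp
        then have "\<bar>sin (p j)\<bar> \<le> sqrt (2 * dispersion n p)"
          by (rule real_le_rsqrt[of "\<bar>sin (p j)\<bar>", simplified])
        then have "\<bar>sin (p j)\<bar> / dispersion n p \<le> sqrt (2 * dispersion n p) / dispersion n p"
          using E by (intro divide_right_mono) auto
        also have "\<dots> = sqrt 2 * dispersion n p powr (- (1 / 2))"
          using E by (simp add: powr_minus powr_half_sqrt real_sqrt_mult field_simps)
        finally show "norm (sin (p j) / (dispersion n p - 0)) \<le>
            norm (sqrt 2 * dispersion n p powr (- (1 / 2)))"
          using E by simp
      qed
    qed
  qed (use j in auto)
qed (use assms in auto)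

lemma abs_cos_diff_le:
  assumes "i \<in> {1..n}" "j \<in> {1..n}"
  shows "\<bar>cos (p j) - cos (p i)\<bar> \<le> dispersion n p"
  using one_minus_cos_le_dispersion[OF assms(1), of p] one_minus_cos_le_dispersion[OF assms(2), of p]
    cos_le_one[of "p i"] cos_le_one[of "p j"] by linarith

lemma kint_cos_diff:
  assumes "i \<in> {1..n}" "j \<in> {1..n}" "z \<le> 0"
  shows "kint n z (\<lambda>p. cos (p j) - cos (p i))"
  by (rule kint_bounded[where K = 1]) (use assms abs_cos_diff_le[OF assms(1,2)] in auto)

lemma kint_add: "kint n z g \<Longrightarrow> kint n z h \<Longrightarrow> kint n z (\<lambda>p. g p + h p)"
  and kint_diff: "kint n z g \<Longrightarrow> kint n z h \<Longrightarrow> kint n z (\<lambda>p. g p - h p)"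
  by (auto simp: kint_def add_divide_distrib diff_divide_distrib)

lemma kint_cmult: "kint n z g \<Longrightarrow> kint n z (\<lambda>p. c * g p)"
  by (auto simp: kint_def simp flip: times_divide_eq_right)

lemma mom_add: "kint n z g \<Longrightarrow> kint n z h \<Longrightarrow> mom n z (\<lambda>p. g p + h p) = mom n z g + mom n z h"
  by (simp add: mom_def kint_def add_divide_distrib avg_add)

lemma mom_diff: "kint n z g \<Longrightarrow> kint n z h \<Longrightarrow> mom n z (\<lambda>p. g p - h p) = mom n z g - mom n z h"
  by (simp add: mom_def kint_def diff_divide_distrib avg_diff)

lemma mom_sum: "(\<And>i. i \<in> I \<Longrightarrow> kint n z (g i)) \<Longrightarrow> mom n z (\<lambda>p. \<Sum>i\<in>I. g i p) = (\<Sum>i\<in>I. mom n z (g i))"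
  by (simp add: mom_def kint_def sum_divide_distrib avg_sum)

lemma mom_cmult: "mom n z (\<lambda>p. c * g p) = c * mom n z g"
  by (simp add: mom_def flip: times_divide_eq_right)

text \<open>Swapping i and j turns the case k = j into minus the case k = i, while the difference of
  these two cases is the mean square 2 c; for a third index k the swap gives 0. This is what makes
  the differences of cosine moments decouple from each other.\<close>

lemma mom_cos_diff_cos:
  assumes ij: "i \<in> {1..n}" "j \<in> {1..n}" "i \<noteq> j" and k: "k \<in> {1..n}" and z: "z \<le> 0"
  shows "mom n z (\<lambda>p. (cos (p j) - cos (p i)) * cos (p k)) =
    c_int n z * ((if k = j then 1 else 0) - (if k = i then 1 else 0))"
proof -
  have main: "mom n z (\<lambda>p. (cos (p j) - cos (p i)) * cos (p j)) = c_int n z"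
    if ij: "i \<in> {1..n}" "j \<in> {1..n}" "i \<noteq> j" for i j
  proof -
    let ?t = "torus_map n (Transposition.transpose i j) (\<lambda>_ x. x)"
    have ki: "kint n z (\<lambda>p. (cos (p j) - cos (p i)) * cos (p l))" if "l \<in> {1..n}" for l
      using that ij z by (intro kint_mult[where K = 1] kint_cos_diff) auto
    have "mom n z (\<lambda>p. (cos (p j) - cos (p i)) * cos (p j)) =
        mom n z (\<lambda>p. (cos (?t p j) - cos (?t p i)) * cos (?t p j))"
      by (rule mom_swap[where g = "\<lambda>p. (cos (p j) - cos (p i)) * cos (p j)", symmetric]) (use ij in measurable)
    also have "\<dots> = mom n z (\<lambda>p. - ((cos (p j) - cos (p i)) * cos (p i)))"
      using ij by (simp add: torus_map_apply algebra_simps)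
    finally have 1: "mom n z (\<lambda>p. (cos (p j) - cos (p i)) * cos (p j)) =
        - mom n z (\<lambda>p. (cos (p j) - cos (p i)) * cos (p i))"
      by simp
    have "2 * c_int n z = mom n z (\<lambda>p. (cos (p j) - cos (p i)) * cos (p j) - (cos (p j) - cos (p i)) * cos (p i))"
      using mom_cos_diff_sq[OF ij, of z] by (simp add: power2_eq_square algebra_simps)
    also have "\<dots> = mom n z (\<lambda>p. (cos (p j) - cos (p i)) * cos (p j)) - mom n z (\<lambda>p. (cos (p j) - cos (p i)) * cos (p i))"
      by (rule mom_diff) (use ki ij in auto)
    finally show ?thesis using 1 by simp
  qed
  consider "k = j" | "k = i" | "k \<noteq> i" "k \<noteq> j" by blast
  then show ?thesis
  proof cases
    case 1
    then show ?thesis using main[OF ij] ij by simp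
  next
    case 2
    have "mom n z (\<lambda>p. - ((cos (p j) - cos (p i)) * cos (p i))) = c_int n z"
      using main[OF ij(2,1)] ij by (simp add: algebra_simps)
    then show ?thesis using 2 ij by simp
  next
    case 3
    then have "mom n z (\<lambda>p. (cos (p j) - cos (p i)) * cos (p k)) = 0"
      using ij k by (intro mom_cos_diff_mult_eq_0) (auto simp: torus_map_apply)
    then show ?thesis using 3 by simp
  qed
qed

text \<open>The cosines sum to n - E = (n - z) - (E - z); the second part cancels the kernel and
  averages to 1.\<close>

lemma b_int_eq:
  assumes z: "z \<le> 0" "z < 0 \<or> n \<ge> 3" and n: "n \<ge> 1"
  shows "n * b_int n z = (n - z) * a_int n z - 1"
proof -
  note k1 = kint_one[OF z n]
  have kc: "kint n z (\<lambda>p. cos (p j))" if "j \<in> {1..n}" for j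
    using that by (intro kint_bound[OF k1, where K = 1]) auto
  have "n * b_int n z = (\<Sum>j\<in>{1..n}. mom n z (\<lambda>p. cos (p j)))"
    by (simp add: mom_cos)
  also have "\<dots> = mom n z (\<lambda>p. n - dispersion n p)"
    by (subst mom_sum[symmetric]) (use kc in \<open>simp_all only: sum_cos_eq\<close>)
  also have "\<dots> = avg n (\<lambda>p. (n - z) * (1 / (dispersion n p - z)) - 1)"
    unfolding mom_def
  proof (rule avg_cong_AE)
    show "AE p in torus n. (n - dispersion n p) / (dispersion n p - z) = (n - z) * (1 / (dispersion n p - z)) - 1"
      using AE_dispersion_pos[OF n]
      by eventually_elim (use z in \<open>auto simp: field_simps\<close>)
  qed measurable
  also have "\<dots> = (n - z) * a_int n z - 1"
    using kint_int[OF k1] by (subst avg_diff) (auto simp: a_int_mom mom_def simp del: times_divide_eq_right)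
  finally show ?thesis .
qed

subsection \<open>Dependence on the spectral parameter\<close>

lemma mom_strict_mono:
  assumes g: "kint n z' g" and "\<And>p. 0 \<le> g p" "\<not> (AE p in torus n. g p = 0)"
    and z: "z < z'" "z' \<le> 0" and n: "n \<ge> 1"
  shows "mom n z g < mom n z' g"
  unfolding mom_def
proof (rule avg_less_AE)
  show "integrable (torus n) (\<lambda>p. g p / (dispersion n p - z))"
    using kint_int[OF kint_antimono[OF g _ z(2) n, of z]] z by simp
  show "integrable (torus n) (\<lambda>p. g p / (dispersion n p - z'))"
    by (rule kint_int[OF g])
  show "AE p in torus n. g p / (dispersion n p - z) \<le> g p / (dispersion n p - z')"
    using AE_dispersion_pos[OF n] by eventually_elim (use assms in \<open>auto intro!: divide_left_mono mult_pos_pos\<close>)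
  show "\<not> (AE p in torus n. g p / (dispersion n p - z) = g p / (dispersion n p - z'))"
  proof
    assume "AE p in torus n. g p / (dispersion n p - z) = g p / (dispersion n p - z')"
    with AE_dispersion_pos[OF n] have "AE p in torus n. g p = 0"
      by eventually_elim (use z in \<open>auto simp: field_simps\<close>)
    then show False using assms by simp
  qed
qed

lemma mom_continuous:
  assumes g: "kint n z0 g" and z0: "z0 \<le> 0" and n: "n \<ge> 1"
  shows "continuous_on {..z0} (\<lambda>z. mom n z g)"
  unfolding continuous_on_sequentially comp_def mom_def avg_def
proof (intro ballI allI impI tendsto_scaleR tendsto_const, elim conjE)
  fix z and y :: "nat \<Rightarrow> real"
  assume z: "z \<in> {..z0}" and y: "\<forall>i. y i \<in> {..z0}" "y \<longlonglongrightarrow> z"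
  have [measurable]: "g \<in> borel_measurable (torus n)"
    by (rule kint_meas[OF g])
  show "(\<lambda>i. LINT p|torus n. g p / (dispersion n p - y i)) \<longlonglongrightarrow> (LINT p|torus n. g p / (dispersion n p - z))"
  proof (rule integral_dominated_convergence)
    show "integrable (torus n) (\<lambda>p. \<bar>g p / (dispersion n p - z0)\<bar>)"
      by (rule integrable_abs[OF kint_int[OF g]])
    show "AE p in torus n. (\<lambda>i. g p / (dispersion n p - y i)) \<longlonglongrightarrow> g p / (dispersion n p - z)"
      using AE_dispersion_pos[OF n]
      by eventually_elim (use z z0 y in \<open>auto intro!: tendsto_intros\<close>)
    show "AE p in torus n. norm (g p / (dispersion n p - y i)) \<le> \<bar>g p / (dispersion n p - z0)\<bar>" for i
      using AE_dispersion_pos[OF n]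
    proof eventually_elim
      case (elim p)
      have "y i \<le> z0" using y by auto
      then show ?case
        using elim z0 by (auto simp: abs_divide intro!: divide_left_mono mult_pos_pos)
    qed
  qed measurable
qed

lemma mom_le:
  assumes [measurable]: "g \<in> borel_measurable (torus n)" and g: "\<And>p. \<bar>g p\<bar> \<le> K" and z: "z < 0"
  shows "mom n z g \<le> K / (- z)"
proof -
  have "mom n z g \<le> avg n (\<lambda>_. K / (- z))"
    unfolding mom_def
  proof (rule avg_mono_AE)
    show "integrable (torus n) (\<lambda>p. g p / (dispersion n p - z))"
      by (rule kint_int, rule kint_neg[OF z _ g]) measurable
    have "g p / (dispersion n p - z) \<le> K / (- z)" for p
      using g[of p] z dispersion_nonneg[of n p] by (intro frac_le) auto
    then show "AE p in torus n. g p / (dispersion n p - z) \<le> K / - z"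
      by simp
  qed auto
  then show ?thesis by simp
qed

lemma mom_pos:
  assumes g: "kint n z g" and "\<And>p. 0 \<le> g p" "\<not> (AE p in torus n. g p = 0)"
    and z: "z \<le> 0" and n: "n \<ge> 1"
  shows "0 < mom n z g"
  unfolding mom_def
proof (rule avg_pos)
  show "integrable (torus n) (\<lambda>p. g p / (dispersion n p - z))"
    by (rule kint_int[OF g])
  show "AE p in torus n. 0 \<le> g p / (dispersion n p - z)"
    using AE_dispersion_pos[OF n] by eventually_elim (use assms in auto)
  show "\<not> (AE p in torus n. g p / (dispersion n p - z) = 0)"
  proof
    assume "AE p in torus n. g p / (dispersion n p - z) = 0"
    with AE_dispersion_pos[OF n] have "AE p in torus n. g p = 0"
      by eventually_elim (use z in auto)
    then show False using assms by simp
  qed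
qed

text \<open>The moment increases strictly in z, tends to 0 as z decreases, because it is at most K /
  (-z), and ends at its value at 0. So the level 1 / lam is attained below 0, and then once, exactly
  if it lies below that end value.\<close>

lemma mom_roots:
  assumes g: "kint n 0 g" "\<And>p. 0 \<le> g p" "\<And>p. g p \<le> K" "\<not> (AE p in torus n. g p = 0)"
    and n: "n \<ge> 1"
  shows "finite {z. z < 0 \<and> lam * mom n z g = 1}"
    and "card {z. z < 0 \<and> lam * mom n z g = 1} = (if lam > inverse (mom n 0 g) then 1 else 0)"
proof -
  let ?F = "\<lambda>z. mom n z g" and ?R = "{z. z < 0 \<and> lam * mom n z g = 1}"
  have pos: "0 < ?F z" if "z \<le> 0" for z
    using mom_pos[OF kint_antimono[OF g(1), of z] g(2,4) that n] that n by simp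
  have mono: "?F z < ?F z'" if "z < z'" "z' \<le> 0" for z z'
    using mom_strict_mono[OF kint_antimono[OF g(1), of z'] g(2,4) that n] that n by simp
  have inj: "z = z'" if "z \<in> ?R" "z' \<in> ?R" for z z'
  proof -
    have "lam * ?F z = lam * ?F z'" "lam \<noteq> 0" using that by auto
    then have "?F z = ?F z'" by simp
    then show ?thesis
      using mono[of z z'] mono[of z' z] that by (cases z z' rule: linorder_cases) auto
  qed
  have "if lam > inverse (?F 0) then \<exists>z. ?R = {z} else ?R = {}"
  proof (cases "lam > inverse (?F 0)")
    case True
    then have lam: "0 < lam"
      using pos[of 0] by (smt (verit) inverse_nonnegative_iff_nonnegative)
    have K: "0 \<le> K"
      using g(2)[of undefined] g(3)[of undefined] by linarith
    \<comment> \<open>Chosen so that K / (-y) < 1 / lam, which puts the left end of the interval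
      below the level.\<close>
    define y where "y = - (K * lam + 1)"
    have "0 \<le> K * lam" using K lam by simp
    then have y: "y < 0" unfolding y_def by linarith
    have "?F y \<le> K / (- y)"
      using mom_le[OF kint_meas[OF g(1)] _ y, of K] g(2,3) by simp
    also have "\<dots> < 1 / lam"
      using K lam y by (simp add: y_def field_simps)
    finally have 1: "?F y \<le> 1 / lam" by simp
    have 2: "1 / lam < ?F 0"
      using True lam pos[of 0] by (simp add: field_simps)
    have "continuous_on {y..0} ?F"
      using mom_continuous[OF g(1) _ n] by (rule continuous_on_subset) auto
    from IVT'[OF 1 less_imp_le[OF 2] _ this] y
    obtain z where z: "z \<le> 0" "?F z = 1 / lam" by auto
    then have "z \<noteq> 0" using 2 by auto
    with z lam have R: "z \<in> ?R" by (auto simp: field_simps)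
    have "?R = {z}"
      using inj[OF _ R] R by blast
    then have "\<exists>z. ?R = {z}" by (rule exI[of _ z])
    then show ?thesis
      using True by (simp only: if_True)
  next
    case False
    have "lam * ?F z \<noteq> 1" if z: "z < 0" for z
    proof
      assume *: "lam * ?F z = 1"
      then have lam: "0 < lam" using pos[of z] z by (smt (verit) zero_less_mult_iff)
      have "1 < lam * ?F 0"
        using mult_strict_left_mono[OF mono[OF z order_refl] lam] * by simp
      then have "inverse (?F 0) < lam"
        using pos[of 0] by (simp add: field_simps)
      then show False using False by simp
    qed
    then have "?R = {}" by blast
    then show ?thesis
      using False by (simp only: if_False)
  qed
  then consider z where "lam > inverse (?F 0)" "?R = {z}" | "\<not> lam > inverse (?F 0)" "?R = {}"
    by presburger
  then have "finite ?R \<and> card ?R = (if lam > inverse (?F 0) then 1 else 0)"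
  proof cases
    case (1 z)
    show ?thesis unfolding 1(2) using 1(1) by simp
  next
    case 2
    show ?thesis unfolding 2(2) using 2(1) by simp
  qed
  then show "finite ?R" "card ?R = (if lam > inverse (?F 0) then 1 else 0)"
    by simp_all
qed

text \<open>On (0, 1]^n the dispersion is at most n/2, while on (2, 3]^n it is at least n, the
  cosines being negative there.\<close>

lemma not_AE_dispersion_const:
  assumes "n \<ge> 1"
  shows "\<not> (AE p in torus n. dispersion n p = c)"
proof
  assume A: "AE p in torus n. dispersion n p = c"
  from AE_torus_box_ex[OF A, of "\<lambda>_. 0" "\<lambda>_. 1"] obtain p where
    p: "dispersion n p = c" "\<And>j. j \<in> {1..n} \<Longrightarrow> 0 < p j \<and> p j \<le> 1"
    using pi_gt3 by auto
  have "dispersion n p \<le> (\<Sum>j=1..n. 1 / 2)"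
    unfolding dispersion_def
  proof (rule sum_mono)
    fix j assume "j \<in> {1..n}"
    from p(2)[OF this] have "(p j)\<^sup>2 \<le> 1" by (intro power_le_one) auto
    then show "1 - cos (p j) \<le> 1 / 2" using one_minus_cos_le[of "p j"] by simp
  qed
  then have 1: "c < n" using assms p(1) by simp
  from AE_torus_box_ex[OF A, of "\<lambda>_. 2" "\<lambda>_. 3"] obtain q where
    q: "dispersion n q = c" "\<And>j. j \<in> {1..n} \<Longrightarrow> 2 < q j \<and> q j \<le> 3"
    using pi_gt3 by auto
  have "(\<Sum>j=1..n. 1) \<le> dispersion n q"
    unfolding dispersion_def
  proof (rule sum_mono)
    fix j assume "j \<in> {1..n}"
    from q(2)[OF this] have "cos (q j) \<le> cos 2"
      using pi_gt3 by (intro cos_monotone_0_pi_le) auto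
    then show "1 \<le> 1 - cos (q j)" using cos_two_less_zero by linarith
  qed
  then show False using 1 q(1) by simp
qed

lemma avg_cos:
  assumes j: "j \<in> {1..n}"
  shows "avg n (\<lambda>p. cos (p j)) = 0"
proof -
  have "avg n (\<lambda>p. cos (torus_map n id (\<lambda>_. circle_shift pi) p j)) = avg n (\<lambda>p. cos (p j))"
    using j by (intro avg_torus_map permutes_id circle_map_shift) auto
  then show ?thesis
    using j by (simp add: torus_map_apply cos_circle_shift)
qed

lemma avg_sin:
  assumes j: "j \<in> {1..n}"
  shows "avg n (\<lambda>p. sin (p j)) = 0"
proof -
  have "avg n (\<lambda>p. sin (torus_map n id (\<lambda>_. circle_shift pi) p j)) = avg n (\<lambda>p. sin (p j))"
    using j by (intro avg_torus_map permutes_id circle_map_shift) auto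
  then show ?thesis
    using j by (simp add: torus_map_apply sin_circle_shift)
qed

lemma integrable_cos: "j \<in> {1..n} \<Longrightarrow> integrable (torus n) (\<lambda>p. cos (p j))"
  by (rule torus.integrable_const_bound[where B = 1]) auto

lemma integrable_dispersion: "integrable (torus n) (dispersion n)"
  by (rule torus.integrable_const_bound[where B = "2 * real n"])
    (auto simp: dispersion_le dispersion_nonneg abs_of_nonneg)

lemma avg_dispersion: "avg n (dispersion n) = n"
proof -
  have "avg n (\<lambda>p. \<Sum>j=1..n. 1 - cos (p j)) = (\<Sum>j=1..n. avg n (\<lambda>p. 1 - cos (p j)))"
    by (intro avg_sum Bochner_Integration.integrable_diff integrable_cos torus.integrable_const)
  also have "\<dots> = n"
    by (simp add: avg_diff integrable_cos avg_cos)
  finally show ?thesis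
    by (simp add: dispersion_def[abs_def])
qed

text \<open>Second-order expansion of \<open>1 / (E - z)\<close> around the mean value \<open>n\<close> of the dispersion relation.\<close>

lemma a_int_expansion:
  assumes z: "z < 0" and n: "n \<ge> 1"
  shows "1 < (n - z) * a_int n z" "(n - z) * a_int n z \<le> 1 + (real n)\<^sup>2 / ((n - z) * (- z))"
proof -
  let ?t = "\<lambda>p. dispersion n p - n"
  let ?w = "n - z"
  have w: "?w > 0" using z n by simp
  have t: "(?t p)\<^sup>2 \<le> (real n)\<^sup>2" for p
    using dispersion_le[of n p] dispersion_nonneg[of n p] by (auto simp: abs_le_square_iff[symmetric])
  have k: "kint n z (\<lambda>p. (?t p)\<^sup>2)"
    using t by (intro kint_neg[OF z, where K = "(real n)\<^sup>2"]) auto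
  have "?w * a_int n z = ?w * avg n (\<lambda>p. 1 / (dispersion n p - z))"
    by (simp add: a_int_mom mom_def)
  also have "\<dots> = avg n (\<lambda>p. ?w * (1 / (dispersion n p - z)))"
    by (subst avg_mult_left) simp
  also have "(\<lambda>p. ?w * (1 / (dispersion n p - z))) =
      (\<lambda>p. 1 - (dispersion n p - n) / ?w + (1 / ?w) * ((?t p)\<^sup>2 / (dispersion n p - z)))"
  proof
    fix p
    have key: "w * (1 / d) = 1 - (d - w) / w + (1 / w) * ((d - w)\<^sup>2 / d)"
      if "w > 0" "d > 0" for w d :: real
      using that by (simp add: field_simps power2_eq_square)
    have "dispersion n p - z > 0"
      using dispersion_nonneg[of n p] z by linarith
    from key[OF w this] show "?w * (1 / (dispersion n p - z)) =
        1 - (dispersion n p - n) / ?w + (1 / ?w) * ((?t p)\<^sup>2 / (dispersion n p - z))"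
      by simp
  qed
  also have "avg n \<dots> = avg n (\<lambda>p. 1 - (dispersion n p - n) / ?w) +
      avg n (\<lambda>p. (1 / ?w) * ((?t p)\<^sup>2 / (dispersion n p - z)))"
    using kint_int[OF k] integrable_dispersion
    by (intro avg_add integrable_mult_right) auto
  also have "avg n (\<lambda>p. (1 / ?w) * ((?t p)\<^sup>2 / (dispersion n p - z))) = mom n z (\<lambda>p. (?t p)\<^sup>2) / ?w"
    by (subst avg_mult_left) (simp add: mom_def)
  also have "avg n (\<lambda>p. 1 - (dispersion n p - n) / ?w) = 1"
    using integrable_dispersion by (simp add: avg_diff avg_dispersion)
  finally have eq: "?w * a_int n z = 1 + mom n z (\<lambda>p. (?t p)\<^sup>2) / ?w" .
  have "0 < mom n z (\<lambda>p. (?t p)\<^sup>2)"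
  proof (rule mom_pos[OF k])
    show "\<not> (AE p in torus n. (?t p)\<^sup>2 = 0)"
      using not_AE_dispersion_const[OF n, of n] by simp
  qed (use z n in auto)
  then show "1 < ?w * a_int n z"
    using eq w by simp
  have "mom n z (\<lambda>p. (?t p)\<^sup>2) \<le> (real n)\<^sup>2 / (- z)"
    using t z by (intro mom_le) auto
  then have "mom n z (\<lambda>p. (?t p)\<^sup>2) / ?w \<le> (real n)\<^sup>2 / (- z) / ?w"
    using w by (intro divide_right_mono) auto
  then show "?w * a_int n z \<le> 1 + (real n)\<^sup>2 / (?w * (- z))"
    using eq by (simp add: mult.commute)
qed

lemma not_AE_one: "\<not> (AE p in torus n. (1::real) = 0)"
proof
  assume "AE p in torus n. (1::real) = 0"
  from AE_torus_box_ex[OF this, of "\<lambda>_. 0" "\<lambda>_. 1"] show False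
    using pi_gt3 by auto
qed

lemma a_int_pos:
  assumes "z \<le> 0" "z < 0 \<or> n \<ge> 3" "n \<ge> 1"
  shows "0 < a_int n z"
  unfolding a_int_mom using assms not_AE_one by (intro mom_pos kint_one) auto

lemma a_int_strict_mono:
  assumes "z < z'" "z' \<le> 0" "z' < 0 \<or> n \<ge> 3" "n \<ge> 1"
  shows "a_int n z < a_int n z'"
  unfolding a_int_mom using assms not_AE_one by (intro mom_strict_mono kint_one) auto

lemma a_int_less:
  assumes z: "z < 0" and n: "n \<ge> 1"
  shows "a_int n z < 1 / (- z)"
proof -
  have "avg n (\<lambda>p. 1 / (dispersion n p - z)) < avg n (\<lambda>_. 1 / (- z))"
  proof (rule avg_less_AE)
    show "integrable (torus n) (\<lambda>p. 1 / (dispersion n p - z))"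
      using z n by (intro kint_int kint_one) auto
    show "AE p in torus n. 1 / (dispersion n p - z) \<le> 1 / - z"
    proof (rule AE_I2)
      fix p
      show "1 / (dispersion n p - z) \<le> 1 / - z"
        using z dispersion_nonneg[of n p] by (intro frac_le) auto
    qed
    show "\<not> (AE p in torus n. 1 / (dispersion n p - z) = 1 / - z)"
    proof
      assume "AE p in torus n. 1 / (dispersion n p - z) = 1 / - z"
      with AE_dispersion_pos[OF n] have "AE p in torus n. dispersion n p = 0"
        by eventually_elim (use z in \<open>auto simp: field_simps\<close>)
      then show False using not_AE_dispersion_const[OF n] by simp
    qed
  qed auto
  then show ?thesis by (simp add: a_int_mom mom_def)
qed

text \<open>Chebyshev's inequality applies since \<open>1 / (E - z)\<close> and \<open>1 / (E - z')\<close> are both decreasing in \<open>E\<close>.\<close>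

lemma a_int_mult_less:
  assumes z: "z < z'" "z' \<le> 0" "z' < 0 \<or> n \<ge> 3" and n: "n \<ge> 1"
  shows "(z' - z) * (a_int n z * a_int n z') < a_int n z' - a_int n z"
proof -
  let ?f = "\<lambda>p. 1 / (dispersion n p - z)" and ?g = "\<lambda>p. 1 / (dispersion n p - z')"
  have z0: "z < 0" using z by simp
  have f: "integrable (torus n) ?f" and g: "integrable (torus n) ?g"
    using z n z0 by (auto intro!: kint_int kint_one)
  \<comment> \<open>The resolvent identity; it yields both the integrability of the product and,
    later, its average.\<close>
  have prod: "AE p in torus n. ?f p * ?g p = (1 / (z' - z)) * (?g p - ?f p)"
    using AE_dispersion_pos[OF n]
  proof eventually_elim
    case (elim p)
    then show ?case using z by (simp add: field_simps)
  qed
  have fg: "integrable (torus n) (\<lambda>p. ?f p * ?g p)"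
  proof (subst integrable_cong_AE[OF _ _ prod])
    show "integrable (torus n) (\<lambda>p. (1 / (z' - z)) * (?g p - ?f p))"
      using f g by (intro integrable_mult_right Bochner_Integration.integrable_diff)
  qed measurable
  \<comment> \<open>The energy at which 1 / (E - z) equals its own average. Comparing the other
    kernel with 1 / (e - z') makes both factors change sign at E = e.\<close>
  define e where "e = z + 1 / a_int n z"
  have a0: "0 < a_int n z" using z0 n by (intro a_int_pos) auto
  have e: "e > 0"
    using a_int_less[OF z0 n] a0 z0 by (simp add: e_def field_simps)
  have af: "avg n ?f = 1 / (e - z)"
    using a0 by (simp add: e_def a_int_mom mom_def)
  have eq: "(?f p - 1 / (e - z)) * (?g p - 1 / (e - z')) =
      (dispersion n p - e)\<^sup>2 / ((dispersion n p - z) * (e - z) * ((dispersion n p - z') * (e - z')))"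
    if "0 < dispersion n p" for p
  proof -
    have d: "dispersion n p - z > 0" "dispersion n p - z' > 0" "e - z > 0" "e - z' > 0"
      using that e z by auto
    have "?f p - 1 / (e - z) = (e - dispersion n p) / ((dispersion n p - z) * (e - z))"
      "?g p - 1 / (e - z') = (e - dispersion n p) / ((dispersion n p - z') * (e - z'))"
      using d by (simp_all add: field_simps)
    then show ?thesis
      by (simp add: power2_eq_square algebra_simps)
  qed
  have "avg n ?f * avg n ?g < avg n (\<lambda>p. ?f p * ?g p)"
  proof (rule avg_mult_greater[OF f g fg, of "1 / (e - z')"])
    show "AE p in torus n. 0 \<le> (?f p - avg n ?f) * (?g p - 1 / (e - z'))"
      using AE_dispersion_pos[OF n] unfolding af
      by eventually_elim (use e z in \<open>auto simp: eq\<close>)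
    show "\<not> (AE p in torus n. (?f p - avg n ?f) * (?g p - 1 / (e - z')) = 0)"
    proof
      assume "AE p in torus n. (?f p - avg n ?f) * (?g p - 1 / (e - z')) = 0"
      with AE_dispersion_pos[OF n] have "AE p in torus n. dispersion n p = e"
        unfolding af by eventually_elim (use e z in \<open>auto simp: eq\<close>)
      then show False using not_AE_dispersion_const[OF n] by simp
    qed
  qed
  also have "avg n (\<lambda>p. ?f p * ?g p) = avg n (\<lambda>p. (1 / (z' - z)) * (?g p - ?f p))"
    using prod by (rule avg_cong_AE) measurable
  also have "\<dots> = (1 / (z' - z)) * (avg n ?g - avg n ?f)"
    using f g by (subst avg_mult_left) (simp add: avg_diff)
  finally have "a_int n z * a_int n z' < (1 / (z' - z)) * (a_int n z' - a_int n z)"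
    by (simp add: a_int_mom mom_def)
  then show ?thesis
    using z by (simp add: field_simps)
qed

section \<open>The function 1/a up to the threshold, including its divergent denominator for n =
  2\<close>

lemma a_int_zero_dim2: "a_int 2 0 = 0"
  using not_integrable_inverse_dispersion[of 2 1] by (simp add: a_int_def not_integrable_integral_eq)

text \<open>If a stayed bounded along -1/(i+1), monotone convergence would make 1/E integrable on
  the two-dimensional torus.\<close>

lemma a_int_dim2_unbounded: "\<exists>z<0. K < a_int 2 z"
proof (rule ccontr)
  assume "\<not> (\<exists>z<0. K < a_int 2 z)"
  then have bd: "a_int 2 z \<le> K" if "z < 0" for z
    using that by (meson not_le)
  define y where "y i = - (1 / real (Suc i))" for i
  have y: "y i < 0" for i by (simp add: y_def)
  have ym: "y i \<le> y (Suc i)" for i by (simp add: y_def field_simps)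
  have "y \<longlonglongrightarrow> - 0"
    unfolding y_def by (intro tendsto_minus) (use LIMSEQ_inverse_real_of_nat in \<open>simp add: inverse_eq_divide\<close>)
  then have y0: "y \<longlonglongrightarrow> 0" by simp
  let ?f = "\<lambda>i p. 1 / (dispersion 2 p - y i)"
  have fi: "integrable (torus 2) (?f i)" for i
    using y[of i] by (intro kint_int kint_one) auto
  have pos: "AE p in torus 2. 0 < dispersion 2 p"
    by (rule AE_dispersion_pos) simp
  have a: "a_int 2 (y i) = (1 / (2 * pi) ^ 2) * integral\<^sup>L (torus 2) (?f i)" for i
    by (simp add: a_int_def)
  have "incseq (\<lambda>i. a_int 2 (y i))"
  proof (rule incseq_SucI)
    fix i
    show "a_int 2 (y i) \<le> a_int 2 (y (Suc i))"
      using a_int_strict_mono[of "y i" "y (Suc i)" 2] ym[of i] y[of "Suc i"]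
      by (cases "y i = y (Suc i)") auto
  qed
  moreover have "\<forall>i. a_int 2 (y i) \<le> K"
    using bd y by simp
  ultimately obtain L where "(\<lambda>i. a_int 2 (y i)) \<longlonglongrightarrow> L"
    by (rule incseq_convergent)
  then have "(\<lambda>i. (2 * pi) ^ 2 * a_int 2 (y i)) \<longlonglongrightarrow> (2 * pi) ^ 2 * L"
    by (intro tendsto_intros)
  then have lim: "(\<lambda>i. integral\<^sup>L (torus 2) (?f i)) \<longlonglongrightarrow> (2 * pi) ^ 2 * L"
    by (simp add: a)
  have "integrable (torus 2) (\<lambda>p. 1 / dispersion 2 p)"
  proof (rule integrable_monotone_convergence[OF fi _ _ lim])
    show "AE p in torus 2. mono (\<lambda>i. ?f i p)"
      using pos
    proof eventually_elim
      case (elim p)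
      have "?f i p \<le> ?f (Suc i) p" for i
        using elim ym[of i] y[of "Suc i"] by (intro frac_le) auto
      then show ?case by (rule incseq_SucI)
    qed
    show "AE p in torus 2. (\<lambda>i. ?f i p) \<longlonglongrightarrow> 1 / dispersion 2 p"
      using pos
    proof eventually_elim
      case (elim p)
      have "(\<lambda>i. ?f i p) \<longlonglongrightarrow> 1 / (dispersion 2 p - 0)"
        by (intro tendsto_intros y0) (use elim in auto)
      then show ?case by simp
    qed
  qed measurable
  then show False
    using not_integrable_inverse_dispersion[of 2 1] by simp
qed

text \<open>For n = 2 the default value a(0) = 0 and the convention 1/0 = 0 assign to 1/a at the
  threshold exactly its limit 0, because a is increasing and unbounded as z tends to 0 from
  below.\<close>

lemma inverse_a_int_continuous:
  assumes n: "n \<ge> 2"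
  shows "continuous_on {..0} (\<lambda>z. 1 / a_int n z)"
proof (cases "n \<ge> 3")
  case True
  then have "continuous_on {..0} (\<lambda>z. a_int n z)"
    unfolding a_int_mom by (intro mom_continuous kint_one) auto
  then show ?thesis
    by (intro continuous_intros) (use a_int_pos[of _ n] True in force)+
next
  case False
  then have n: "n = 2" using n by simp
  have neg: "continuous_on {..z} (\<lambda>z. 1 / a_int 2 z)" if "z < 0" for z
  proof -
    have "continuous_on {..z} (\<lambda>z. a_int 2 z)"
      unfolding a_int_mom using that by (intro mom_continuous kint_one) auto
    moreover have "\<forall>y\<in>{..z}. a_int 2 y \<noteq> 0"
    proof
      fix y assume "y \<in> {..z}"
      then show "a_int 2 y \<noteq> 0" using a_int_pos[of y 2] that by auto
    qed
    ultimately show ?thesis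
      by (intro continuous_intros)
  qed
  show ?thesis
    unfolding n continuous_on_eq_continuous_within
  proof
    fix z :: real assume "z \<in> {..0}"
    then consider "z < 0" | "z = 0" by fastforce
    then show "continuous (at z within {..0}) (\<lambda>z. 1 / a_int 2 z)"
    proof cases
      case 1
      then have "continuous_on {..<z/2} (\<lambda>z. 1 / a_int 2 z)"
        by (intro continuous_on_subset[OF neg[of "z/2"]]) auto
      then have "isCont (\<lambda>z. 1 / a_int 2 z) z"
        using 1 by (auto simp: continuous_on_eq_continuous_at)
      then show ?thesis by (rule continuous_at_imp_continuous_at_within)
    next
      case 2
      have "((\<lambda>z. 1 / a_int 2 z) \<longlongrightarrow> 0) (at 0 within {..0})"
      proof (rule tendstoI)
        fix e :: real assume e: "e > 0"
        obtain y where y: "y < 0" "1 / e < a_int 2 y"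
          using a_int_dim2_unbounded by blast
        have "eventually (\<lambda>z. z \<in> {y<..}) (at 0 within {..0})"
          using y by (auto simp: eventually_at dist_real_def intro!: exI[of _ "- y"])
        moreover have "eventually (\<lambda>z::real. z \<in> {..0} \<and> z \<noteq> 0) (at 0 within {..0})"
          by (auto simp: eventually_at intro!: exI[of _ 1])
        ultimately show "eventually (\<lambda>z. dist (1 / a_int 2 z) 0 < e) (at 0 within {..0})"
        proof eventually_elim
          case (elim z)
          then have "a_int 2 y < a_int 2 z"
            by (intro a_int_strict_mono) auto
          then have "1 / e < a_int 2 z" using y by simp
          moreover have "0 < a_int 2 z" using elim by (intro a_int_pos) auto
          ultimately show ?case using e by (simp add: field_simps)
        qed
      qed
      then show ?thesis
        using 2 by (simp add: continuous_within a_int_zero_dim2)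
    qed
  qed
qed

subsection \<open>Zeros of the even symmetric determinant\<close>

text \<open>The ratio a/b with b eliminated through n b = (n - z) a - 1. In this form it also has
  the right value at z = 0 for n = 2: there 1/a is 0 by convention and the quotient is 2/2 =
  1.\<close>

definition xfun :: "nat \<Rightarrow> real \<Rightarrow> real" where
  "xfun n z = n / (n - z - 1 / a_int n z)"

text \<open>Dividing the Chebyshev bound by a(z) a(z') gives z' - z < 1/a(z) - 1/a(z'). For n = 2
  and z' = 0 the last term is 0, and what remains is a(z) < 1/(-z).\<close>

lemma xfun_denom_strict_mono:
  assumes z: "z < z'" "z' \<le> 0" and n: "n \<ge> 2"
  shows "n - z - 1 / a_int n z < n - z' - 1 / a_int n z'"
proof -
  have z0: "z < 0" and a: "0 < a_int n z" using z n by (auto intro: a_int_pos)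
  show ?thesis
  proof (cases "z' < 0 \<or> n \<ge> 3")
    case True
    have a': "0 < a_int n z'" using z n True by (intro a_int_pos) auto
    have "(z' - z) * (a_int n z * a_int n z') < a_int n z' - a_int n z"
      using a_int_mult_less[of z z' n] z n True by auto
    then have "z' - z < (a_int n z' - a_int n z) / (a_int n z * a_int n z')"
      using a a' by (simp add: pos_less_divide_eq)
    also have "\<dots> = 1 / a_int n z - 1 / a_int n z'"
      using a a' by (simp add: field_simps)
    finally show ?thesis by simp
  next
    case False
    then have n2: "n = 2" "z' = 0" using n z by auto
    have "a_int n z < 1 / (- z)" using z0 n by (intro a_int_less) auto
    then have "- z < 1 / a_int n z" using a z0 by (simp add: field_simps)
    then show ?thesis by (simp add: n2 a_int_zero_dim2)
  qed
qed

lemma xfun_denom_pos: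
  assumes z: "z \<le> 0" and n: "n \<ge> 2"
  shows "0 < n - z - 1 / a_int n z"
proof -
  have neg: "0 < n - z - 1 / a_int n z" if z: "z < 0" for z :: real
  proof -
    have "1 < (n - z) * a_int n z" using a_int_expansion(1)[OF z, of n] n by simp
    moreover have "0 < a_int n z" using z n by (intro a_int_pos) auto
    ultimately show ?thesis by (simp add: field_simps)
  qed
  \<comment> \<open>At z = 0 positivity is inherited from z = -1 by monotonicity, so no separate
    threshold estimate arises.\<close>
  show ?thesis
    using neg[of z] neg[of "-1"] xfun_denom_strict_mono[of "-1" 0 n] z n by (cases "z = 0") auto
qed

lemma xfun_strict_antimono:
  assumes z: "z < z'" "z' \<le> 0" and n: "n \<ge> 2"
  shows "xfun n z' < xfun n z"
  unfolding xfun_def using xfun_denom_strict_mono[OF z n] xfun_denom_pos[of z n] xfun_denom_pos[of z' n] z n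
  by (intro divide_strict_left_mono mult_pos_pos) auto

lemma xfun_continuous:
  assumes n: "n \<ge> 2"
  shows "continuous_on {..0} (xfun n)"
proof -
  have "continuous_on {..0} (\<lambda>z. real n - z - 1 / a_int n z)"
    by (rule continuous_on_diff[OF _ inverse_a_int_continuous[OF n]]) (intro continuous_intros)
  moreover have "real n - z - 1 / a_int n z \<noteq> 0" if "z \<in> {..0}" for z
    using xfun_denom_pos[of z n] n that by auto
  ultimately show ?thesis
    unfolding xfun_def by (intro continuous_on_divide continuous_on_const) auto
qed

lemma xfun_unbounded:
  assumes n: "n \<ge> 2"
  shows "\<exists>z<0. K < xfun n z"
proof (intro exI conjI)
  \<comment> \<open>The denominator of \<open>xfun\<close> is at most n^2 / (-z), which is n /
    (\<bar>K\<bar> + 1) for this z.\<close>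
  define z where "z = - (real n * (\<bar>K\<bar> + 1))"
  have z: "z < 0" using n by (simp add: z_def mult_pos_pos add_nonneg_pos)
  then show "z < 0" .
  have a: "1 < (n - z) * a_int n z" "(n - z) * a_int n z \<le> 1 + (real n)\<^sup>2 / ((n - z) * (- z))"
    using a_int_expansion[OF z, of n] n by auto
  have ap: "0 < a_int n z" using z n by (intro a_int_pos) auto
  have w: "n - z > 0" using z by linarith
  have "n - z - 1 / a_int n z = ((n - z) * a_int n z - 1) / a_int n z"
    using ap by (simp add: field_simps)
  also have "\<dots> \<le> ((real n)\<^sup>2 / ((n - z) * (- z))) / (1 / (n - z))"
    using a ap w by (intro frac_le) (auto simp: field_simps)
  also have "\<dots> = (real n)\<^sup>2 / (- z)"
    using w z by (simp add: field_simps)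
  also have "\<dots> = n / (\<bar>K\<bar> + 1)"
    using n by (simp add: z_def power2_eq_square)
  finally have "n / (n / (\<bar>K\<bar> + 1)) \<le> xfun n z"
    unfolding xfun_def using xfun_denom_pos[of z n] z n
    by (intro divide_left_mono mult_pos_pos) auto
  then show "K < xfun n z" using n by simp
qed

lemma b_int_pos:
  assumes z: "z \<le> 0" "z < 0 \<or> n \<ge> 3" and n: "n \<ge> 2"
  shows "0 < b_int n z"
proof -
  have a: "0 < a_int n z" using assms by (intro a_int_pos) auto
  have "0 < (n - z - 1 / a_int n z) * a_int n z"
    using xfun_denom_pos[OF z(1) n] a by (rule mult_pos_pos)
  also have "\<dots> = n * b_int n z"
    using b_int_eq[OF z] n a by (simp add: algebra_simps)
  finally show ?thesis using n by (simp add: zero_less_mult_iff)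
qed

lemma xfun_eq:
  assumes z: "z \<le> 0" "z < 0 \<or> n \<ge> 3" and n: "n \<ge> 2"
  shows "xfun n z = a_int n z / b_int n z"
proof -
  have a: "0 < a_int n z" using assms by (intro a_int_pos) auto
  have b: "0 < b_int n z" by (rule b_int_pos[OF assms])
  have "(n - z - 1 / a_int n z) = n * b_int n z / a_int n z"
    using b_int_eq[OF z] n a by (simp add: field_simps)
  then show ?thesis
    using a b n by (simp add: xfun_def)
qed

lemma X_asym_eq:
  assumes n: "n \<ge> 2"
  shows "X_asym n = xfun n 0"
proof (cases "n = 2")
  case True
  then show ?thesis by (simp add: X_asym_def xfun_def a_int_zero_dim2)
next
  case False
  then show ?thesis using n xfun_eq[of 0 n] by (simp add: X_asym_def)
qed

text \<open>The equation for A reads A = \<mu> a A + lam b (\<Sum> C_j). Inserting \<Sum> C_j = (n -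
  z - \<mu>) A leaves this factor times A equal to 0.\<close>

definition sym_det :: "nat \<Rightarrow> real \<Rightarrow> real \<Rightarrow> real \<Rightarrow> real" where
  "sym_det n lam \<mu> z = 1 - \<mu> * a_int n z - lam * (n - z) * b_int n z + lam * \<mu> * b_int n z"

text \<open>The determinant is b > 0 times the defect of the hyperbola equation; expanding that
  product uses a = \<open>xfun\<close> b and n b = (n - z) a - 1.\<close>

lemma sym_det_eq_0_iff:
  assumes z: "z \<le> 0" "z < 0 \<or> n \<ge> 3" and n: "n \<ge> 2"
  shows "sym_det n lam \<mu> z = 0 \<longleftrightarrow> (lam - xfun n z) * (\<mu> - (n - z)) = n"
proof -
  have b: "0 < b_int n z" by (rule b_int_pos[OF assms])
  have x: "xfun n z * b_int n z = a_int n z" using xfun_eq[OF assms] b by simp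
  have "((lam - xfun n z) * (\<mu> - (n - z)) - n) * b_int n z =
      lam * \<mu> * b_int n z - lam * (n - z) * b_int n z
      - \<mu> * (xfun n z * b_int n z) + (n - z) * (xfun n z * b_int n z) - n * b_int n z"
    by (simp add: algebra_simps)
  also have "\<dots> = sym_det n lam \<mu> z"
    unfolding x sym_det_def using b_int_eq[OF z] n by (simp add: algebra_simps)
  finally show ?thesis using b by (metis mult_eq_0_iff less_irrefl right_minus_eq)
qed

text \<open>The product N is positive, so at a root both factors have the same sign, which splits
  the roots into two branches. Where both are negative, their absolute values decrease in z from
  arbitrarily large values: there is one root, unless lam < x 0 and the product at 0 is still at
  least N. Where both are positive, they increase in z: there is one root exactly when both are
  positive at 0 with product above N.\<close>

lemma hyperbola_roots:
  fixes x :: "real \<Rightarrow> real" and N lam \<mu> :: real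
  defines "R \<equiv> {z. z < 0 \<and> (lam - x z) * (\<mu> - (N - z)) = N}"
    and "H \<equiv> (lam - x 0) * (\<mu> - N) - N"
  assumes cont: "continuous_on {..0} x" and dec: "\<And>z z'. z < z' \<Longrightarrow> z' \<le> 0 \<Longrightarrow> x z' < x z"
    and unb: "\<And>K. \<exists>z<0. K < x z" and N: "0 < N"
  shows "finite R"
    and "card R = (if H \<ge> 0 \<and> lam < x 0 then 0 else 1) + (if H > 0 \<and> lam > x 0 then 1 else 0)"
proof -
  define Rn where "Rn = {z \<in> R. lam < x z}"
  define Rp where "Rp = {z \<in> R. x z < lam}"
  have ne: "lam \<noteq> x z" if "z \<in> R" for z using that N by (auto simp: R_def)
  have R: "R = Rn \<union> Rp" "Rn \<inter> Rp = {}"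
    using ne by (force simp: Rn_def Rp_def)+
  have Rn: "z \<in> Rn \<longleftrightarrow> z < 0 \<and> lam < x z \<and> \<mu> < N - z \<and> (x z - lam) * (N - z - \<mu>) = N" for z
  proof -
    have eq: "(lam - x z) * (\<mu> - (N - z)) = (x z - lam) * (N - z - \<mu>)" by (simp add: algebra_simps)
    show ?thesis
      unfolding Rn_def R_def mem_Collect_eq eq using N by (auto simp: zero_less_mult_iff)
        (smt (verit) zero_less_mult_iff)
  qed
  have Rp: "z \<in> Rp \<longleftrightarrow> z < 0 \<and> x z < lam \<and> N - z < \<mu> \<and> (lam - x z) * (\<mu> - (N - z)) = N" for z
    unfolding Rp_def R_def mem_Collect_eq using N by (auto simp: zero_less_mult_iff)
        (smt (verit) zero_less_mult_iff)
  have dec0: "x 0 < x z" if "z < 0" for z using dec[OF that] by simp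
  have "if H \<ge> 0 \<and> lam < x 0 then Rn = {} else \<exists>z. Rn = {z}"
  proof (cases "H \<ge> 0 \<and> lam < x 0")
    case True
    have muN: "\<mu> < N"
    proof (rule ccontr)
      assume "\<not> \<mu> < N"
      then have "(lam - x 0) * (\<mu> - N) \<le> 0" using True by (intro mult_nonpos_nonneg) auto
      then show False using True N by (simp add: H_def)
    qed
    have "z \<notin> Rn" for z
    proof
      assume z: "z \<in> Rn"
      then have "(x 0 - lam) * (N - \<mu>) < (x z - lam) * (N - z - \<mu>)"
        using dec0[of z] muN True by (intro mult_strict_mono) (auto simp: Rn)
      then show False using z True by (simp add: Rn H_def algebra_simps)
    qed
    then show ?thesis using True by auto
  next
    case False
    \<comment> \<open>Truncation at 0 extends the branch to a continuous function on the whole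
      interval; since N > 0, the truncation is inactive at any point where h = N.\<close>
    define h where "h z = max (x z - lam) 0 * max (N - z - \<mu>) 0" for z
    have h0: "h 0 < N"
    proof (cases "lam < x 0 \<and> \<mu> < N")
      case True
      then show ?thesis using False by (simp add: h_def H_def algebra_simps)
    next
      case False
      then have "h 0 = 0" by (auto simp: h_def max_def)
      then show ?thesis using N by simp
    qed
    obtain z0 where z0: "z0 < 0" "lam + N < x z0" using unb by blast
    \<comment> \<open>Here the first factor exceeds N and the second is at least 1.\<close>
    define z1 where "z1 = min z0 (N - \<mu> - 1)"
    have z1: "z1 < 0" "z1 \<le> z0" using z0 by (auto simp: z1_def)
    have "lam + N < x z1" using z0 dec[of z1 z0] z1 by (cases "z1 = z0") auto
    then have "N * 1 \<le> h z1"
      unfolding h_def using N by (intro mult_mono) (auto simp: z1_def)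
    then have h1: "N \<le> h z1" by simp
    have "continuous_on {z1..0} h"
      unfolding h_def by (intro continuous_intros continuous_on_subset[OF cont]) auto
    from IVT2'[of h 0 N z1, OF less_imp_le[OF h0] h1 _ this] z1
    obtain z where z: "z \<le> 0" "h z = N" by auto
    with h0 have "z < 0" by (cases "z = 0") auto
    moreover have "lam < x z" "\<mu> < N - z"
      using z N by (auto simp: h_def max_def split: if_splits)
    ultimately have zR: "z \<in> Rn" using z by (simp add: Rn h_def max_def)
    have "y = z" if y: "y \<in> Rn" for y
    proof (rule ccontr)
      assume "y \<noteq> z"
      have *: False if "u \<in> Rn" "v \<in> Rn" "u < v" for u v
      proof -
        have "(x v - lam) * (N - v - \<mu>) < (x u - lam) * (N - u - \<mu>)"
          using that dec[of u v] by (intro mult_strict_mono) (auto simp: Rn)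
        then show False using that by (simp add: Rn)
      qed
      show False using *[OF y zR] *[OF zR y] \<open>y \<noteq> z\<close> by linarith
    qed
    with zR have "Rn = {z}" by blast
    then show ?thesis using False by auto
  qed
  then have cn: "finite Rn" "card Rn = (if H \<ge> 0 \<and> lam < x 0 then 0 else 1)"
    by (auto split: if_splits)
  have "if H > 0 \<and> lam > x 0 then \<exists>z. Rp = {z} else Rp = {}"
  proof (cases "H > 0 \<and> lam > x 0")
    case False
    have "z \<notin> Rp" for z
    proof
      assume z: "z \<in> Rp"
      then have *: "lam > x 0" "N < \<mu>" using dec0[of z] by (auto simp: Rp)
      have "(lam - x z) * (\<mu> - (N - z)) < (lam - x 0) * (\<mu> - N)"
        using z dec0[of z] by (intro mult_strict_mono) (auto simp: Rp)
      then show False using z False * by (simp add: Rp H_def)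
    qed
    then show ?thesis using False by auto
  next
    case True
    define h where "h z = max (lam - x z) 0 * max (\<mu> - (N - z)) 0" for z
    have muN: "N < \<mu>"
    proof (rule ccontr)
      assume "\<not> N < \<mu>"
      then have "(lam - x 0) * (\<mu> - N) \<le> 0" using True by (intro mult_nonneg_nonpos) auto
      then show False using True N by (simp add: H_def)
    qed
    have h0: "N < h 0" using True muN by (simp add: h_def H_def)
    obtain z1 where z1: "z1 < 0" "lam < x z1" using unb by blast
    then have h1: "h z1 \<le> N" using N by (simp add: h_def max_def)
    have "continuous_on {z1..0} h"
      unfolding h_def by (intro continuous_intros continuous_on_subset[OF cont]) auto
    from IVT'[of h z1 N 0, OF h1 less_imp_le[OF h0] _ this] z1
    obtain z where z: "z \<le> 0" "h z = N" by auto
    with h0 have "z < 0" by (cases "z = 0") auto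
    moreover have "x z < lam" "N - z < \<mu>"
      using z N by (auto simp: h_def max_def split: if_splits)
    ultimately have zR: "z \<in> Rp" using z by (simp add: Rp h_def max_def)
    have "y = z" if y: "y \<in> Rp" for y
    proof (rule ccontr)
      assume "y \<noteq> z"
      have *: False if "u \<in> Rp" "v \<in> Rp" "u < v" for u v
      proof -
        have "(lam - x u) * (\<mu> - (N - u)) < (lam - x v) * (\<mu> - (N - v))"
          using that dec[of u v] by (intro mult_strict_mono) (auto simp: Rp)
        then show False using that by (simp add: Rp)
      qed
      show False using *[OF y zR] *[OF zR y] \<open>y \<noteq> z\<close> by linarith
    qed
    with zR have "Rp = {z}" by blast
    then show ?thesis using True by auto
  qed
  then have cp: "finite Rp" "card Rp = (if H > 0 \<and> lam > x 0 then 1 else 0)"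
    by (auto split: if_splits)
  show "finite R" using R cn cp by simp
  show "card R = (if H \<ge> 0 \<and> lam < x 0 then 0 else 1) + (if H > 0 \<and> lam > x 0 then 1 else 0)"
    using card_Un_disjoint[OF cn(1) cp(1) R(2)] by (simp only: R(1) cn cp)
qed

lemma sym_det_roots:
  assumes n: "n \<ge> 2"
  shows "finite {z. z < 0 \<and> sym_det n lam \<mu> z = 0}"
    and "card {z. z < 0 \<and> sym_det n lam \<mu> z = 0} =
      (if H0_bar n lam \<mu> \<ge> 0 \<and> lam < X_asym n then 0 else 1) +
      (if H0_bar n lam \<mu> > 0 \<and> lam > X_asym n then 1 else 0)"
proof -
  have eq: "{z. z < 0 \<and> sym_det n lam \<mu> z = 0} = {z. z < 0 \<and> (lam - xfun n z) * (\<mu> - (real n - z)) = real n}"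
    using n by (auto simp: sym_det_eq_0_iff)
  note * = hyperbola_roots[of "xfun n" "real n" lam \<mu>,
      OF xfun_continuous[OF n] xfun_strict_antimono[OF _ _ n] xfun_unbounded[OF n]]
  show "finite {z. z < 0 \<and> sym_det n lam \<mu> z = 0}"
    unfolding eq using n by (intro *(1)) auto
  show "card {z. z < 0 \<and> sym_det n lam \<mu> z = 0} =
      (if H0_bar n lam \<mu> \<ge> 0 \<and> lam < X_asym n then 0 else 1) +
      (if H0_bar n lam \<mu> > 0 \<and> lam > X_asym n then 1 else 0)"
    unfolding eq H0_bar_def X_asym_eq[OF n] using n by (intro *(2)) auto
qed

subsection \<open>Ordering of the critical couplings\<close>

lemma integral_circle:
  "(LINT x|circle. f x) = (LINT x|lborel. f x * indicator {-pi..pi} x)" for f :: "real \<Rightarrow> real"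
proof (cases "f \<in> borel_measurable circle")
  case True
  then have [measurable]: "(\<lambda>x. indicator {-pi<..pi} x * f x) \<in> borel_measurable lborel"
    unfolding circle_def by (subst (asm) borel_measurable_restrict_space_iff) auto
  have ae: "AE x in lborel. indicator {-pi<..pi} x * f x = f x * indicator {-pi..pi} x"
    using AE_lborel_singleton[of "-pi"] by eventually_elim (auto simp: indicator_def)
  have "(LINT x|circle. f x) = (LINT x|lborel. indicator {-pi<..pi} x * f x)"
    unfolding circle_def by (subst integral_restrict_space) auto
  also have "\<dots> = (LINT x|lborel. f x * indicator {-pi..pi} x)"
  proof (rule integral_cong_AE[OF _ _ ae])
    have "(\<lambda>x. f x * indicator {-pi..pi} x) =
        (\<lambda>x. indicator {-pi<..pi} x * f x + f (-pi) * indicator {-pi} x)"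
      using pi_gt_zero by (auto simp: fun_eq_iff indicator_def)
    then show "(\<lambda>x. f x * indicator {-pi..pi} x) \<in> borel_measurable lborel"
      by simp
  qed simp
  finally show ?thesis .
next
  case False
  \<comment> \<open>Measurability transfers between the two intervals, so for a non-measurable f
    both integrals take the default value 0.\<close>
  have "(\<lambda>x. f x * indicator {-pi..pi} x) \<notin> borel_measurable lborel"
  proof
    assume [measurable]: "(\<lambda>x. f x * indicator {-pi..pi} x) \<in> borel_measurable lborel"
    have "(\<lambda>x. indicator {-pi<..pi} x * f x) =
        (\<lambda>x. f x * indicator {-pi..pi} x * indicator {-pi<..pi} x)"
      by (auto simp: fun_eq_iff indicator_def)
    then have "(\<lambda>x. indicator {-pi<..pi} x * f x) \<in> borel_measurable lborel"
      by simp
    then have "f \<in> borel_measurable circle"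
      unfolding circle_def by (subst borel_measurable_restrict_space_iff) auto
    with False show False by simp
  qed
  then show ?thesis
    using False by (simp add: not_integrable_integral_eq integrable_iff_bounded)
qed

lemma integral_circle_FTC:
  fixes f F :: "real \<Rightarrow> real"
  assumes "\<And>x. (F has_real_derivative f x) (at x)" "\<And>x. isCont f x"
  shows "(LINT x|circle. f x) = F pi - F (-pi)"
  unfolding integral_circle by (rule integral_FTC_Icc_real) (use assms in auto)

lemma integrable_circle_continuous:
  fixes f :: "real \<Rightarrow> real"
  assumes "\<And>x. isCont f x"
  shows "integrable circle f"
proof -
  have c: "continuous_on A f" for A
    using assms by (simp add: continuous_at_imp_continuous_on)
  have "compact (f ` {-pi..pi})"
    by (intro compact_continuous_image c) simp
  then obtain B where B: "\<And>x. x \<in> {-pi..pi} \<Longrightarrow> norm (f x) \<le> B"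
    using compact_imp_bounded bounded_iff by (metis imageI)
  show ?thesis
  proof (rule circle.integrable_const_bound)
    show "AE x in circle. norm (f x) \<le> B" by (intro AE_I2 B) auto
    show "f \<in> borel_measurable circle"
      by (intro measurable_circleI borel_measurable_continuous_onI c)
  qed
qed

text \<open>The antiderivative comes from the Poisson kernel with \<open>r + 1 / r = 2 * w\<close>; unlike the usual
  half-angle substitution it has no singularity at \<open>\<plusminus>\<pi>\<close>.\<close>

lemma integral_circle_inverse:
  fixes w :: real
  assumes w: "w > 1"
  shows "(LINT x|circle. 1 / (w - cos x)) = 2 * pi / sqrt (w\<^sup>2 - 1)"
proof -
  define q where "q = sqrt (w\<^sup>2 - 1)"
  \<comment> \<open>The smaller root of r + 1/r = 2 w; it lies in (0, 1), so 1 - r cos x stays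
    positive.\<close>
  define r where "r = w - q"
  have w2: "w\<^sup>2 > 1" using w by (simp add: one_less_power)
  then have q: "q > 0" "q\<^sup>2 = w\<^sup>2 - 1" by (auto simp: q_def)
  have "q < w" using q w by (intro power2_less_imp_less[of q w]) auto
  then have r0: "r > 0" by (simp add: r_def)
  have r2: "r\<^sup>2 = 2 * w * r - 1" and rq: "1 - r\<^sup>2 = 2 * r * q"
    using q(2) by (simp_all add: r_def power2_eq_square algebra_simps)
  have "r\<^sup>2 < 1" using rq r0 q by (smt (verit) mult_pos_pos)
  then have r1: "r < 1" using r0 by (simp add: power2_less_1_iff abs_square_less_1)
  have d: "w - cos x > 0" for x using cos_le_one[of x] w by linarith
  have e: "1 - r * cos x > 0" for x
  proof -
    have "r * cos x \<le> r * 1" using r0 by (intro mult_left_mono) auto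
    then show ?thesis using r1 by simp
  qed
  \<comment> \<open>The arctangent is the argument of 1 - r exp (-i x) and vanishes at
    \<plusminus>pi, so only the linear term contributes to the integral.\<close>
  let ?F = "\<lambda>x. (x + 2 * arctan (r * sin x / (1 - r * cos x))) / q"
  have "(LINT x|circle. 1 / (w - cos x)) = ?F pi - ?F (-pi)"
  proof (rule integral_circle_FTC)
    fix x :: real
    have D: "(1 - r * cos x)\<^sup>2 + (r * sin x)\<^sup>2 = 2 * r * (w - cos x)"
    proof -
      have "(1 - r * cos x)\<^sup>2 + (r * sin x)\<^sup>2 = 1 - 2 * r * cos x + r\<^sup>2 * ((cos x)\<^sup>2 + (sin x)\<^sup>2)"
        by algebra
      then show ?thesis by (simp add: r2 algebra_simps)
    qed
    have N: "r * cos x * (1 - r * cos x) - r * sin x * (r * sin x) = r * cos x - r\<^sup>2"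
    proof -
      have "r * cos x * (1 - r * cos x) - r * sin x * (r * sin x) =
          r * cos x - r\<^sup>2 * ((cos x)\<^sup>2 + (sin x)\<^sup>2)"
        by algebra
      then show ?thesis by simp
    qed
    have inv: "inverse (1 + (r * sin x / (1 - r * cos x))\<^sup>2) = (1 - r * cos x)\<^sup>2 / (2 * r * (w - cos x))"
    proof -
      have "1 + (r * sin x / (1 - r * cos x))\<^sup>2 =
          ((1 - r * cos x)\<^sup>2 + (r * sin x)\<^sup>2) / (1 - r * cos x)\<^sup>2"
        using e[of x] by (simp add: power_divide add_divide_distrib)
      then show ?thesis unfolding D by simp
    qed
    have "((\<lambda>x. r * sin x / (1 - r * cos x)) has_real_derivative
        (r * cos x * (1 - r * cos x) - r * sin x * (r * sin x)) / (1 - r * cos x)\<^sup>2) (at x)"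
      using e[of x] by (auto intro!: derivative_eq_intros simp: power2_eq_square)
    from DERIV_chain2[where f = arctan and g = "\<lambda>x. r * sin x / (1 - r * cos x)", OF DERIV_arctan this]
    have "((\<lambda>x. arctan (r * sin x / (1 - r * cos x))) has_real_derivative
        (r * cos x - r\<^sup>2) / (2 * r * (w - cos x))) (at x)"
      using e[of x] unfolding inv N by simp
    from DERIV_cmult[OF this, of 2]
    have "(?F has_real_derivative (1 + 2 * ((r * cos x - r\<^sup>2) / (2 * r * (w - cos x)))) / q) (at x)"
      by (intro DERIV_cdivide DERIV_add DERIV_ident)
    moreover have "(1 + 2 * ((r * cos x - r\<^sup>2) / (2 * r * (w - cos x)))) / q = 1 / (w - cos x)"
    proof -
      have "1 + 2 * ((r * cos x - r\<^sup>2) / (2 * r * (w - cos x))) =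
          (2 * r * (w - cos x) + 2 * (r * cos x - r\<^sup>2)) / (2 * r * (w - cos x))"
        using r0 d[of x] by (simp add: add_divide_distrib)
      also have "2 * r * (w - cos x) + 2 * (r * cos x - r\<^sup>2) = 2 * r * q"
        by (simp add: r_def power2_eq_square algebra_simps)
      finally show ?thesis using r0 q(1) by simp
    qed
    ultimately show "(?F has_real_derivative 1 / (w - cos x)) (at x)" by simp
    show "isCont (\<lambda>x. 1 / (w - cos x)) x"
      using d[of x] by (intro continuous_intros) auto
  qed
  also have "\<dots> = 2 * pi / q" by (simp add: field_simps)
  finally show ?thesis by (simp add: q_def)
qed

lemma integral_circle_cos: "(LINT x|circle. cos x) = 0"
  using integral_circle_FTC[of sin cos] by simp

text \<open>Polynomial division by w - cos x reduces both to the previous integral: cos x = w - (w -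
  cos x) and (sin x)^2 = (w + cos x) (w - cos x) - (w^2 - 1).\<close>

lemma integral_circle_weighted:
  fixes w :: real
  assumes w: "w > 1"
  shows "(LINT x|circle. cos x / (w - cos x)) = 2 * pi * (w / sqrt (w\<^sup>2 - 1) - 1)"
    and "(LINT x|circle. (sin x)\<^sup>2 / (w - cos x)) = 2 * pi * (w - sqrt (w\<^sup>2 - 1))"
proof -
  have d: "w - cos x > 0" for x using cos_le_one[of x] w by linarith
  have i: "integrable circle (\<lambda>x. 1 / (w - cos x))" "integrable circle cos"
    using d by (auto intro!: integrable_circle_continuous continuous_intros simp: less_imp_neq[symmetric])
  have "(LINT x|circle. cos x / (w - cos x)) = (LINT x|circle. w * (1 / (w - cos x)) - 1)"
    using d by (intro Bochner_Integration.integral_cong) (auto simp: field_simps less_imp_neq[symmetric])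
  also have "\<dots> = (LINT x|circle. w * (1 / (w - cos x))) - (LINT x|circle. 1)"
    using i by (intro Bochner_Integration.integral_diff integrable_mult_right circle.integrable_const)
  also have "(LINT x|circle. w * (1 / (w - cos x))) = w * (2 * pi / sqrt (w\<^sup>2 - 1))"
    by (subst integral_mult_right_zero) (simp add: integral_circle_inverse[OF w])
  also have "w * (2 * pi / sqrt (w\<^sup>2 - 1)) - (LINT x|circle. 1) = 2 * pi * (w / sqrt (w\<^sup>2 - 1) - 1)"
    using measure_circle by (simp add: algebra_simps)
  finally show "(LINT x|circle. cos x / (w - cos x)) = 2 * pi * (w / sqrt (w\<^sup>2 - 1) - 1)" .
  have w2: "w\<^sup>2 > 1" using w by (simp add: one_less_power)
  have eq: "(sin x)\<^sup>2 / (w - cos x) = (w + cos x) - (w\<^sup>2 - 1) * (1 / (w - cos x))" for x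
  proof -
    have "(sin x)\<^sup>2 = (w + cos x) * (w - cos x) - (w\<^sup>2 - 1)"
      by (simp add: sin_squared_eq power2_eq_square algebra_simps)
    then show ?thesis using d[of x] by (simp add: diff_divide_distrib)
  qed
  have "(LINT x|circle. (sin x)\<^sup>2 / (w - cos x)) =
      (LINT x|circle. (w + cos x) - (w\<^sup>2 - 1) * (1 / (w - cos x)))"
    unfolding eq ..
  also have "\<dots> = (LINT x|circle. w + cos x) - (LINT x|circle. (w\<^sup>2 - 1) * (1 / (w - cos x)))"
    using i by (intro Bochner_Integration.integral_diff) (auto simp del: times_divide_eq_right)
  also have "(LINT x|circle. (w\<^sup>2 - 1) * (1 / (w - cos x))) = (w\<^sup>2 - 1) * (2 * pi / sqrt (w\<^sup>2 - 1))"
    by (subst integral_mult_right_zero) (simp add: integral_circle_inverse[OF w])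
  also have "\<dots> = 2 * pi * ((w\<^sup>2 - 1) / sqrt (w\<^sup>2 - 1))" by simp
  also have "(w\<^sup>2 - 1) / sqrt (w\<^sup>2 - 1) = sqrt (w\<^sup>2 - 1)" using w2 by (intro real_div_sqrt) auto
  also have "(LINT x|circle. w + cos x) = 2 * pi * w"
    using i measure_circle by (subst Bochner_Integration.integral_add) (auto simp: integral_circle_cos)
  finally show "(LINT x|circle. (sin x)\<^sup>2 / (w - cos x)) = 2 * pi * (w - sqrt (w\<^sup>2 - 1))"
    by (simp add: algebra_simps)
qed

section \<open>Integrating out the first coordinate, and the inequality X <
  \<open>lam_s\<close>\<close>

lemma avg_eq_fiberwise:
  fixes f g :: "(nat \<Rightarrow> real) \<Rightarrow> real"
  assumes n: "n \<ge> 1" and "integrable (torus n) f" "integrable (torus n) g"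
    and eq: "\<And>x. (LINT y|circle. f (x(1 := y))) = (LINT y|circle. g (x(1 := y)))"
  shows "avg n f = avg n g"
proof -
  have ins: "{1..n} = insert 1 {2..n}" using n by auto
  have *: "integral\<^sup>L (torus n) h = (LINT x|PiM {2..n} (\<lambda>_. circle). LINT y|circle. h (x(1 := y)))"
    if "integrable (torus n) h" for h :: "(nat \<Rightarrow> real) \<Rightarrow> real"
    using tor.product_integral_insert[of "{2..n}" 1 h] that
    by (simp only: torus_eq ins finite_atLeastAtMost atLeastAtMost_iff) simp
  show ?thesis
    unfolding avg_def *[OF assms(2)] *[OF assms(3)] eq ..
qed

lemma not_AE_sin:
  assumes "n \<ge> 1"
  shows "\<not> (AE p in torus n. (sin (p 1))\<^sup>2 = 0)"
proof
  assume A: "AE p in torus n. (sin (p 1))\<^sup>2 = 0"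
  have "(0::real) < 1 \<and> - pi \<le> 0 \<and> 1 \<le> pi"
    using pi_gt3 by simp
  then obtain p :: "nat \<Rightarrow> real" where "(sin (p 1))\<^sup>2 = 0"
      and p: "\<And>j. j \<in> {1..n} \<Longrightarrow> 0 < p j \<and> p j \<le> 1"
    using AE_torus_box_ex[OF A, of "\<lambda>_. 0" "\<lambda>_. 1"] by blast
  moreover have "0 < p 1" "p 1 < pi" using p[of 1] assms pi_gt3 by auto
  then have "0 < sin (p 1)" by (rule sin_gt_zero)
  ultimately show False by simp
qed

lemma not_AE_cos_diff:
  assumes "n \<ge> 2"
  shows "\<not> (AE p in torus n. cos (p 1) - cos (p 2) = 0)"
proof
  assume A: "AE p in torus n. cos (p 1) - cos (p 2) = 0"
  define l u :: "nat \<Rightarrow> real" where "l j = (if j = 2 then 2 else 0)" and "u j = (if j = 2 then 3 else 1)" for j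
  have "l j < u j \<and> - pi \<le> l j \<and> u j \<le> pi" for j
    using pi_gt3 by (simp add: l_def u_def)
  then obtain p :: "nat \<Rightarrow> real" where p: "cos (p 1) - cos (p 2) = 0" "\<And>j. j \<in> {1..n} \<Longrightarrow> l j < p j \<and> p j \<le> u j"
    using AE_torus_box_ex[OF A, of l u] by blast
  have "0 < p 1" "p 1 \<le> 1" "2 < p 2" "p 2 \<le> 3"
    using p(2)[of 1] p(2)[of 2] assms by (auto simp: l_def u_def)
  moreover from this have "cos (p 2) < cos (p 1)"
    using pi_gt3 by (intro cos_monotone_0_pi) auto
  ultimately show False using p(1) by simp
qed

lemma s_int_pos: "n \<ge> 2 \<Longrightarrow> 0 < s_int n 0"
  unfolding s_int_def
  using not_AE_sin[of n] kint_mult[OF kint_sin[of 1 n 0], of "\<lambda>p. sin (p 1)" 1]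
  by (intro mom_pos) (auto simp: power2_eq_square)

text \<open>Integrating out \<open>p 1\<close> turns the three moments into averages of \<open>1 / q\<close>, \<open>w - q\<close> and their
  product, where \<open>w\<close> and \<open>q = sqrt (w\<^sup>2 - 1)\<close> depend on the other coordinates only; Chebyshev's
  inequality applies since both factors decrease in \<open>q\<close>.\<close>

lemma s_int_mult_a_int_less:
  assumes n: "n \<ge> 3"
  shows "s_int n 0 * a_int n 0 < b_int n 0"
proof -
  define E' where "E' p = (\<Sum>j=2..n. 1 - cos (p j))" for p :: "nat \<Rightarrow> real"
  have [measurable]: "E' \<in> borel_measurable (torus n)"
    unfolding E'_def by (intro borel_measurable_sum borel_measurable_diff) auto
  have E: "dispersion n p = 1 + E' p - cos (p 1)" for p
  proof -
    have "{1..n} = insert 1 {2..n}" using n by auto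
    then show ?thesis by (simp add: dispersion_def E'_def)
  qed
  have upd: "E' (x(1 := y)) = E' x" for x y
    unfolding E'_def by (intro sum.cong) auto
  have E'0: "0 \<le> E' p" for p unfolding E'_def by (intro sum_nonneg) simp
  have E'pos: "AE p in torus n. 0 < E' p"
    using AE_one_minus_cos_pos
  proof eventually_elim
    case (elim p)
    have "1 - cos (p 2) \<le> E' p" unfolding E'_def using n by (intro member_le_sum) auto
    moreover have "0 < 1 - cos (p 2)" using elim n by auto
    ultimately show ?case by simp
  qed
  define q where "q p = sqrt ((1 + E' p)\<^sup>2 - 1)" for p
  define r where "r p = 1 + E' p - q p" for p
  have [measurable]: "q \<in> borel_measurable (torus n)" "r \<in> borel_measurable (torus n)"
    unfolding q_def[abs_def] r_def[abs_def] by measurable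
  have q0: "0 \<le> q p" and q2: "(q p)\<^sup>2 = (1 + E' p)\<^sup>2 - 1" for p
    using E'0[of p] by (auto simp: q_def one_le_power)
  have qpos: "0 < q p" if "0 < E' p" for p
    using that by (simp add: q_def one_less_power)
  have rq: "r p = sqrt ((q p)\<^sup>2 + 1) - q p" for p
    using E'0[of p] by (simp add: r_def q2)
  have qle: "q p \<le> 1 + E' p" for p
  proof (rule power2_le_imp_le)
    show "(q p)\<^sup>2 \<le> (1 + E' p)\<^sup>2" unfolding q2 by simp
  qed (use E'0[of p] in simp)
  have r01: "0 \<le> r p" "r p \<le> 1" for p
  proof -
    show "0 \<le> r p" using qle by (simp add: r_def)
    have "(E' p)\<^sup>2 \<le> (q p)\<^sup>2" unfolding q2 using E'0[of p] by (simp add: power2_eq_square algebra_simps)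
    then have "E' p \<le> q p" using q0 by (rule power2_le_imp_le)
    then show "r p \<le> 1" by (simp add: r_def)
  qed
  \<comment> \<open>As q^2 = 2 E' + E'^2 \<ge> E', the function 1/q is bounded by E'^(-1/2) in the n
    - 1 remaining coordinates; that power is integrable because n - 1 \<ge> 2.\<close>
  have iq: "integrable (torus n) (\<lambda>p. 1 / q p)"
  proof (rule Bochner_Integration.integrable_bound)
    show "integrable (torus n) (\<lambda>p. (\<Sum>j\<in>{2..n}. 1 - cos (p j)) powr (- (1/2)))"
      using n by (intro integrable_partial_dispersion_powr) auto
    show "AE p in torus n. norm (1 / q p) \<le> norm ((\<Sum>j\<in>{2..n}. 1 - cos (p j)) powr (- (1/2)))"
      using E'pos
    proof eventually_elim
      case (elim p)
      have "sqrt (E' p) \<le> q p"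
        unfolding q_def using elim by (intro real_sqrt_le_mono) (simp add: power2_eq_square algebra_simps)
      then have "1 / q p \<le> 1 / sqrt (E' p)" using elim by (intro frac_le) auto
      also have "\<dots> = E' p powr (- (1/2))"
        using elim by (simp add: powr_minus powr_half_sqrt inverse_eq_divide)
      finally show ?case using q0[of p] by (simp add: E'_def)
    qed
  qed measurable
  have ir: "integrable (torus n) r"
    by (rule torus.integrable_const_bound[where B = 1]) (use r01 in \<open>auto simp: abs_of_nonneg\<close>)
  have irq: "integrable (torus n) (\<lambda>p. r p * (1 / q p))"
  proof (rule Bochner_Integration.integrable_bound[OF iq])
    show "AE p in torus n. norm (r p * (1 / q p)) \<le> norm (1 / q p)"
      using r01 q0 by (intro AE_I2) (auto simp: abs_mult divide_right_mono)
  qed measurable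
  \<comment> \<open>The closed forms require w > 1, while the fibrewise comparison asks for equality
    on every fibre. Both integrands are therefore set to 0 off E' > 0, a change on a null
    set.\<close>
  have fib: "mom n 0 (\<lambda>p. g (p 1)) = avg n G"
    if kg: "kint n 0 (\<lambda>p. g (p 1))" and iG: "integrable (torus n) G" and updG: "\<And>x y. G (x(1 := y)) = G x"
      and eq: "\<And>x. 0 < E' x \<Longrightarrow> (LINT y|circle. g y / (1 + E' x - cos y)) = 2 * pi * G x"
    for g G
  proof -
    have m1: "(\<lambda>p. g (p 1) / dispersion n p) \<in> borel_measurable (torus n)"
      using kint_int[OF kg] by (simp add: integrable_iff_bounded)
    have mG: "G \<in> borel_measurable (torus n)"
      using iG by simp
    have mif: "(\<lambda>p. if 0 < E' p then h p else 0) \<in> borel_measurable (torus n)"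
      if "h \<in> borel_measurable (torus n)" for h :: "(nat \<Rightarrow> real) \<Rightarrow> real"
      using that by (intro measurable_If) auto
    have "mom n 0 (\<lambda>p. g (p 1)) = avg n (\<lambda>p. if 0 < E' p then g (p 1) / dispersion n p else 0)"
      unfolding mom_def diff_0_right using E'pos
      by (intro avg_cong_AE m1 mif) (auto elim: eventually_mono)
    also have "\<dots> = avg n (\<lambda>p. if 0 < E' p then G p else 0)"
    proof (rule avg_eq_fiberwise)
      show "integrable (torus n) (\<lambda>p. if 0 < E' p then g (p 1) / dispersion n p else 0)"
        using kint_int[OF kg, unfolded diff_0_right] mif[OF m1] by (rule Bochner_Integration.integrable_bound) auto
      show "integrable (torus n) (\<lambda>p. if 0 < E' p then G p else 0)"
        using iG mif[OF mG] by (rule Bochner_Integration.integrable_bound) auto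
      show "(LINT y|circle. (if 0 < E' (x(1 := y)) then g ((x(1 := y)) 1) / dispersion n (x(1 := y)) else 0)) =
          (LINT y|circle. (if 0 < E' (x(1 := y)) then G (x(1 := y)) else 0))" for x
        using measure_circle eq[of x] unfolding upd updG E by auto
    qed (use n in auto)
    also have "\<dots> = avg n G"
      using E'pos by (intro avg_cong_AE mG mif) (auto elim: eventually_mono)
    finally show ?thesis .
  qed
  have updq: "q (x(1 := y)) = q x" and updr: "r (x(1 := y)) = r x" for x y
    by (simp_all only: q_def r_def upd)
  have k1: "kint n 0 (\<lambda>_. 1)" using n by (intro kint_one) auto
  have a: "a_int n 0 = avg n (\<lambda>p. 1 / q p)"
    unfolding a_int_mom using iq updq k1 integral_circle_inverse
    by (intro fib[of "\<lambda>_. 1"]) (auto simp: q_def)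
  have s: "s_int n 0 = avg n r"
    unfolding s_int_def
  proof (rule fib[of "\<lambda>x. (sin x)\<^sup>2"])
    show "kint n 0 (\<lambda>p. (sin (p 1))\<^sup>2)"
      using n by (intro kint_bound[OF k1, where K = 1] borel_measurable_power) (auto simp: abs_square_le_1)
    show "(LINT y|circle. (sin y)\<^sup>2 / (1 + E' x - cos y)) = 2 * pi * r x" if "0 < E' x" for x
      using that by (simp add: integral_circle_weighted r_def q_def)
  qed (use ir updr in auto)
  have b: "b_int n 0 = avg n (\<lambda>p. r p * (1 / q p))"
    unfolding b_int_mom
  proof (rule fib[of cos])
    show "kint n 0 (\<lambda>p. cos (p 1))"
      using n by (intro kint_bound[OF k1, where K = 1]) auto
    show "(LINT y|circle. cos y / (1 + E' x - cos y)) = 2 * pi * (r x * (1 / q x))" if "0 < E' x" for x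
    proof -
      have "r x * (1 / q x) = (1 + E' x) / q x - 1"
        using qpos[OF that] by (simp add: r_def field_simps)
      then show ?thesis
        using integral_circle_weighted(1)[of "1 + E' x"] that by (simp add: q_def)
    qed
  qed (use irq updr updq in auto)
  have dec: "sqrt (x\<^sup>2 + 1) - x < sqrt (y\<^sup>2 + 1) - y" if "0 \<le> y" "y < x" for x y :: real
  proof -
    have pos: "0 < sqrt (x\<^sup>2 + 1) + sqrt (y\<^sup>2 + 1)"
      by (intro add_pos_pos) (auto intro: add_nonneg_pos)
    have "x < sqrt (x\<^sup>2 + 1)" "y < sqrt (y\<^sup>2 + 1)"
      by (auto intro!: real_less_rsqrt)
    then have "x + y < sqrt (x\<^sup>2 + 1) + sqrt (y\<^sup>2 + 1)" by simp
    then have "(x - y) * (x + y) < (x - y) * (sqrt (x\<^sup>2 + 1) + sqrt (y\<^sup>2 + 1))"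
      using that by (intro mult_strict_left_mono) auto
    moreover have "(sqrt (x\<^sup>2 + 1) - sqrt (y\<^sup>2 + 1)) * (sqrt (x\<^sup>2 + 1) + sqrt (y\<^sup>2 + 1)) = (x - y) * (x + y)"
      by (simp add: algebra_simps power2_eq_square[symmetric])
    ultimately have "sqrt (x\<^sup>2 + 1) - sqrt (y\<^sup>2 + 1) < x - y"
      using mult_less_cancel_right_pos[OF pos, of "sqrt (x\<^sup>2 + 1) - sqrt (y\<^sup>2 + 1)" "x - y"] by linarith
    then show ?thesis by simp
  qed
  define m where "m = avg n r"
  have s0: "0 < m"
    unfolding m_def s[symmetric] using n by (intro s_int_pos) simp
  have "avg n r < avg n (\<lambda>_. 1)"
  proof (rule avg_less_AE[OF ir])
    show "\<not> (AE p in torus n. r p = 1)"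
    proof
      assume "AE p in torus n. r p = 1"
      with E'pos have "AE p in torus n. (1::real) = 0"
      proof eventually_elim
        case (elim p)
        then have "q p = E' p" by (simp add: r_def)
        then have "E' p = 0" using q2[of p] by (simp add: power2_eq_square algebra_simps)
        then show ?case using elim by simp
      qed
      then show False using not_AE_one by blast
    qed
  qed (use r01 in auto)
  then have m1: "m < 1" by (simp add: m_def)
  \<comment> \<open>The solution of sqrt (q0^2 + 1) - q0 = m: the value of q at which r equals its
    average m. It is positive because 0 < m < 1, and both factors in Chebyshev's inequality change
    sign at q = q0.\<close>
  define q0 where "q0 = (1 - m\<^sup>2) / (2 * m)"
  have q0pos: "0 < q0"
    using s0 m1 by (simp add: q0_def power2_less_1_iff abs_square_less_1)
  have mq0: "m = sqrt (q0\<^sup>2 + 1) - q0"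
  proof -
    have "q0\<^sup>2 + 1 = ((1 + m\<^sup>2) / (2 * m))\<^sup>2"
      using s0 by (simp add: q0_def power_divide field_simps power2_eq_square)
    then have "sqrt (q0\<^sup>2 + 1) = (1 + m\<^sup>2) / (2 * m)"
      using s0 by simp
    then show ?thesis using s0 by (simp add: q0_def field_simps power2_eq_square)
  qed
  have sgn: "0 < (r p - m) * (1 / q p - 1 / q0)" if "0 < q p" "q p \<noteq> q0" for p
  proof (cases "q p < q0")
    case True
    then have "r p - m > 0" unfolding rq mq0 using dec[of "q p" q0] that by simp
    moreover have "1 / q p - 1 / q0 > 0" using True that q0pos by (simp add: frac_less2)
    ultimately show ?thesis by simp
  next
    case False
    then have "q0 < q p" using that by simp
    then have "r p - m < 0" unfolding rq mq0 using dec[of q0 "q p"] q0pos by simp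
    moreover have "1 / q p - 1 / q0 < 0" using \<open>q0 < q p\<close> that q0pos by (simp add: frac_less2)
    ultimately show ?thesis by (rule mult_neg_neg)
  qed
  have "avg n r * avg n (\<lambda>p. 1 / q p) < avg n (\<lambda>p. r p * (1 / q p))"
  proof (rule avg_mult_greater[OF ir iq irq, of "1 / q0"])
    show "AE p in torus n. 0 \<le> (r p - avg n r) * (1 / q p - 1 / q0)"
      using E'pos
    proof eventually_elim
      case (elim p)
      show ?case
        using sgn[OF qpos[OF elim]] by (cases "q p = q0") (auto simp: m_def)
    qed
    show "\<not> (AE p in torus n. (r p - avg n r) * (1 / q p - 1 / q0) = 0)"
    proof
      assume "AE p in torus n. (r p - avg n r) * (1 / q p - 1 / q0) = 0"
      with E'pos have A: "AE p in torus n. q p = q0"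
      proof eventually_elim
        case (elim p)
        show ?case using sgn[OF qpos[OF elim(1)]] elim(2) by (cases "q p = q0") (auto simp: m_def)
      qed
      define c where "c = sqrt (q0\<^sup>2 + 1) - 1"
      have A: "AE p in torus n. E' p = c"
        using A
      proof eventually_elim
        case (elim p)
        then show ?case using E'0[of p] by (simp add: q2 c_def flip: elim)
      qed
      \<comment> \<open>Equality would make E' constant, that is, E - 1 + cos p_1 constant.
        Exchanging the first two coordinates gives the same constant with p_2, so cos p_1 = cos p_2
        almost everywhere.\<close>
      let ?T = "torus_map n (Transposition.transpose 1 2) (\<lambda>_ x. x)"
      have t: "Transposition.transpose 1 2 permutes {1..n}"
        using n by (intro permutes_swap_id) auto
      have "E' (?T p) = dispersion n p - 1 + cos (p 2)" for p
      proof -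
        have "dispersion n (?T p) = dispersion n p"
          by (rule dispersion_torus_map[OF t]) simp
        then show ?thesis
          using E[of "?T p"] n by (simp add: torus_map_apply)
      qed
      then have "AE p in torus n. dispersion n p - 1 + cos (p 2) = c"
        using AE_torus_map[OF t circle_map_id A] by simp
      with A have "AE p in torus n. cos (p 1) - cos (p 2) = 0"
        by eventually_elim (auto simp: E)
      then show False using not_AE_cos_diff[of n] n by simp
    qed
  qed
  then show ?thesis by (simp add: a b s)
qed

text \<open>The two squared sines add up to 2 E minus the squares of 1 - cos p_1 and 1 - cos p_2,
  hence to less than 2 E almost everywhere. By symmetry each sine contributes half of the
  average.\<close>

lemma s_int_dim2_less: "s_int 2 0 < 1"
proof -
  have k: "kint 2 0 (\<lambda>p. (sin (p j))\<^sup>2)" if "j \<in> {1..2}" for j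
    using that kint_mult[OF kint_sin[of j 2 0], of "\<lambda>p. sin (p j)" 1] by (simp add: power2_eq_square)
  have E: "dispersion 2 p = (1 - cos (p 1)) + (1 - cos (p 2))" for p
    by (simp add: dispersion_def numeral_2_eq_2)
  have pos: "AE p in torus 2. 0 < dispersion 2 p"
    by (rule AE_dispersion_pos) simp
  have less: "((sin (p 1))\<^sup>2 + (sin (p 2))\<^sup>2) / (dispersion 2 p - 0) < 2" if "0 < dispersion 2 p" for p
  proof -
    have "(sin (p 1))\<^sup>2 + (sin (p 2))\<^sup>2 = 2 * dispersion 2 p - ((1 - cos (p 1))\<^sup>2 + (1 - cos (p 2))\<^sup>2)"
      by (simp add: E sin_squared_eq power2_eq_square algebra_simps)
    moreover have "0 < (1 - cos (p 1))\<^sup>2 + (1 - cos (p 2))\<^sup>2"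
      using that by (auto simp: E sum_power2_gt_zero_iff)
    ultimately show ?thesis using that by (simp add: divide_less_eq)
  qed
  have "2 * s_int 2 0 = mom 2 0 (\<lambda>p. (sin (p 1))\<^sup>2) + mom 2 0 (\<lambda>p. (sin (p 2))\<^sup>2)"
    using mom_sin_sq[of 1 2 0] mom_sin_sq[of 2 2 0] by simp
  also have "\<dots> = mom 2 0 (\<lambda>p. (sin (p 1))\<^sup>2 + (sin (p 2))\<^sup>2)"
    using k by (intro mom_add[symmetric]) auto
  also have "\<dots> < avg 2 (\<lambda>_. 2)"
    unfolding mom_def
  proof (rule avg_less_AE)
    show "integrable (torus 2) (\<lambda>p. ((sin (p 1))\<^sup>2 + (sin (p 2))\<^sup>2) / (dispersion 2 p - 0))"
      using k by (intro kint_int kint_add) auto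
    show "AE p in torus 2. ((sin (p 1))\<^sup>2 + (sin (p 2))\<^sup>2) / (dispersion 2 p - 0) \<le> 2"
      using pos by eventually_elim (use less in \<open>auto intro: less_imp_le\<close>)
    show "\<not> (AE p in torus 2. ((sin (p 1))\<^sup>2 + (sin (p 2))\<^sup>2) / (dispersion 2 p - 0) = 2)"
    proof
      assume "AE p in torus 2. ((sin (p 1))\<^sup>2 + (sin (p 2))\<^sup>2) / (dispersion 2 p - 0) = 2"
      with pos have "AE p in torus 2. (1::real) = 0"
        by eventually_elim (use less in fastforce)
      then show False using not_AE_one by blast
    qed
  qed simp
  finally show ?thesis by simp
qed

lemma X_asym_less_lam_s:
  assumes n: "n \<ge> 2"
  shows "X_asym n < lam_s n"
proof (cases "n = 2")
  case True
  then show ?thesis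
    using s_int_dim2_less s_int_pos[of 2] by (simp add: X_asym_def lam_s_eq field_simps)
next
  case False
  then have n3: "n \<ge> 3" using n by simp
  have "0 < b_int n 0" using n3 by (intro b_int_pos) auto
  then show ?thesis
    using s_int_mult_a_int_less[OF n3] s_int_pos[OF n] n3 by (simp add: X_asym_def lam_s_eq field_simps)
qed

section \<open>The inequality \<open>lam_s\<close> < \<open>lam_c\<close>\<close>

lemma abs_cos_diff_le_2: "\<bar>cos x - cos y\<bar> \<le> 2" for x y :: real
  using cos_le_one[of x] cos_le_one[of y] cos_ge_minus_one[of x] cos_ge_minus_one[of y] by linarith

lemma abs_sin_add_le_2: "\<bar>sin x + sin y\<bar> \<le> 2" for x y :: real
  using sin_le_one[of x] sin_le_one[of y] sin_ge_minus_one[of x] sin_ge_minus_one[of y] by linarith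

text \<open>The map \<open>(p 1, p 2) \<mapsto> (p 2 + \<pi>/2, p 1 - \<pi>/2)\<close> negates the weight
  \<open>(sin (p 1) + sin (p 2))\<^sup>2 - (cos (p 1) - cos (p 2))\<^sup>2\<close>, and the translation by \<open>(\<pi>, \<pi>)\<close> leaves it
  invariant. The average of the integrand over the group generated by both is nonnegative.\<close>

lemma c_int_less_s_int:
  assumes n: "n \<ge> 2"
  shows "c_int n 0 < s_int n 0"
proof -
  have n1: "n \<ge> 1" "1 \<in> {1..n}" "2 \<in> {1..n}" using n by auto
  \<comment> \<open>The part of the energy fixed by both maps. The other part is -\<alpha>; on the
    remaining group elements it becomes +\<alpha>, -\<beta> and +\<beta>.\<close>
  define K where "K p = 2 + (\<Sum>j=3..n. 1 - cos (p j))" for p :: "nat \<Rightarrow> real"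
  have E: "dispersion n p = K p - (cos (p 1) + cos (p 2))" for p
  proof -
    have "{1..n} = insert 1 (insert 2 {3..n})" using n by auto
    then show ?thesis by (simp add: dispersion_def K_def)
  qed
  define S where "S p = sin (p 1) + sin (p 2)" for p :: "nat \<Rightarrow> real"
  define D where "D p = cos (p 1) - cos (p 2)" for p :: "nat \<Rightarrow> real"
  define N where "N p = (S p)\<^sup>2 - (D p)\<^sup>2" for p
  define \<alpha> where "\<alpha> p = cos (p 1) + cos (p 2)" for p :: "nat \<Rightarrow> real"
  define \<beta> where "\<beta> p = sin (p 1) - sin (p 2)" for p :: "nat \<Rightarrow> real"
  let ?\<rho> = "\<lambda>j::nat. if j \<in> {1, 2} then circle_shift pi else (\<lambda>x. x)"
  \<comment> \<open>The shift 3 pi/2 stands for -pi/2, since circle shifts range over [0, 2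
    pi).\<close>
  let ?\<tau> = "\<lambda>j::nat. if j = 1 then circle_shift (pi/2) else if j = 2 then circle_shift (3*pi/2) else (\<lambda>x. x)"
  let ?R = "torus_map n id ?\<rho>"
  let ?T = "torus_map n (Transposition.transpose 1 2) ?\<tau>"
  have R: "id permutes {1..n}" "circle_map (if j \<in> {1, 2} then circle_shift pi else (\<lambda>x. x))" for j :: nat
    by (auto simp: circle_map_id circle_map_shift permutes_id)
  have T: "Transposition.transpose 1 2 permutes {1..n}"
    "circle_map (if j = 1 then circle_shift (pi/2) else if j = 2 then circle_shift (3*pi/2) else (\<lambda>x. x))" for j :: nat
    using n1 by (auto simp: circle_map_id circle_map_shift intro: permutes_swap_id)
  have c3: "cos (x + 3 * pi / 2) = sin x" and s3: "sin (x + 3 * pi / 2) = - cos x" for x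
  proof -
    have "x + 3 * pi / 2 = (x + pi / 2) + pi" by simp
    then show "cos (x + 3 * pi / 2) = sin x" "sin (x + 3 * pi / 2) = - cos x"
      by (simp_all only: cos_periodic_pi sin_periodic_pi) (simp_all add: sin_add cos_add)
  qed
  have KR: "K (?R p) = K p" and KT: "K (?T p) = K p" for p
    unfolding K_def by (auto intro!: sum.cong simp: torus_map_apply Transposition.transpose_def)
  have Rv: "S (?R p) = - S p" "D (?R p) = - D p" "\<alpha> (?R p) = - \<alpha> p" for p
    using n1 by (auto simp: S_def D_def \<alpha>_def torus_map_apply cos_circle_shift sin_circle_shift)
  have Tv: "S (?T p) = - D p" "D (?T p) = - S p" "\<alpha> (?T p) = \<beta> p" for p
  proof -
    have "cos (?T p 1) = - sin (p 2)" "sin (?T p 1) = cos (p 2)"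
      using n1 by (simp_all add: torus_map_apply cos_circle_shift sin_circle_shift cos_add sin_add)
    moreover have "cos (?T p 2) = sin (p 1)" "sin (?T p 2) = - cos (p 1)"
      using n1 c3[of "p 1"] s3[of "p 1"] by (simp_all add: torus_map_apply cos_circle_shift sin_circle_shift)
    ultimately show "S (?T p) = - D p" "D (?T p) = - S p" "\<alpha> (?T p) = \<beta> p"
      unfolding S_def D_def \<alpha>_def \<beta>_def by simp_all
  qed
  have NR: "N (?R p) = N p" and NT: "N (?T p) = - N p" for p
    unfolding N_def Rv Tv by simp_all
  have kS: "kint n 0 (\<lambda>p. (S p)\<^sup>2)"
  proof -
    have "kint n 0 (\<lambda>p. S p * S p)"
      unfolding S_def using n1 n
      by (intro kint_mult[where K = 2] kint_add kint_sin)
        (auto intro: abs_sin_add_le_2)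
    then show ?thesis by (simp add: power2_eq_square)
  qed
  have kD: "kint n 0 (\<lambda>p. (D p)\<^sup>2)"
  proof -
    have "kint n 0 (\<lambda>p. D p * D p)"
      unfolding D_def using n1 n
      by (intro kint_mult[where K = 2] kint_cos_diff)
        (auto intro: abs_cos_diff_le_2)
    then show ?thesis by (simp add: power2_eq_square)
  qed
  have kN: "kint n 0 N"
    using kint_diff[OF kS kD] by (simp add: N_def[abs_def])
  have "mom n 0 (\<lambda>p. (S p)\<^sup>2) = 2 * s_int n 0"
  proof -
    have k: "kint n 0 (\<lambda>p. sin (p i) * sin (p j))" if "i \<in> {1, 2}" "j \<in> {1, 2}" for i j
      using that n by (intro kint_mult[where K = 1] kint_sin) auto
    have "mom n 0 (\<lambda>p. (S p)\<^sup>2) = mom n 0 (\<lambda>p. (sin (p 1) * sin (p 1) + sin (p 2) * sin (p 2)) +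
        2 * (sin (p 1) * sin (p 2)))"
      by (simp add: S_def power2_eq_square algebra_simps)
    also have "\<dots> = 2 * s_int n 0"
      using n1 by (simp add: mom_add mom_cmult k kint_add kint_cmult mom_sin_sin)
    finally show ?thesis .
  qed
  moreover have "mom n 0 (\<lambda>p. (D p)\<^sup>2) = 2 * c_int n 0"
    by (simp add: c_int_def D_def)
  ultimately have main: "mom n 0 N = 2 * s_int n 0 - 2 * c_int n 0"
    using mom_diff[OF kS kD] by (simp add: N_def[abs_def])
  let ?f = "\<lambda>p. N p / (dispersion n p - 0)"
  have f: "integrable (torus n) ?f" by (rule kint_int[OF kN])
  have fm: "?f \<in> borel_measurable (torus n)" using f by (rule borel_measurable_integrable)
  let ?fR = "\<lambda>p. ?f (?R p)"
  have fR: "integrable (torus n) ?fR"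
    by (rule iffD2[OF integrable_torus_map[OF R fm] f])
  have fRm: "?fR \<in> borel_measurable (torus n)" using fR by (rule borel_measurable_integrable)
  have aR: "avg n ?fR = avg n ?f" by (rule avg_torus_map[OF R fm])
  have fT: "integrable (torus n) (\<lambda>p. ?f (?T p))" "integrable (torus n) (\<lambda>p. ?fR (?T p))"
    by (rule iffD2[OF integrable_torus_map[OF T fm] f], rule iffD2[OF integrable_torus_map[OF T fRm] fR])
  have aT: "avg n (\<lambda>p. ?f (?T p)) = avg n ?f" "avg n (\<lambda>p. ?fR (?T p)) = avg n ?f"
    by (rule avg_torus_map[OF T fm], rule trans[OF avg_torus_map[OF T fRm] aR])
  \<comment> \<open>The sum over the group: N over K - \<alpha> and K + \<alpha>, minus N over K -
    \<beta> and K + \<beta>. Its average is four times that of N / E, that is, 8 (s - c).\<close>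
  let ?g = "\<lambda>p. (?f p + ?fR p) + (?f (?T p) + ?fR (?T p))"
  have "avg n ?g = 4 * mom n 0 N"
    using f fR fT aR aT by (simp add: avg_add mom_def)
  moreover have "0 < avg n ?g"
  proof (rule avg_pos)
    show "integrable (torus n) ?g" using f fR fT by (intro Bochner_Integration.integrable_add)
    have pos: "AE p in torus n. 0 < K p - \<alpha> p"
      using AE_dispersion_pos[OF n1(1)] by (simp add: E \<alpha>_def)
    have posR: "AE p in torus n. 0 < K p + \<alpha> p"
      using AE_torus_map[where \<phi> = ?\<rho>, OF R pos] unfolding KR Rv by simp
    have posT: "AE p in torus n. 0 < K p - \<beta> p"
      using AE_torus_map[where \<phi> = ?\<tau>, OF T pos] unfolding KT Tv .
    have posTR: "AE p in torus n. 0 < K p + \<beta> p"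
      using AE_torus_map[where \<phi> = ?\<tau>, OF T posR] unfolding KT Tv .
    \<comment> \<open>N and \<alpha>^2 - \<beta>^2 share the factor cos (p_1 - p_2), and their other
      factors multiply to 4 (sin (p_1 + p_2))^2. The group sum is proportional to N (\<alpha>^2 -
      \<beta>^2) with a positive factor, so it cannot be negative.\<close>
    have Ndec: "N p = (2 - 2 * cos (p 1 + p 2)) * cos (p 1 - p 2)"
      and Q: "(\<alpha> p)\<^sup>2 - (\<beta> p)\<^sup>2 = (2 + 2 * cos (p 1 + p 2)) * cos (p 1 - p 2)" for p
    proof -
      have id: "(s1 + s2)\<^sup>2 - (c1 - c2)\<^sup>2 = (2 - 2 * (c1 * c2 - s1 * s2)) * (c1 * c2 + s1 * s2)"
        "(c1 + c2)\<^sup>2 - (s1 - s2)\<^sup>2 = (2 + 2 * (c1 * c2 - s1 * s2)) * (c1 * c2 + s1 * s2)"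
        if "s1\<^sup>2 + c1\<^sup>2 = 1" "s2\<^sup>2 + c2\<^sup>2 = 1" for s1 s2 c1 c2 :: real
        using that by algebra+
      show "N p = (2 - 2 * cos (p 1 + p 2)) * cos (p 1 - p 2)"
        "(\<alpha> p)\<^sup>2 - (\<beta> p)\<^sup>2 = (2 + 2 * cos (p 1 + p 2)) * cos (p 1 - p 2)"
        unfolding N_def S_def D_def \<alpha>_def \<beta>_def cos_add cos_diff by (intro id; simp)+
    qed
    have g: "?g p = 2 * K p * (4 * (sin (p 1 + p 2))\<^sup>2 * (cos (p 1 - p 2))\<^sup>2) /
        ((K p - \<alpha> p) * (K p + \<alpha> p) * ((K p - \<beta> p) * (K p + \<beta> p)))"
      if "0 < K p - \<alpha> p" "0 < K p + \<alpha> p" "0 < K p - \<beta> p" "0 < K p + \<beta> p" for p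
    proof -
      have key: "x / u + - (x / v) = x * (v - u) / (u * v)" if "u > 0" "v > 0" for x u v :: real
        using that by (simp add: field_simps)
      have "?g p = (N p / (K p - \<alpha> p) + N p / (K p + \<alpha> p)) + (- N p / (K p - \<beta> p) + - N p / (K p + \<beta> p))"
        unfolding E NR NT KR KT \<alpha>_def[symmetric] Rv Tv by simp
      also have "N p / (K p - \<alpha> p) + N p / (K p + \<alpha> p) = 2 * K p * N p / ((K p - \<alpha> p) * (K p + \<alpha> p))"
        using that by (simp add: field_simps)
      also have "- N p / (K p - \<beta> p) + - N p / (K p + \<beta> p) = - (2 * K p * N p / ((K p - \<beta> p) * (K p + \<beta> p)))"
        using that by (simp add: field_simps)
      also note key[OF mult_pos_pos[OF that(1,2)] mult_pos_pos[OF that(3,4)], of "2 * K p * N p"]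
      finally have "?g p = 2 * K p * N p * ((K p - \<beta> p) * (K p + \<beta> p) - (K p - \<alpha> p) * (K p + \<alpha> p)) /
          ((K p - \<alpha> p) * (K p + \<alpha> p) * ((K p - \<beta> p) * (K p + \<beta> p)))" .
      also have "(K p - \<beta> p) * (K p + \<beta> p) - (K p - \<alpha> p) * (K p + \<alpha> p) = (\<alpha> p)\<^sup>2 - (\<beta> p)\<^sup>2"
        by (simp add: power2_eq_square algebra_simps)
      also have "2 * K p * N p * ((\<alpha> p)\<^sup>2 - (\<beta> p)\<^sup>2) = 2 * K p * (4 * (sin (p 1 + p 2))\<^sup>2 * (cos (p 1 - p 2))\<^sup>2)"
        unfolding Ndec Q sin_squared_eq by (simp add: power2_eq_square algebra_simps)
      finally show ?thesis .
    qed
    have K0: "0 < K p" for p unfolding K_def by (intro add_pos_nonneg sum_nonneg) auto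
    show "AE p in torus n. 0 \<le> ?g p"
      using pos posR posT posTR
    proof eventually_elim
      case (elim p)
      show ?case unfolding g[OF elim] using elim K0[of p]
        by (intro divide_nonneg_nonneg mult_nonneg_nonneg) auto
    qed
    show "\<not> (AE p in torus n. ?g p = 0)"
    proof
      assume "AE p in torus n. ?g p = 0"
      with pos posR posT posTR have A: "AE p in torus n. sin (p 1 + p 2) = 0 \<or> cos (p 1 - p 2) = 0"
      proof eventually_elim
        case (elim p)
        from elim(5) show ?case unfolding g[OF elim(1-4)] using elim(1-4) K0[of p] by auto
      qed
      have "(0::real) < 1/2 \<and> - pi \<le> 0 \<and> 1/2 \<le> pi"
        using pi_gt3 by simp
      then obtain p :: "nat \<Rightarrow> real" where p: "sin (p 1 + p 2) = 0 \<or> cos (p 1 - p 2) = 0"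
          "\<And>j. j \<in> {1..n} \<Longrightarrow> 0 < p j \<and> p j \<le> 1/2"
        using AE_torus_box_ex[OF A, of "\<lambda>_. 0" "\<lambda>_. 1/2"] by blast
      have "0 < p 1" "p 1 \<le> 1/2" "0 < p 2" "p 2 \<le> 1/2" using p(2)[of 1] p(2)[of 2] n by auto
      then have "0 < sin (p 1 + p 2)" "0 < cos (p 1 - p 2)"
        using pi_gt3 by (auto intro!: sin_gt_zero cos_gt_zero_pi)
      then show False using p(1) by auto
    qed
  qed
  ultimately show ?thesis using main by simp
qed

lemma c_int_pos:
  assumes n: "n \<ge> 2"
  shows "0 < c_int n 0"
proof -
  have "0 < mom n 0 (\<lambda>p. (cos (p 1) - cos (p 2))\<^sup>2)"
  proof (rule mom_pos)
    show "kint n 0 (\<lambda>p. (cos (p 1) - cos (p 2))\<^sup>2)"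
      using n kint_mult[OF kint_cos_diff[of 2 n 1 0], of "\<lambda>p. cos (p 1) - cos (p 2)" 2] abs_cos_diff_le_2
      by (simp add: power2_eq_square)
  qed (use n not_AE_cos_diff[OF n] in auto)
  then show ?thesis by (simp add: c_int_def)
qed

lemma lam_s_less_lam_c:
  assumes n: "n \<ge> 2"
  shows "lam_s n < lam_c n"
  unfolding lam_s_eq lam_c_eq using c_int_less_s_int[OF n] c_int_pos[OF n] by (simp add: less_imp_inverse_less)

subsection \<open>Dimension of a quotient via biorthogonal functionals\<close>

text \<open>Elimination, by induction on the set of equations: an unknown with nonzero coefficient
  in the new equation is expressed through the others, which leaves one equation and one unknown
  fewer.\<close>

lemma linear_dependence:
  fixes m :: "'a \<Rightarrow> 'i \<Rightarrow> complex"
  assumes "finite I" "finite A" "card I < card A"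
  shows "\<exists>c. (\<exists>i\<in>A. c i \<noteq> 0) \<and> (\<forall>j\<in>I. (\<Sum>i\<in>A. c i * m i j) = 0)"
  using assms
proof (induction I arbitrary: A m rule: finite_induct)
  case empty
  then obtain i where "i \<in> A" by fastforce
  then show ?case by (intro exI[of _ "\<lambda>_. 1"]) auto
next
  case (insert j I)
  show ?case
  proof (cases "\<forall>i\<in>A. m i j = 0")
    case True
    have "card I < card A" using insert by simp
    then obtain c where c: "\<exists>i\<in>A. c i \<noteq> 0" "\<forall>j\<in>I. (\<Sum>i\<in>A. c i * m i j) = 0"
      using insert.IH[of A m] insert.prems by blast
    moreover have "(\<Sum>i\<in>A. c i * m i j) = 0" using True by (intro sum.neutral) simp
    ultimately show ?thesis by auto
  next
    case False
    then obtain i0 where i0: "i0 \<in> A" "m i0 j \<noteq> 0" by blast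
    let ?A = "A - {i0}"
    let ?m = "\<lambda>i l. m i l - m i j / m i0 j * m i0 l"
    have "card I < card ?A" using insert i0 by simp
    then obtain c where c: "\<exists>i\<in>?A. c i \<noteq> 0" "\<forall>l\<in>I. (\<Sum>i\<in>?A. c i * ?m i l) = 0"
      using insert.IH[of ?A ?m] insert.prems by blast
    \<comment> \<open>The coefficient at i0 is determined by equation j; the elsewhere unchanged
      solution then satisfies the other equations because these were reduced by the same
      multiple.\<close>
    define c' where "c' i = (if i = i0 then - (\<Sum>i\<in>?A. c i * (m i j / m i0 j)) else c i)" for i
    have eq: "(\<Sum>i\<in>A. c' i * m i l) = (\<Sum>i\<in>?A. c i * ?m i l)" for l
    proof -
      have "(\<Sum>i\<in>A. c' i * m i l) = c' i0 * m i0 l + (\<Sum>i\<in>?A. c' i * m i l)"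
        using i0 insert.prems by (intro sum.remove) auto
      also have "(\<Sum>i\<in>?A. c' i * m i l) = (\<Sum>i\<in>?A. c i * m i l)"
        by (intro sum.cong) (auto simp: c'_def)
      also have "c' i0 * m i0 l = - (\<Sum>i\<in>?A. c i * (m i j / m i0 j * m i0 l))"
        by (simp add: c'_def sum_distrib_right mult.assoc)
      finally show ?thesis by (simp add: algebra_simps sum_subtractf)
    qed
    have "(\<Sum>i\<in>A. c' i * m i l) = 0" if "l \<in> insert j I" for l
    proof (cases "l = j")
      case True
      then show ?thesis unfolding eq using i0 by simp
    next
      case False
      then show ?thesis unfolding eq using that c by auto
    qed
    moreover have "\<exists>i\<in>A. c' i \<noteq> 0" using c by (auto simp: c'_def)
    ultimately show ?thesis by blast
  qed
qed

definition fun_subspace :: "('a \<Rightarrow> complex) set \<Rightarrow> bool" where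
  "fun_subspace V \<longleftrightarrow> (\<lambda>_. 0) \<in> V \<and> (\<forall>f\<in>V. \<forall>g\<in>V. (\<lambda>p. f p + g p) \<in> V) \<and>
     (\<forall>c. \<forall>f\<in>V. (\<lambda>p. c * f p) \<in> V)"

text \<open>Linearity is asked on V only: an average is additive on integrable functions, not on all
  functions.\<close>

definition functional_on :: "('a \<Rightarrow> complex) set \<Rightarrow> (('a \<Rightarrow> complex) \<Rightarrow> complex) \<Rightarrow> bool" where
  "functional_on V l \<longleftrightarrow> l (\<lambda>_. 0) = 0 \<and> (\<forall>f\<in>V. \<forall>g\<in>V. l (\<lambda>p. f p + g p) = l f + l g) \<and>
     (\<forall>c. \<forall>f\<in>V. l (\<lambda>p. c * f p) = c * l f)"

lemma fun_subspace_add: "fun_subspace V \<Longrightarrow> f \<in> V \<Longrightarrow> g \<in> V \<Longrightarrow> (\<lambda>p. f p + g p) \<in> V"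
  and fun_subspace_cmult: "fun_subspace V \<Longrightarrow> f \<in> V \<Longrightarrow> (\<lambda>p. c * f p) \<in> V"
  by (auto simp: fun_subspace_def)

lemma fun_subspace_sum:
  fixes k :: nat
  assumes "fun_subspace V" "\<And>i. i < k \<Longrightarrow> f i \<in> V"
  shows "(\<lambda>p. \<Sum>i<k. c i * f i p) \<in> V"
  using assms(2)
proof (induction k)
  case 0
  then show ?case using assms(1) by (simp add: fun_subspace_def)
next
  case (Suc k)
  then have "(\<lambda>p. \<Sum>i<k. c i * f i p) \<in> V" "(\<lambda>p. c k * f k p) \<in> V"
    using assms(1) by (simp_all add: fun_subspace_def)
  then show ?case using assms(1) by (simp add: fun_subspace_def)
qed

lemma functional_on_sum:
  fixes k :: nat
  assumes "fun_subspace V" "functional_on V l" "\<And>i. i < k \<Longrightarrow> f i \<in> V"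
  shows "l (\<lambda>p. \<Sum>i<k. c i * f i p) = (\<Sum>i<k. c i * l (f i))"
  using assms(3)
proof (induction k)
  case 0
  then show ?case using assms(2) by (simp add: functional_on_def)
next
  case (Suc k)
  have "(\<lambda>p. \<Sum>i<k. c i * f i p) \<in> V"
    using Suc by (intro fun_subspace_sum[OF assms(1)]) auto
  moreover have "(\<lambda>p. c k * f k p) \<in> V"
    using Suc assms(1) by (simp add: fun_subspace_def)
  ultimately have "l (\<lambda>p. \<Sum>i<Suc k. c i * f i p) = l (\<lambda>p. \<Sum>i<k. c i * f i p) + l (\<lambda>p. c k * f k p)"
    using assms(2) by (simp add: functional_on_def)
  then show ?case using Suc assms(2) by (simp add: functional_on_def)
qed

text \<open>Upper bound: among more than card I elements of V some nontrivial combination is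
  annihilated by all functionals, hence lies in W. Lower bound: the functionals vanish on W and
  separate the vectors b i, so no nontrivial combination of these lies in W.\<close>

lemma quotient_dim_eq:
  assumes V: "fun_subspace V" and l: "\<And>j. j \<in> I \<Longrightarrow> functional_on V (l j)" and I: "finite I"
    and ker: "\<And>f. f \<in> V \<Longrightarrow> (\<And>j. j \<in> I \<Longrightarrow> l j f = 0) \<Longrightarrow> f \<in> W"
    and b: "\<And>i. i \<in> I \<Longrightarrow> b i \<in> V"
    and lb: "\<And>i j. i \<in> I \<Longrightarrow> j \<in> I \<Longrightarrow> i \<noteq> j \<Longrightarrow> l j (b i) = 0"
    and lbi: "\<And>i. i \<in> I \<Longrightarrow> l i (b i) \<noteq> 0"
    and W: "\<And>f j. f \<in> W \<Longrightarrow> j \<in> I \<Longrightarrow> l j f = 0"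
  shows "quotient_dim V W = enat (card I)"
  unfolding quotient_dim_def
proof (rule antisym)
  show "Sup {enat k | k. \<exists>f :: nat \<Rightarrow> _ \<Rightarrow> complex. (\<forall>i<k. f i \<in> V) \<and>
      (\<forall>c :: nat \<Rightarrow> complex. (\<lambda>p. \<Sum>i<k. c i * f i p) \<in> W \<longrightarrow> (\<forall>i<k. c i = 0))} \<le> enat (card I)"
  proof (rule Sup_least, elim CollectE exE conjE)
    fix x k and f :: "nat \<Rightarrow> _ \<Rightarrow> complex"
    assume x: "x = enat k" and f: "\<forall>i<k. f i \<in> V"
      and ind: "\<forall>c :: nat \<Rightarrow> complex. (\<lambda>p. \<Sum>i<k. c i * f i p) \<in> W \<longrightarrow> (\<forall>i<k. c i = 0)"
    have "\<not> card I < k"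
    proof
      assume "card I < k"
      then obtain c where c: "\<exists>i\<in>{..<k}. c i \<noteq> 0" "\<forall>j\<in>I. (\<Sum>i<k. c i * l j (f i)) = 0"
        using linear_dependence[OF I, of "{..<k}" "\<lambda>i j. l j (f i)"] by auto
      have "(\<lambda>p. \<Sum>i<k. c i * f i p) \<in> W"
      proof (rule ker)
        show "(\<lambda>p. \<Sum>i<k. c i * f i p) \<in> V" using f by (intro fun_subspace_sum[OF V]) auto
        show "l j (\<lambda>p. \<Sum>i<k. c i * f i p) = 0" if "j \<in> I" for j
          using functional_on_sum[OF V l[OF that], of k f c] f c that by simp
      qed
      then show False using ind c(1) by auto
    qed
    then show "x \<le> enat (card I)" by (simp add: x)
  qed
  obtain h where h: "bij_betw h {..<card I} I"
    using ex_bij_betw_nat_finite[OF I] by (auto simp: atLeast0LessThan)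
  have hI: "h i \<in> I" if "i < card I" for i using h that by (auto simp: bij_betw_def)
  have hinj: "h i = h j \<longleftrightarrow> i = j" if "i < card I" "j < card I" for i j
    using h that by (auto simp: bij_betw_def inj_on_def)
  show "enat (card I) \<le> Sup {enat k | k. \<exists>f :: nat \<Rightarrow> _ \<Rightarrow> complex. (\<forall>i<k. f i \<in> V) \<and>
      (\<forall>c :: nat \<Rightarrow> complex. (\<lambda>p. \<Sum>i<k. c i * f i p) \<in> W \<longrightarrow> (\<forall>i<k. c i = 0))}"
  proof (rule Sup_upper, intro CollectI exI[of _ "card I"] exI[of _ "\<lambda>i. b (h i)"] conjI allI impI refl)
    show "b (h i) \<in> V" if "i < card I" for i using b hI that by blast
    fix c :: "nat \<Rightarrow> complex" and j
    assume W': "(\<lambda>p. \<Sum>i<card I. c i * b (h i) p) \<in> W" and j: "j < card I"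
    have "0 = l (h j) (\<lambda>p. \<Sum>i<card I. c i * b (h i) p)"
      using W[OF W' hI[OF j]] by simp
    also have "\<dots> = (\<Sum>i<card I. c i * l (h j) (b (h i)))"
      using functional_on_sum[OF V l[OF hI[OF j]], of "card I" "\<lambda>i. b (h i)" c] b hI by simp
    also have "\<dots> = (\<Sum>i<card I. if i = j then c j * l (h j) (b (h j)) else 0)"
      by (intro sum.cong) (auto simp: lb hI j hinj)
    also have "\<dots> = c j * l (h j) (b (h j))" using j by simp
    finally show "c j = 0" using lbi[OF hI[OF j]] by simp
  qed
qed

lemma quotient_dim_eq_0:
  assumes "fun_subspace V" "V \<subseteq> W"
  shows "quotient_dim V W = 0"
  using quotient_dim_eq[of V "{}" undefined W undefined] assms by (auto simp: zero_enat_def)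

lemma quotient_dim_pos:
  assumes V: "fun_subspace V" and W: "fun_subspace W" and "f \<in> V" "f \<notin> W"
  shows "quotient_dim V W \<noteq> 0"
proof -
  have "enat 1 \<le> quotient_dim V W"
    unfolding quotient_dim_def
  proof (rule Sup_upper, intro CollectI exI[of _ 1] exI[of _ "\<lambda>_. f"] conjI allI impI refl)
    show "f \<in> V" by fact
    fix c :: "nat \<Rightarrow> complex" and i :: nat
    assume c: "(\<lambda>p. \<Sum>i<1. c i * f p) \<in> W" and i: "i < 1"
    show "c i = 0"
    proof (rule ccontr)
      assume "c i \<noteq> 0"
      then have c0: "c 0 \<noteq> 0" using i by simp
      have "(\<lambda>p. c 0 * f p) \<in> W" using c by simp
      from fun_subspace_cmult[OF W this, of "inverse (c 0)"]
      have "(\<lambda>p. inverse (c 0) * (c 0 * f p)) \<in> W" .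
      also have "(\<lambda>p. inverse (c 0) * (c 0 * f p)) = f"
        using c0 by (simp add: fun_eq_iff flip: mult.assoc)
      finally show False using \<open>f \<notin> W\<close> by simp
    qed
  qed
  then show ?thesis by (auto simp: zero_enat_def)
qed

subsection \<open>Solutions and their moments\<close>

definition A_mom :: "nat \<Rightarrow> ((nat \<Rightarrow> real) \<Rightarrow> complex) \<Rightarrow> complex" where
  "A_mom n f = avg n f"

definition C_mom :: "nat \<Rightarrow> nat \<Rightarrow> ((nat \<Rightarrow> real) \<Rightarrow> complex) \<Rightarrow> complex" where
  "C_mom n j f = avg n (\<lambda>q. of_real (cos (q j)) * f q)"

definition S_mom :: "nat \<Rightarrow> nat \<Rightarrow> ((nat \<Rightarrow> real) \<Rightarrow> complex) \<Rightarrow> complex" where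
  "S_mom n j f = avg n (\<lambda>q. of_real (sin (q j)) * f q)"

definition trig :: "nat \<Rightarrow> complex \<Rightarrow> (nat \<Rightarrow> complex) \<Rightarrow> (nat \<Rightarrow> complex) \<Rightarrow> (nat \<Rightarrow> real) \<Rightarrow> complex" where
  "trig n \<alpha> \<beta> \<gamma> p = \<alpha> + (\<Sum>j=1..n. \<beta> j * of_real (cos (p j)) + \<gamma> j * of_real (sin (p j)))"

text \<open>One equation for both parities and for negative eigenvalues. The sine moments of an even
  function vanish, and so do the remaining moments of an odd one; intersecting with a parity class
  therefore recovers the separate equations. Integrability makes every moment a genuine
  integral.\<close>

definition sol :: "nat \<Rightarrow> real \<Rightarrow> real \<Rightarrow> real \<Rightarrow> ((nat \<Rightarrow> real) \<Rightarrow> complex) set" where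
  "sol n lam \<mu> z = {f. integrable (torus n) f \<and>
     (AE p in torus n. of_real (dispersion n p - z) * f p =
        trig n (of_real \<mu> * A_mom n f) (\<lambda>j. of_real lam * C_mom n j f) (\<lambda>j. of_real lam * S_mom n j f) p)}"

lemma trig_measurable [measurable]: "trig n \<alpha> \<beta> \<gamma> \<in> borel_measurable (torus n)"
  unfolding trig_def[abs_def]
  by (intro borel_measurable_add borel_measurable_sum borel_measurable_times borel_measurable_const
      measurable_compose[OF _ borel_measurable_of_real] cos_coord_measurable sin_coord_measurable) auto

lemma norm_trig_le: "norm (trig n \<alpha> \<beta> \<gamma> p) \<le> norm \<alpha> + (\<Sum>j=1..n. norm (\<beta> j) + norm (\<gamma> j))"
proof -
  have "norm (\<beta> j * of_real (cos (p j)) + \<gamma> j * of_real (sin (p j))) \<le> norm (\<beta> j) + norm (\<gamma> j)" for j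
    by (rule norm_triangle_le) (auto simp: norm_mult intro!: add_mono mult_left_le)
  then have "norm (\<Sum>j=1..n. \<beta> j * of_real (cos (p j)) + \<gamma> j * of_real (sin (p j))) \<le>
      (\<Sum>j=1..n. norm (\<beta> j) + norm (\<gamma> j))"
    by (rule sum_norm_le)
  then show ?thesis
    unfolding trig_def by (intro norm_triangle_le add_left_mono)
qed

lemma integrable_of_real_mult:
  fixes f :: "_ \<Rightarrow> complex"
  assumes f: "integrable (torus n) f" and g: "g \<in> borel_measurable (torus n)" "\<And>p. \<bar>g p\<bar> \<le> K"
  shows "integrable (torus n) (\<lambda>p. of_real (g p) * f p)"
proof (rule Bochner_Integration.integrable_bound)
  show "integrable (torus n) (\<lambda>p. K *\<^sub>R f p)" using f by simp
  have "norm (of_real (g p) * f p) \<le> norm (K *\<^sub>R f p)" for p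
    using mult_right_mono[OF order_trans[OF g(2)[of p] abs_ge_self] norm_ge_zero[of "f p"]] by (simp add: norm_mult)
  then show "AE p in torus n. norm (of_real (g p) * f p) \<le> norm (K *\<^sub>R f p)" by simp
  show "(\<lambda>p. of_real (g p) * f p) \<in> borel_measurable (torus n)"
    using f g(1) by (intro borel_measurable_times measurable_compose[OF _ borel_measurable_of_real]) auto
qed

lemma integrable_cos_mult:
  fixes f :: "_ \<Rightarrow> complex"
  shows "j \<in> {1..n} \<Longrightarrow> integrable (torus n) f \<Longrightarrow> integrable (torus n) (\<lambda>p. of_real (cos (p j)) * f p)"
  by (rule integrable_of_real_mult[where K = 1]) auto

lemma integrable_sin_mult:
  fixes f :: "_ \<Rightarrow> complex"
  shows "j \<in> {1..n} \<Longrightarrow> integrable (torus n) f \<Longrightarrow> integrable (torus n) (\<lambda>p. of_real (sin (p j)) * f p)"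
  by (rule integrable_of_real_mult[where K = 1]) auto

lemma mom_add_complex:
  fixes f g :: "_ \<Rightarrow> complex"
  assumes "integrable (torus n) f" "integrable (torus n) g"
  shows "A_mom n (\<lambda>p. f p + g p) = A_mom n f + A_mom n g"
    and "j \<in> {1..n} \<Longrightarrow> C_mom n j (\<lambda>p. f p + g p) = C_mom n j f + C_mom n j g"
    and "j \<in> {1..n} \<Longrightarrow> S_mom n j (\<lambda>p. f p + g p) = S_mom n j f + S_mom n j g"
  using assms
  by (auto simp: A_mom_def C_mom_def S_mom_def avg_add distrib_left integrable_cos_mult integrable_sin_mult)

lemma mom_cmult_complex:
  shows "A_mom n (\<lambda>p. c * f p) = c * A_mom n f"
    and "C_mom n j (\<lambda>p. c * f p) = c * C_mom n j f"
    and "S_mom n j (\<lambda>p. c * f p) = c * S_mom n j f"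
  by (simp_all add: A_mom_def C_mom_def S_mom_def mult.left_commute[of _ c])

lemma mom_zero_complex:
  "A_mom n (\<lambda>_. 0) = 0" "C_mom n j (\<lambda>_. 0) = 0" "S_mom n j (\<lambda>_. 0) = 0"
  by (simp_all add: A_mom_def C_mom_def S_mom_def)

lemma mom_null:
  assumes "f \<in> null_functions n"
  shows "A_mom n f = 0" "j \<in> {1..n} \<Longrightarrow> C_mom n j f = 0" "j \<in> {1..n} \<Longrightarrow> S_mom n j f = 0"
proof -
  have f: "f \<in> borel_measurable (torus n)" "AE p in torus n. f p = 0"
    using assms by (auto simp: null_functions_def)
  have *: "avg n (\<lambda>p. of_real (g p) * f p) = 0" if "g \<in> borel_measurable (torus n)" for g
  proof -
    have "avg n (\<lambda>p. of_real (g p) * f p) = avg n (\<lambda>_. 0)"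
      using f that
      by (intro avg_cong_AE borel_measurable_times measurable_compose[OF _ borel_measurable_of_real])
        (auto elim: eventually_mono)
    then show ?thesis by simp
  qed
  show "A_mom n f = 0" using *[of "\<lambda>_. 1"] by (simp add: A_mom_def)
  show "j \<in> {1..n} \<Longrightarrow> C_mom n j f = 0" using *[of "\<lambda>p. cos (p j)"] by (simp add: C_mom_def)
  show "j \<in> {1..n} \<Longrightarrow> S_mom n j f = 0" using *[of "\<lambda>p. sin (p j)"] by (simp add: S_mom_def)
qed

text \<open>Dividing by E - z writes f as a finite combination of integrable kernels, so
  integrability of f comes out as a conclusion and its average is linear in the
  coefficients.\<close>

lemma avg_of_weights:
  fixes f :: "_ \<Rightarrow> complex"
  assumes f: "f \<in> borel_measurable (torus n)" and n: "n \<ge> 1" and z: "z \<le> 0"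
    and k: "\<alpha> \<noteq> 0 \<Longrightarrow> kint n z g0"
      "\<And>j. j \<in> {1..n} \<Longrightarrow> kint n z (g j)" "\<And>j. j \<in> {1..n} \<Longrightarrow> kint n z (h j)"
    and eq: "AE p in torus n. of_real (dispersion n p - z) * f p =
      \<alpha> * of_real (g0 p) + (\<Sum>j=1..n. \<beta> j * of_real (g j p) + \<gamma> j * of_real (h j p))"
  shows "integrable (torus n) f"
    and "avg n f = \<alpha> * of_real (mom n z g0) +
      (\<Sum>j=1..n. \<beta> j * of_real (mom n z (g j)) + \<gamma> j * of_real (mom n z (h j)))"
proof -
  let ?K = "\<lambda>g p. complex_of_real (g p / (dispersion n p - z))"
  let ?F = "\<lambda>p. \<alpha> * ?K g0 p + (\<Sum>j=1..n. \<beta> j * ?K (g j) p + \<gamma> j * ?K (h j) p)"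
  have i0: "integrable (torus n) (\<lambda>p. \<alpha> * ?K g0 p)"
    using kint_int[OF k(1)] by (intro integrable_mult_right integrable_of_real)
  have ig: "integrable (torus n) (\<lambda>p. \<beta> j * ?K (g j) p)" and ih: "integrable (torus n) (\<lambda>p. \<gamma> j * ?K (h j) p)"
    if "j \<in> {1..n}" for j
    using kint_int[OF k(2)[OF that]] kint_int[OF k(3)[OF that]]
    by (intro integrable_mult_right integrable_of_real; simp)+
  have iF: "integrable (torus n) ?F"
    using i0 ig ih by (intro Bochner_Integration.integrable_add Bochner_Integration.integrable_sum) auto
  have ae: "AE p in torus n. f p = ?F p"
    using eq AE_dispersion_pos[OF n]
  proof eventually_elim
    case (elim p)
    have E: "dispersion n p - z \<noteq> 0" using elim z by simp
    then have "f p = (of_real (dispersion n p - z) * f p) / of_real (dispersion n p - z)"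
      by (simp del: of_real_diff)
    also have "\<dots> = ?F p"
      unfolding elim(1) using E
      by (simp add: add_divide_distrib sum_divide_distrib del: of_real_diff)
    finally show ?case .
  qed
  show "integrable (torus n) f"
    using iF integrable_cong_AE[OF f borel_measurable_integrable[OF iF] ae] by simp
  have "avg n f = avg n ?F"
    by (rule avg_cong_AE[OF ae f borel_measurable_integrable[OF iF]])
  also have "\<dots> = avg n (\<lambda>p. \<alpha> * ?K g0 p) + (\<Sum>j=1..n. avg n (\<lambda>p. \<beta> j * ?K (g j) p + \<gamma> j * ?K (h j) p))"
    by (subst avg_add[OF i0], intro Bochner_Integration.integrable_sum Bochner_Integration.integrable_add ig ih,
        assumption, assumption, subst avg_sum, intro Bochner_Integration.integrable_add ig ih) simp_all
  also have "(\<Sum>j=1..n. avg n (\<lambda>p. \<beta> j * ?K (g j) p + \<gamma> j * ?K (h j) p)) =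
      (\<Sum>j=1..n. \<beta> j * of_real (mom n z (g j)) + \<gamma> j * of_real (mom n z (h j)))"
    using ig ih by (intro sum.cong refl, subst avg_add) (auto simp: mom_def simp del: of_real_divide)
  also have "avg n (\<lambda>p. \<alpha> * ?K g0 p) = \<alpha> * of_real (mom n z g0)"
    by (simp add: mom_def del: of_real_divide)
  finally show "avg n f = \<alpha> * of_real (mom n z g0) +
      (\<Sum>j=1..n. \<beta> j * of_real (mom n z (g j)) + \<gamma> j * of_real (mom n z (h j)))" .
qed

context
  fixes n :: nat and z :: real
  assumes n: "n \<ge> 2" and z: "z \<le> 0"
begin

text \<open>The equation tested against a weight g with g / (E - z) integrable; all moment relations
  except the averaged equation are instances.\<close>

lemma avg_weight_mult:
  fixes f :: "_ \<Rightarrow> complex"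
  assumes f: "f \<in> borel_measurable (torus n)" and g: "kint n z g"
    and eq: "AE p in torus n. of_real (dispersion n p - z) * f p = trig n \<alpha> \<beta> \<gamma> p"
  shows "integrable (torus n) (\<lambda>p. of_real (g p) * f p)"
    and "avg n (\<lambda>p. of_real (g p) * f p) = \<alpha> * of_real (mom n z g) +
      (\<Sum>j=1..n. \<beta> j * of_real (mom n z (\<lambda>p. g p * cos (p j))) + \<gamma> j * of_real (mom n z (\<lambda>p. g p * sin (p j))))"
proof -
  have m: "(\<lambda>p. of_real (g p) * f p) \<in> borel_measurable (torus n)"
    using f kint_meas[OF g] by (intro borel_measurable_times measurable_compose[OF _ borel_measurable_of_real])
  have gc: "kint n z (\<lambda>p. g p * cos (p j))" and gs: "kint n z (\<lambda>p. g p * sin (p j))" if "j \<in> {1..n}" for j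
    using that by (auto intro!: kint_mult[OF g, where K = 1])
  have ae: "AE p in torus n. of_real (dispersion n p - z) * (of_real (g p) * f p) =
      \<alpha> * of_real (g p) + (\<Sum>j=1..n. \<beta> j * of_real (g p * cos (p j)) + \<gamma> j * of_real (g p * sin (p j)))"
    using eq
  proof eventually_elim
    case (elim p)
    have "of_real (dispersion n p - z) * (of_real (g p) * f p) = of_real (g p) * trig n \<alpha> \<beta> \<gamma> p"
      unfolding elim[symmetric] by (rule mult.left_commute)
    then show ?case
      by (simp add: trig_def sum_distrib_left algebra_simps)
  qed
  note * = avg_of_weights[OF m _ z g gc gs ae]
  show "integrable (torus n) (\<lambda>p. of_real (g p) * f p)" using *(1) n by simp
  show "avg n (\<lambda>p. of_real (g p) * f p) = \<alpha> * of_real (mom n z g) +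
      (\<Sum>j=1..n. \<beta> j * of_real (mom n z (\<lambda>p. g p * cos (p j))) + \<gamma> j * of_real (mom n z (\<lambda>p. g p * sin (p j))))"
    using *(2) n by simp
qed

lemma S_mom_trig:
  fixes f :: "_ \<Rightarrow> complex"
  assumes f: "f \<in> borel_measurable (torus n)"
    and eq: "AE p in torus n. of_real (dispersion n p - z) * f p = trig n \<alpha> \<beta> \<gamma> p"
    and k: "k \<in> {1..n}"
  shows "S_mom n k f = \<gamma> k * of_real (s_int n z)"
proof -
  have "S_mom n k f = (\<Sum>j=1..n. \<gamma> j * of_real (if k = j then s_int n z else 0))"
    unfolding S_mom_def avg_weight_mult(2)[OF f kint_sin[OF k n z] eq]
    using k by (simp add: mom_sin mom_sin_cos mom_sin_sin)
  also have "\<dots> = (\<Sum>j=1..n. if k = j then \<gamma> k * of_real (s_int n z) else 0)"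
    by (intro sum.cong) auto
  finally show ?thesis using k by simp
qed

text \<open>Stated for differences because a cosine difference is dominated by E and can be tested
  at the threshold in every dimension, whereas a single cosine is not small at the origin.\<close>

lemma C_mom_diff_trig:
  fixes f :: "_ \<Rightarrow> complex"
  assumes f: "integrable (torus n) f"
    and eq: "AE p in torus n. of_real (dispersion n p - z) * f p = trig n \<alpha> \<beta> \<gamma> p"
    and k: "i \<in> {1..n}" "k \<in> {1..n}"
  shows "C_mom n k f - C_mom n i f = (\<beta> k - \<beta> i) * of_real (c_int n z)"
proof (cases "i = k")
  case False
  have "C_mom n k f - C_mom n i f = avg n (\<lambda>p. of_real (cos (p k) - cos (p i)) * f p)"
    unfolding C_mom_def using k f
    by (subst avg_diff[symmetric]) (simp_all add: integrable_cos_mult left_diff_distrib)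
  also have "\<dots> = (\<Sum>j=1..n. \<beta> j * of_real (c_int n z * ((if j = k then 1 else 0) - (if j = i then 1 else 0))))"
    unfolding avg_weight_mult(2)[OF borel_measurable_integrable[OF f] kint_cos_diff[OF k z] eq]
    using k False z by (simp add: mom_cos_diff mom_cos_diff_sin mom_cos_diff_cos)
  also have "\<dots> = (\<Sum>j=1..n. (if j = k then \<beta> k * of_real (c_int n z) else 0) - (if j = i then \<beta> i * of_real (c_int n z) else 0))"
    by (intro sum.cong) (auto simp: False)
  also have "\<dots> = (\<beta> k - \<beta> i) * of_real (c_int n z)"
    using k by (simp add: sum_subtractf algebra_simps)
  finally show ?thesis .
qed simp

lemma A_mom_trig:
  fixes f :: "_ \<Rightarrow> complex"
  assumes f: "f \<in> borel_measurable (torus n)"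
    and eq: "AE p in torus n. of_real (dispersion n p - z) * f p = trig n \<alpha> \<beta> \<gamma> p"
    and z3: "z < 0 \<or> n \<ge> 3"
  shows "A_mom n f = \<alpha> * of_real (a_int n z) + (\<Sum>j=1..n. \<beta> j) * of_real (b_int n z)"
proof -
  have "kint n z (\<lambda>_. 1)" using z z3 n by (intro kint_one) auto
  from avg_weight_mult(2)[OF f this eq] show ?thesis
    by (simp add: A_mom_def a_int_mom mom_cos mom_sin sum_distrib_right)
qed

text \<open>The equation is averaged as it stands, with no division: sines and cosines on the right
  average to 0, and on the left (E - z) f = (n - z) f - (\<Sum> cos p_j) f. Hence the relation
  survives at the threshold for n = 2.\<close>

lemma sum_C_mom_trig:
  fixes f :: "_ \<Rightarrow> complex"
  assumes f: "integrable (torus n) f"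
    and eq: "AE p in torus n. of_real (dispersion n p - z) * f p = trig n \<alpha> \<beta> \<gamma> p"
  shows "(\<Sum>j=1..n. C_mom n j f) = of_real (n - z) * A_mom n f - \<alpha>"
proof -
  have ib: "integrable (torus n) (\<lambda>p. complex_of_real (g p))"
    if "g \<in> borel_measurable (torus n)" "\<And>p. \<bar>g p\<bar> \<le> 1" for g
    using that by (intro integrable_of_real torus.integrable_const_bound[where B = 1]) auto
  have it: "integrable (torus n) (\<lambda>p. \<beta> j * complex_of_real (cos (p j)))"
    "integrable (torus n) (\<lambda>p. \<gamma> j * complex_of_real (sin (p j)))" if "j \<in> {1..n}" for j
    using that by (auto intro!: integrable_mult_right ib)
  have itr: "integrable (torus n) (trig n \<alpha> \<beta> \<gamma>)"
    unfolding trig_def[abs_def] using it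
    by (intro Bochner_Integration.integrable_add Bochner_Integration.integrable_sum torus.integrable_const) auto
  have tr: "avg n (trig n \<alpha> \<beta> \<gamma>) = \<alpha>"
  proof -
    have "avg n (trig n \<alpha> \<beta> \<gamma>) = \<alpha> + (\<Sum>j=1..n. avg n (\<lambda>p. \<beta> j * complex_of_real (cos (p j)) + \<gamma> j * complex_of_real (sin (p j))))"
      unfolding trig_def[abs_def] using it
      by (subst avg_add, simp, force intro!: Bochner_Integration.integrable_sum, subst avg_sum) auto
    also have "(\<Sum>j=1..n. avg n (\<lambda>p. \<beta> j * complex_of_real (cos (p j)) + \<gamma> j * complex_of_real (sin (p j)))) = 0"
    proof (intro sum.neutral ballI)
      fix j assume j: "j \<in> {1..n}"
      show "avg n (\<lambda>p. \<beta> j * complex_of_real (cos (p j)) + \<gamma> j * complex_of_real (sin (p j))) = 0"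
        by (subst avg_add[OF it[OF j]]) (simp add: avg_sin[OF j] avg_cos[OF j])
    qed
    finally show ?thesis by simp
  qed
  have "(\<Sum>j=1..n. C_mom n j f) = avg n (\<lambda>p. \<Sum>j=1..n. of_real (cos (p j)) * f p)"
    unfolding C_mom_def using f by (intro avg_sum[symmetric] integrable_cos_mult) auto
  also have "\<dots> = avg n (\<lambda>p. of_real (n - z) * f p - trig n \<alpha> \<beta> \<gamma> p)"
  proof (rule avg_cong_AE)
    show "AE p in torus n. (\<Sum>j=1..n. of_real (cos (p j)) * f p) = of_real (n - z) * f p - trig n \<alpha> \<beta> \<gamma> p"
      using eq
    proof eventually_elim
      case (elim p)
      have "(\<Sum>j=1..n. of_real (cos (p j)) * f p) = of_real (\<Sum>j=1..n. cos (p j)) * f p"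
        by (simp add: sum_distrib_right)
      also have "\<dots> = of_real (n - z) * f p - of_real (dispersion n p - z) * f p"
        unfolding sum_cos_eq by (simp add: algebra_simps)
      finally show ?case by (simp only: elim)
    qed
    show "(\<lambda>p. \<Sum>j=1..n. complex_of_real (cos (p j)) * f p) \<in> borel_measurable (torus n)"
      using f by (intro borel_measurable_sum borel_measurable_integrable integrable_cos_mult) auto
  qed (use f in measurable)
  also have "\<dots> = of_real (n - z) * A_mom n f - \<alpha>"
    using f itr by (subst avg_diff) (auto simp: tr A_mom_def simp del: of_real_diff)
  finally show ?thesis .
qed

end

text \<open>By symmetry the n moments agree, and together they are the average of E / E.\<close>

lemma mom_one_minus_cos:
  assumes j: "j \<in> {1..n}" and n: "n \<ge> 2"
  shows "kint n 0 (\<lambda>p. 1 - cos (p j))" "mom n 0 (\<lambda>p. 1 - cos (p j)) = 1 / n"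
proof -
  have k: "kint n 0 (\<lambda>p. 1 - cos (p i))" if "i \<in> {1..n}" for i
    using that one_minus_cos_le_dispersion[of i n] by (intro kint_bounded[where K = 1]) auto
  show "kint n 0 (\<lambda>p. 1 - cos (p j))" by (rule k[OF j])
  have eq: "mom n 0 (\<lambda>p. 1 - cos (p i)) = mom n 0 (\<lambda>p. 1 - cos (p j))" if i: "i \<in> {1..n}" for i
    using mom_diff[OF k[OF i] k[OF j]] mom_cos_diff[OF i j, of 0] by simp
  have "(\<Sum>i\<in>{1..n}. mom n 0 (\<lambda>p. 1 - cos (p i))) = mom n 0 (dispersion n)"
    using k by (subst mom_sum[symmetric]) (simp_all add: dispersion_def[abs_def])
  also have "\<dots> = avg n (\<lambda>_. 1)"
    unfolding mom_def
  proof (rule avg_cong_AE)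
    have "1 \<le> n" using n by simp
    from AE_dispersion_pos[OF this] show "AE p in torus n. dispersion n p / (dispersion n p - 0) = 1"
      by eventually_elim simp
  qed measurable
  finally have "n * mom n 0 (\<lambda>p. 1 - cos (p j)) = 1"
    by (simp add: eq)
  then show "mom n 0 (\<lambda>p. 1 - cos (p j)) = 1 / n"
    using n by (simp add: field_simps)
qed

text \<open>The hypothesis says that the numerator vanishes at p = 0; the constant then merges with
  the cosines into terms 1 - cos p_j, which are dominated by E.\<close>

lemma trig_sum_zero:
  assumes "\<alpha> + (\<Sum>j=1..n. \<beta> j) = 0"
  shows "trig n \<alpha> \<beta> \<gamma> p = (\<Sum>j=1..n. - \<beta> j * of_real (1 - cos (p j)) + \<gamma> j * of_real (sin (p j)))"
proof -
  have "\<alpha> = - (\<Sum>j=1..n. \<beta> j)" using assms by (simp add: eq_neg_iff_add_eq_0)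
  then show ?thesis
    by (simp add: trig_def algebra_simps sum.distrib sum_subtractf sum_negf)
qed

text \<open>The threshold substitute for the relation through a and b: f is a combination of the
  functions (1 - cos p_j) / E, each of average 1/n, and of sine terms of average 0.\<close>

lemma A_mom_trig_threshold:
  fixes f :: "_ \<Rightarrow> complex"
  assumes n: "n \<ge> 2" and f: "f \<in> borel_measurable (torus n)"
    and eq: "AE p in torus n. of_real (dispersion n p - 0) * f p = trig n \<alpha> \<beta> \<gamma> p"
    and 0: "\<alpha> + (\<Sum>j=1..n. \<beta> j) = 0"
  shows "A_mom n f = - (\<Sum>j=1..n. \<beta> j) / n"
proof -
  have "AE p in torus n. of_real (dispersion n p - 0) * f p =
      0 * of_real ((\<lambda>_. 0) p) + (\<Sum>j=1..n. - \<beta> j * of_real (1 - cos (p j)) + \<gamma> j * of_real (sin (p j)))"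
    using eq unfolding trig_sum_zero[OF 0] by simp
  from avg_of_weights(2)[OF f _ order_refl _ _ _ this]
  have "avg n f = (\<Sum>j=1..n. - \<beta> j * of_real (mom n 0 (\<lambda>p. 1 - cos (p j))) + \<gamma> j * of_real (mom n 0 (\<lambda>p. sin (p j))))"
    using n by (simp add: mom_one_minus_cos(1) kint_sin)
  also have "\<dots> = (\<Sum>j=1..n. - \<beta> j * of_real (1 / n))"
    using n by (intro sum.cong refl) (simp add: mom_one_minus_cos(2) mom_sin)
  finally show ?thesis by (simp add: A_mom_def sum_negf sum_divide_distrib)
qed

subsection \<open>Function spaces\<close>

lemma norm_powr_two: "norm x powr 2 = (norm x)\<^sup>2" for x :: complex
  by (cases "x = 0") auto

lemma Lp2_iff: "f \<in> Lp n 2 \<longleftrightarrow> f \<in> borel_measurable (torus n) \<and> integrable (torus n) (\<lambda>p. (norm (f p))\<^sup>2)"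
  unfolding Lp_def mem_Collect_eq norm_powr_two ..

lemma Lp1_iff: "f \<in> Lp n 1 \<longleftrightarrow> integrable (torus n) f"
proof -
  have "f \<in> Lp n 1 \<longleftrightarrow> f \<in> borel_measurable (torus n) \<and> integrable (torus n) (\<lambda>p. norm (f p))"
    by (simp add: Lp_def)
  also have "\<dots> \<longleftrightarrow> integrable (torus n) f"
    using integrable_norm_iff[of f "torus n"] by auto
  finally show ?thesis .
qed

lemma Lp2_imp_integrable:
  assumes "f \<in> Lp n 2"
  shows "integrable (torus n) f"
proof (rule Bochner_Integration.integrable_bound)
  show "integrable (torus n) (\<lambda>p. 1 + (norm (f p))\<^sup>2)"
    using assms by (simp add: Lp2_iff)
  have "x \<le> 1 + x\<^sup>2" for x :: real
    using sum_squares_bound[of x 1] zero_le_power2[of x] by (simp add: power2_eq_square) (smt (verit) zero_le_square)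
  then show "AE p in torus n. norm (f p) \<le> norm (1 + (norm (f p))\<^sup>2)"
    by (simp add: abs_of_nonneg)
qed (use assms in \<open>simp add: Lp2_iff\<close>)

lemma bounded_imp_Lp2:
  assumes "f \<in> borel_measurable (torus n)" "AE p in torus n. norm (f p) \<le> K"
  shows "f \<in> Lp n 2"
  unfolding Lp2_iff
proof
  show "integrable (torus n) (\<lambda>p. (norm (f p))\<^sup>2)"
  proof (rule torus.integrable_const_bound)
    show "AE p in torus n. norm ((norm (f p))\<^sup>2) \<le> K\<^sup>2"
      using assms(2) by eventually_elim (auto intro: power_mono)
  qed (use assms in measurable)
qed fact

lemma norm_sum_sq_le: "(norm (x + y))\<^sup>2 \<le> 2 * (norm x)\<^sup>2 + 2 * (norm y)\<^sup>2" for x y :: complex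
proof -
  have "(norm (x + y))\<^sup>2 \<le> (norm x + norm y)\<^sup>2"
    by (intro power_mono norm_triangle_ineq) auto
  also have "\<dots> \<le> 2 * (norm x)\<^sup>2 + 2 * (norm y)\<^sup>2"
    using sum_squares_bound[of "norm x" "norm y"] by (simp add: power2_sum)
  finally show ?thesis .
qed

lemma fun_subspace_Lp2: "fun_subspace (Lp n 2)"
  unfolding fun_subspace_def
proof (intro conjI ballI allI)
  show "(\<lambda>_. 0) \<in> Lp n 2" by (simp add: Lp2_iff)
next
  fix f g assume f: "f \<in> Lp n 2" and g: "g \<in> Lp n 2"
  then have [measurable]: "f \<in> borel_measurable (torus n)" "g \<in> borel_measurable (torus n)"
    by (auto simp: Lp2_iff)
  have "integrable (torus n) (\<lambda>p. (norm (f p + g p))\<^sup>2)"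
  proof (rule Bochner_Integration.integrable_bound)
    show "integrable (torus n) (\<lambda>p. 2 * (norm (f p))\<^sup>2 + 2 * (norm (g p))\<^sup>2)"
      using f g by (auto simp: Lp2_iff)
    show "AE p in torus n. norm ((norm (f p + g p))\<^sup>2) \<le> norm (2 * (norm (f p))\<^sup>2 + 2 * (norm (g p))\<^sup>2)"
      using norm_sum_sq_le by simp
  qed measurable
  then show "(\<lambda>p. f p + g p) \<in> Lp n 2" by (simp add: Lp2_iff)
next
  fix c :: complex and f assume "f \<in> Lp n 2"
  then show "(\<lambda>p. c * f p) \<in> Lp n 2" by (auto simp: Lp2_iff norm_mult power_mult_distrib)
qed

lemma fun_subspace_Int: "fun_subspace V \<Longrightarrow> fun_subspace W \<Longrightarrow> fun_subspace (V \<inter> W)"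
  by (auto simp: fun_subspace_def)

lemma fun_subspace_null: "fun_subspace (null_functions n)"
  unfolding fun_subspace_def null_functions_def by (auto elim: eventually_elim2 eventually_mono)

lemma null_subset_Lp2: "null_functions n \<subseteq> Lp n 2"
proof
  fix f assume "f \<in> null_functions n"
  then show "f \<in> Lp n 2"
    by (intro bounded_imp_Lp2[where K = 0]) (auto simp: null_functions_def elim: eventually_mono)
qed

lemma fun_subspace_even: "fun_subspace (even_functions n)"
  unfolding fun_subspace_def even_functions_def by (auto elim: eventually_elim2 eventually_mono)

lemma fun_subspace_odd: "fun_subspace (odd_functions n)"
  unfolding fun_subspace_def odd_functions_def by (auto elim: eventually_elim2 eventually_mono)

lemma torus_uminus_eq: "torus_uminus n = torus_map n id (\<lambda>_. circle_neg)"
  by (auto simp: fun_eq_iff torus_uminus_def torus_map_def circle_neg_def)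

lemma avg_antisymmetric:
  fixes g :: "_ \<Rightarrow> complex"
  assumes g: "g \<in> borel_measurable (torus n)" and "AE p in torus n. g (torus_uminus n p) = - g p"
  shows "avg n g = 0"
proof -
  note m = measurable_torus_map[OF permutes_id circle_map_neg g]
  have "avg n g = avg n (\<lambda>p. g (torus_uminus n p))"
    unfolding torus_uminus_eq by (rule avg_torus_map[OF permutes_id circle_map_neg g, symmetric])
  also have "\<dots> = avg n (\<lambda>p. - g p)"
    using assms m by (intro avg_cong_AE) (auto simp: torus_uminus_eq)
  finally have "avg n g = - avg n g" by simp
  then show ?thesis by simp
qed

lemma cos_torus_uminus: "j \<in> {1..n} \<Longrightarrow> cos (torus_uminus n p j) = cos (p j)"
  and sin_torus_uminus: "j \<in> {1..n} \<Longrightarrow> sin (torus_uminus n p j) = - sin (p j)"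
  by (auto simp: torus_uminus_def)

lemma dispersion_torus_uminus: "dispersion n (torus_uminus n p) = dispersion n p"
  unfolding torus_uminus_eq by (rule dispersion_torus_map[OF permutes_id]) simp

lemma measurable_of_real_mult:
  fixes f :: "_ \<Rightarrow> complex"
  assumes "g \<in> borel_measurable M" "f \<in> borel_measurable M"
  shows "(\<lambda>p. of_real (g p) * f p) \<in> borel_measurable M"
  using assms by (intro borel_measurable_times measurable_compose[OF _ borel_measurable_of_real])

lemma even_S_mom:
  assumes f: "f \<in> even_functions n" and j: "j \<in> {1..n}"
  shows "S_mom n j f = 0"
  unfolding S_mom_def
proof (rule avg_antisymmetric)
  have f': "f \<in> borel_measurable (torus n)" "AE p in torus n. f (torus_uminus n p) = f p"
    using f by (auto simp: even_functions_def)
  show "(\<lambda>p. of_real (sin (p j)) * f p) \<in> borel_measurable (torus n)"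
    using f' j by (intro measurable_of_real_mult) auto
  show "AE p in torus n. of_real (sin (torus_uminus n p j)) * f (torus_uminus n p) = - (of_real (sin (p j)) * f p)"
    using f'(2) by eventually_elim (simp add: sin_torus_uminus[OF j])
qed

lemma odd_A_mom:
  assumes f: "f \<in> odd_functions n"
  shows "A_mom n f = 0"
  unfolding A_mom_def using f by (intro avg_antisymmetric) (auto simp: odd_functions_def)

lemma odd_C_mom:
  assumes f: "f \<in> odd_functions n" and j: "j \<in> {1..n}"
  shows "C_mom n j f = 0"
  unfolding C_mom_def
proof (rule avg_antisymmetric)
  have f': "f \<in> borel_measurable (torus n)" "AE p in torus n. f (torus_uminus n p) = - f p"
    using f by (auto simp: odd_functions_def)
  show "(\<lambda>p. of_real (cos (p j)) * f p) \<in> borel_measurable (torus n)"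
    using f' j by (intro measurable_of_real_mult) auto
  show "AE p in torus n. of_real (cos (torus_uminus n p j)) * f (torus_uminus n p) = - (of_real (cos (p j)) * f p)"
    using f'(2) by eventually_elim (simp add: cos_torus_uminus[OF j])
qed

subsection \<open>Reduction of the equations\<close>

lemma trig_cong: "(\<And>j. j \<in> {1..n} \<Longrightarrow> \<beta> j = \<beta>' j) \<Longrightarrow> (\<And>j. j \<in> {1..n} \<Longrightarrow> \<gamma> j = \<gamma>' j) \<Longrightarrow>
    trig n \<alpha> \<beta> \<gamma> = trig n \<alpha> \<beta>' \<gamma>'"
  unfolding trig_def[abs_def] by (intro ext arg_cong2[where f = "(+)"] refl sum.cong) auto

lemma trig_add: "trig n \<alpha> \<beta> \<gamma> p + trig n \<alpha>' \<beta>' \<gamma>' p =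
    trig n (\<alpha> + \<alpha>') (\<lambda>j. \<beta> j + \<beta>' j) (\<lambda>j. \<gamma> j + \<gamma>' j) p"
  by (simp add: trig_def sum.distrib algebra_simps)

lemma fun_subspace_sol: "fun_subspace (sol n lam \<mu> z)"
  unfolding fun_subspace_def
proof (intro conjI ballI allI)
  show "(\<lambda>_. 0) \<in> sol n lam \<mu> z"
    by (simp add: sol_def trig_def mom_zero_complex)
next
  fix f g assume f: "f \<in> sol n lam \<mu> z" and g: "g \<in> sol n lam \<mu> z"
  then have i: "integrable (torus n) f" "integrable (torus n) g" by (auto simp: sol_def)
  have "AE p in torus n. of_real (dispersion n p - z) * (f p + g p) =
      trig n (of_real \<mu> * A_mom n (\<lambda>p. f p + g p)) (\<lambda>j. of_real lam * C_mom n j (\<lambda>p. f p + g p))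
        (\<lambda>j. of_real lam * S_mom n j (\<lambda>p. f p + g p)) p"
    using f[unfolded sol_def mem_Collect_eq, THEN conjunct2] g[unfolded sol_def mem_Collect_eq, THEN conjunct2]
  proof eventually_elim
    case (elim p)
    have "trig n (of_real \<mu> * A_mom n (\<lambda>p. f p + g p)) (\<lambda>j. of_real lam * C_mom n j (\<lambda>p. f p + g p))
        (\<lambda>j. of_real lam * S_mom n j (\<lambda>p. f p + g p)) p =
      trig n (of_real \<mu> * A_mom n f) (\<lambda>j. of_real lam * C_mom n j f) (\<lambda>j. of_real lam * S_mom n j f) p +
      trig n (of_real \<mu> * A_mom n g) (\<lambda>j. of_real lam * C_mom n j g) (\<lambda>j. of_real lam * S_mom n j g) p"
      unfolding trig_add distrib_left[symmetric] mom_add_complex(1)[OF i]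
      by (subst trig_cong[of n _ "\<lambda>j. of_real lam * (C_mom n j f + C_mom n j g)"
          _ "\<lambda>j. of_real lam * (S_mom n j f + S_mom n j g)"]) (simp_all add: mom_add_complex[OF i])
    then show ?case by (simp only: elim distrib_left)
  qed
  then show "(\<lambda>p. f p + g p) \<in> sol n lam \<mu> z" using i by (simp add: sol_def)
next
  fix c :: complex and f assume f: "f \<in> sol n lam \<mu> z"
  then have i: "integrable (torus n) f" by (auto simp: sol_def)
  have "AE p in torus n. of_real (dispersion n p - z) * (c * f p) =
      trig n (of_real \<mu> * A_mom n (\<lambda>p. c * f p)) (\<lambda>j. of_real lam * C_mom n j (\<lambda>p. c * f p))
        (\<lambda>j. of_real lam * S_mom n j (\<lambda>p. c * f p)) p"
    using f[unfolded sol_def mem_Collect_eq, THEN conjunct2]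
  proof eventually_elim
    case (elim p)
    have "trig n (of_real \<mu> * A_mom n (\<lambda>p. c * f p)) (\<lambda>j. of_real lam * C_mom n j (\<lambda>p. c * f p))
        (\<lambda>j. of_real lam * S_mom n j (\<lambda>p. c * f p)) p =
      c * trig n (of_real \<mu> * A_mom n f) (\<lambda>j. of_real lam * C_mom n j f) (\<lambda>j. of_real lam * S_mom n j f) p"
      by (simp add: trig_def mom_cmult_complex sum_distrib_left algebra_simps)
    then show ?case by (simp only: elim[symmetric] mult.left_commute)
  qed
  then show "(\<lambda>p. c * f p) \<in> sol n lam \<mu> z" using i by (simp add: sol_def)
qed

lemma He_op_eq:
  "He_op n lam \<mu> f p = of_real (dispersion n p) * f p -
     trig n (of_real \<mu> * A_mom n f) (\<lambda>j. of_real lam * C_mom n j f) (\<lambda>_. 0) p"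
  by (simp add: He_op_def trig_def A_mom_def C_mom_def avg_def scaleR_conv_of_real sum_distrib_left
      mult_ac divide_inverse)

lemma Ho_op_eq:
  "Ho_op n lam f p = of_real (dispersion n p) * f p -
     trig n 0 (\<lambda>_. 0) (\<lambda>j. of_real lam * S_mom n j f) p"
  by (simp add: Ho_op_def trig_def S_mom_def avg_def scaleR_conv_of_real sum_distrib_left
      mult_ac divide_inverse)

lemma H_op_eq:
  assumes f: "integrable (torus n) f"
  shows "H_op n lam \<mu> f p = of_real (dispersion n p) * f p -
     trig n (of_real \<mu> * A_mom n f) (\<lambda>j. of_real lam * C_mom n j f) (\<lambda>j. of_real lam * S_mom n j f) p"
proof -
  let ?c = "\<lambda>j. complex_of_real (cos (p j))" and ?s = "\<lambda>j. complex_of_real (sin (p j))"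
  let ?F = "\<lambda>s. of_real \<mu> * f s + (\<Sum>j=1..n. (of_real lam * ?c j) * (of_real (cos (s j)) * f s) +
      (of_real lam * ?s j) * (of_real (sin (s j)) * f s))"
  have "(LINT s|torus n. of_real (\<mu> + lam * (\<Sum>j=1..n. cos (p j - s j))) * f s) = (LINT s|torus n. ?F s)"
    by (intro Bochner_Integration.integral_cong refl)
      (simp add: cos_diff distrib_right distrib_left sum_distrib_left sum_distrib_right mult_ac)
  also have "\<dots> = (LINT s|torus n. of_real \<mu> * f s) + (\<Sum>j=1..n. (LINT s|torus n. (of_real lam * ?c j) * (of_real (cos (s j)) * f s)) +
      (LINT s|torus n. (of_real lam * ?s j) * (of_real (sin (s j)) * f s)))"
    using f integrable_cos_mult[OF _ f] integrable_sin_mult[OF _ f]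
    by (subst Bochner_Integration.integral_add) (auto intro!: Bochner_Integration.integrable_sum)
  also have "\<dots> = of_real \<mu> * integral\<^sup>L (torus n) f + (\<Sum>j=1..n.
      (of_real lam * ?c j) * (LINT s|torus n. of_real (cos (s j)) * f s) +
      (of_real lam * ?s j) * (LINT s|torus n. of_real (sin (s j)) * f s))"
    by (simp only: integral_mult_right_zero)
  finally have "of_real (1 / (2 * pi) ^ n) * (LINT s|torus n. of_real (\<mu> + lam * (\<Sum>j=1..n. cos (p j - s j))) * f s) =
      of_real (1 / (2 * pi) ^ n) * \<dots>"
    by (rule arg_cong)
  also have "\<dots> = trig n (of_real \<mu> * A_mom n f) (\<lambda>j. of_real lam * C_mom n j f) (\<lambda>j. of_real lam * S_mom n j f) p"
    unfolding trig_def A_mom_def C_mom_def S_mom_def avg_def scaleR_conv_of_real distrib_left sum_distrib_left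
    by (intro arg_cong2[where f = "(+)"] sum.cong refl) (simp_all only: mult_ac)
  finally show ?thesis
    by (simp only: H_op_def)
qed

text \<open>For z < 0 the factor E - z is at least -z, so an integrable solution is bounded and
  hence square integrable.\<close>

lemma eigenspace_eq_sol:
  assumes z: "z < 0"
  shows "eigenspace n lam \<mu> z = sol n lam \<mu> z"
proof (intro set_eqI iffI)
  fix f assume f: "f \<in> eigenspace n lam \<mu> z"
  then have i: "integrable (torus n) f"
    by (auto simp: eigenspace_def intro: Lp2_imp_integrable)
  have "AE p in torus n. H_op n lam \<mu> f p = of_real z * f p"
    using f by (simp add: eigenspace_def)
  then show "f \<in> sol n lam \<mu> z"
    using i unfolding sol_def H_op_eq[OF i]
    by (auto simp: algebra_simps elim!: eventually_mono)
next
  fix f assume f: "f \<in> sol n lam \<mu> z"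
  then have i: "integrable (torus n) f" by (simp add: sol_def)
  let ?t = "trig n (of_real \<mu> * A_mom n f) (\<lambda>j. of_real lam * C_mom n j f) (\<lambda>j. of_real lam * S_mom n j f)"
  have eq: "AE p in torus n. of_real (dispersion n p - z) * f p = ?t p"
    using f by (simp add: sol_def)
  let ?K = "norm (of_real \<mu> * A_mom n f) + (\<Sum>j=1..n. norm (of_real lam * C_mom n j f) + norm (of_real lam * S_mom n j f))"
  have "f \<in> Lp n 2"
  proof (rule bounded_imp_Lp2)
    show "f \<in> borel_measurable (torus n)" using i by simp
    show "AE p in torus n. norm (f p) \<le> ?K / (- z)"
      using eq
    proof eventually_elim
      case (elim p)
      have "(- z) * norm (f p) \<le> (dispersion n p - z) * norm (f p)"
        using dispersion_nonneg[of n p] by (intro mult_right_mono) auto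
      also have "\<dots> = norm (of_real (dispersion n p - z) * f p)"
        using dispersion_nonneg[of n p] z unfolding norm_mult norm_of_real by simp
      also have "\<dots> \<le> ?K" unfolding elim by (rule norm_trig_le)
      finally show ?case using z by (simp add: field_simps)
    qed
  qed
  moreover have "AE p in torus n. H_op n lam \<mu> f p = of_real z * f p"
    using eq unfolding H_op_eq[OF i] by eventually_elim (simp add: algebra_simps)
  ultimately show "f \<in> eigenspace n lam \<mu> z" by (simp add: eigenspace_def)
qed

text \<open>The content is that integrability of f is automatic, even for \<mu> = 0. Together with
  the odd case this rules out super-threshold resonances.\<close>

lemma even_solutions_eq:
  assumes n: "n \<ge> 2"
  shows "even_solutions n lam \<mu> = even_functions n \<inter> sol n lam \<mu> 0"
proof (intro set_eqI)
  fix f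
  show "f \<in> even_solutions n lam \<mu> \<longleftrightarrow> f \<in> even_functions n \<inter> sol n lam \<mu> 0"
  proof (cases "f \<in> even_functions n")
    case True
    let ?t = "trig n (of_real \<mu> * A_mom n f) (\<lambda>j. of_real lam * C_mom n j f) (\<lambda>_. 0)"
    have t: "trig n (of_real \<mu> * A_mom n f) (\<lambda>j. of_real lam * C_mom n j f) (\<lambda>j. of_real lam * S_mom n j f) = ?t"
      using even_S_mom[OF True] by (intro trig_cong) auto
    have m: "f \<in> borel_measurable (torus n)" using True by (simp add: even_functions_def)
    have int: "integrable (torus n) f"
      if "\<mu> \<noteq> 0 \<longrightarrow> integrable (torus n) f"
        "lam \<noteq> 0 \<longrightarrow> (\<forall>j\<in>{1..n}. integrable (torus n) (\<lambda>q. of_real (cos (q j)) * f q))"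
        and eq: "AE p in torus n. of_real (dispersion n p) * f p = ?t p"
    proof -
      consider "\<mu> \<noteq> 0" | "\<mu> = 0" "lam = 0" | "lam \<noteq> 0" by blast
      then show ?thesis
      proof cases
        case 1
        then show ?thesis using that by simp
      next
        case 2
        have "1 \<le> n" using n by simp
        from AE_dispersion_pos[OF this] eq have "AE p in torus n. norm (f p) \<le> 0"
          by eventually_elim (simp add: 2 trig_def)
        then show ?thesis using m by (intro torus.integrable_const_bound)
      next
        case 3
        let ?K = "norm (of_real \<mu> * A_mom n f) + (\<Sum>j=1..n. norm (of_real lam * C_mom n j f) + norm (0::complex))"
        \<comment> \<open>f is the sum of (1 - cos p_1) f, bounded because E f is, and of cos p_1 f,
          integrable by the convergence requirement for lam \<noteq> 0.\<close>
        have "integrable (torus n) (\<lambda>p. of_real (1 - cos (p 1)) * f p)"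
        proof (rule torus.integrable_const_bound)
          show "AE p in torus n. norm (of_real (1 - cos (p 1)) * f p) \<le> ?K"
            using eq
          proof eventually_elim
            case (elim p)
            have "norm (of_real (1 - cos (p 1)) * f p) = (1 - cos (p 1)) * norm (f p)"
              unfolding norm_mult norm_of_real by simp
            also have "\<dots> \<le> dispersion n p * norm (f p)"
              using n by (intro mult_right_mono one_minus_cos_le_dispersion) auto
            also have "\<dots> = norm (of_real (dispersion n p) * f p)"
              using dispersion_nonneg[of n p] unfolding norm_mult norm_of_real by simp
            also have "\<dots> \<le> ?K" unfolding elim by (rule norm_trig_le)
            finally show ?case .
          qed
          show "(\<lambda>p. of_real (1 - cos (p 1)) * f p) \<in> borel_measurable (torus n)"
            using m n by (intro measurable_of_real_mult) auto
        qed
        moreover have "integrable (torus n) (\<lambda>q. of_real (cos (q 1)) * f q)"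
          using that 3 n by simp
        ultimately have "integrable (torus n) (\<lambda>p. of_real (1 - cos (p 1)) * f p + of_real (cos (p 1)) * f p)"
          by (rule Bochner_Integration.integrable_add)
        then show ?thesis by (simp add: algebra_simps)
      qed
    qed
    show ?thesis
      using True int integrable_cos_mult[of _ n f]
      unfolding even_solutions_def sol_def He_op_eq mem_Collect_eq Int_iff t by (auto simp del: of_real_diff)
  next
    case False
    then show ?thesis by (simp add: even_solutions_def)
  qed
qed

text \<open>E f is a combination of sines, and sin p_j / E is integrable. The value of \<mu> on the
  right is arbitrary, since an odd function has average 0.\<close>

lemma odd_solutions_eq:
  assumes n: "n \<ge> 2"
  shows "odd_solutions n lam = odd_functions n \<inter> sol n lam \<mu> 0"
proof (intro set_eqI)
  fix f
  show "f \<in> odd_solutions n lam \<longleftrightarrow> f \<in> odd_functions n \<inter> sol n lam \<mu> 0"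
  proof (cases "f \<in> odd_functions n")
    case True
    let ?t = "trig n 0 (\<lambda>_. 0) (\<lambda>j. of_real lam * S_mom n j f)"
    have t: "trig n (of_real \<mu> * A_mom n f) (\<lambda>j. of_real lam * C_mom n j f) (\<lambda>j. of_real lam * S_mom n j f) = ?t"
      unfolding odd_A_mom[OF True] mult_zero_right using odd_C_mom[OF True] by (intro trig_cong) auto
    have m: "f \<in> borel_measurable (torus n)" using True by (simp add: odd_functions_def)
    have int: "integrable (torus n) f" if eq: "AE p in torus n. of_real (dispersion n p) * f p = ?t p"
    proof -
      have "AE p in torus n. of_real (dispersion n p - 0) * f p =
          0 * of_real 0 + (\<Sum>j=1..n. 0 * of_real (sin (p j)) + (of_real lam * S_mom n j f) * of_real (sin (p j)))"
        using eq by (simp add: trig_def)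
      from avg_of_weights(1)[OF m _ order_refl _ _ _ this] show ?thesis
        using n by (simp add: kint_sin)
    qed
    show ?thesis
      using True int integrable_sin_mult[of _ n f]
      unfolding odd_solutions_def sol_def Ho_op_eq mem_Collect_eq Int_iff t by (auto simp del: of_real_diff)
  next
    case False
    then show ?thesis by (simp add: odd_solutions_def)
  qed
qed

subsection \<open>Structure of the solution spaces\<close>

lemma sol_eq:
  assumes "f \<in> sol n lam \<mu> z"
  shows "AE p in torus n. of_real (dispersion n p - z) * f p =
        trig n (of_real \<mu> * A_mom n f) (\<lambda>j. of_real lam * C_mom n j f) (\<lambda>j. of_real lam * S_mom n j f) p"
    and "integrable (torus n) f" and "f \<in> borel_measurable (torus n)"
  using assms by (auto simp: sol_def)

text \<open>Splitting off the singular part \<open>\<kappa> / E\<close> of a solution at the threshold.\<close>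

lemma threshold_split:
  fixes f :: "_ \<Rightarrow> complex"
  assumes n: "n \<ge> 2" and eq: "AE p in torus n. of_real (dispersion n p - 0) * f p = trig n \<alpha> \<beta> \<gamma> p"
  defines "\<kappa> \<equiv> \<alpha> + (\<Sum>j=1..n. \<beta> j)"
    and "R \<equiv> \<lambda>p. (\<Sum>j=1..n. - \<beta> j * of_real (1 - cos (p j)) + \<gamma> j * of_real (sin (p j))) / of_real (dispersion n p)"
  shows "AE p in torus n. f p - R p = \<kappa> / of_real (dispersion n p)"
    and "R \<in> borel_measurable (torus n)"
    and "integrable (torus n) R"
    and "(\<And>j. j \<in> {1..n} \<Longrightarrow> \<gamma> j = 0) \<Longrightarrow> AE p in torus n. norm (R p) \<le> (\<Sum>j=1..n. norm (\<beta> j))"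
proof -
  have pos: "AE p in torus n. 0 < dispersion n p"
    using n by (intro AE_dispersion_pos) simp
  have t: "trig n \<alpha> \<beta> \<gamma> p = \<kappa> + (\<Sum>j=1..n. - \<beta> j * of_real (1 - cos (p j)) + \<gamma> j * of_real (sin (p j)))" for p
    by (simp add: trig_def \<kappa>_def algebra_simps sum.distrib sum_subtractf sum_negf)
  show "AE p in torus n. f p - R p = \<kappa> / of_real (dispersion n p)"
    using eq pos
  proof eventually_elim
    case (elim p)
    then have "f p = trig n \<alpha> \<beta> \<gamma> p / of_real (dispersion n p)" by (simp add: field_simps)
    then show ?case unfolding t R_def by (simp add: add_divide_distrib)
  qed
  show m: "R \<in> borel_measurable (torus n)"
    unfolding R_def
    by (intro borel_measurable_divide borel_measurable_sum borel_measurable_add borel_measurable_times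
        borel_measurable_const measurable_compose[OF _ borel_measurable_of_real] borel_measurable_diff) auto
  have "AE p in torus n. of_real (dispersion n p - 0) * R p =
      0 * of_real 0 + (\<Sum>j=1..n. - \<beta> j * of_real (1 - cos (p j)) + \<gamma> j * of_real (sin (p j)))"
    using pos by eventually_elim (simp add: R_def)
  from avg_of_weights(1)[OF m _ order_refl _ _ _ this] show "integrable (torus n) R"
    using n by (simp add: mom_one_minus_cos(1) kint_sin)
  show "AE p in torus n. norm (R p) \<le> (\<Sum>j=1..n. norm (\<beta> j))" if g: "\<And>j. j \<in> {1..n} \<Longrightarrow> \<gamma> j = 0"
    using pos
  proof eventually_elim
    case (elim p)
    have "norm (\<Sum>j=1..n. - \<beta> j * of_real (1 - cos (p j)) + \<gamma> j * of_real (sin (p j))) \<le>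
        (\<Sum>j=1..n. norm (\<beta> j) * dispersion n p)"
    proof (rule sum_norm_le)
      fix j assume j: "j \<in> {1..n}"
      have "norm (- \<beta> j * of_real (1 - cos (p j)) + \<gamma> j * of_real (sin (p j))) = norm (\<beta> j) * (1 - cos (p j))"
        unfolding g[OF j] mult_zero_left add_0_right norm_mult norm_of_real by simp
      also have "\<dots> \<le> norm (\<beta> j) * dispersion n p"
        by (intro mult_left_mono one_minus_cos_le_dispersion j) simp
      finally show "norm (- \<beta> j * of_real (1 - cos (p j)) + \<gamma> j * of_real (sin (p j))) \<le> norm (\<beta> j) * dispersion n p" .
    qed
    then show ?case using elim by (simp add: R_def norm_divide divide_le_eq sum_distrib_right)
  qed
qed

lemma const_mult_integrable_imp_0:
  assumes "integrable (torus n) (\<lambda>p. norm \<kappa> * g p)" "\<not> integrable (torus n) g"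
  shows "\<kappa> = (0::complex)"
proof (rule ccontr)
  assume "\<kappa> \<noteq> 0"
  have "integrable (torus n) (\<lambda>p. (1 / norm \<kappa>) * (norm \<kappa> * g p))"
    using assms(1) by (rule integrable_mult_right)
  then show False using assms(2) \<open>\<kappa> \<noteq> 0\<close> by simp
qed

text \<open>The remainder in the splitting is integrable but 1/E is not, so the coefficient of 1/E
  must vanish.\<close>

lemma threshold_integrable_dim2:
  fixes f :: "_ \<Rightarrow> complex"
  assumes f: "integrable (torus 2) f"
    and eq: "AE p in torus 2. of_real (dispersion 2 p - 0) * f p = trig 2 \<alpha> \<beta> \<gamma> p"
  shows "\<alpha> + (\<Sum>j=1..2. \<beta> j) = 0"
proof -
  note * = threshold_split[OF order_refl eq]
  let ?\<kappa> = "\<alpha> + (\<Sum>j=1..2. \<beta> j)"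
  have "integrable (torus 2) (\<lambda>p. norm ?\<kappa> * (1 / dispersion 2 p ^ 1))"
  proof (rule Bochner_Integration.integrable_bound[OF Bochner_Integration.integrable_diff[OF f *(3)]])
    show "AE p in torus 2. norm (norm ?\<kappa> * (1 / dispersion 2 p ^ 1)) \<le>
        norm (f p - (\<Sum>j=1..2. - \<beta> j * of_real (1 - cos (p j)) + \<gamma> j * of_real (sin (p j))) / of_real (dispersion 2 p))"
      using *(1) by eventually_elim (simp add: norm_divide dispersion_nonneg)
  qed measurable
  then show ?thesis
    by (rule const_mult_integrable_imp_0) (rule not_integrable_inverse_dispersion, auto)
qed

text \<open>With no sine terms the remainder is bounded, hence square integrable, while 1/E^2 is not
  integrable up to dimension four.\<close>

lemma threshold_Lp2_dim34:
  fixes f :: "_ \<Rightarrow> complex"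
  assumes n: "n \<ge> 2" "n \<le> 4" and f: "f \<in> Lp n 2"
    and eq: "AE p in torus n. of_real (dispersion n p - 0) * f p = trig n \<alpha> \<beta> \<gamma> p"
    and \<gamma>: "\<And>j. j \<in> {1..n} \<Longrightarrow> \<gamma> j = 0"
  shows "\<alpha> + (\<Sum>j=1..n. \<beta> j) = 0"
proof -
  note * = threshold_split[OF n(1) eq]
  let ?\<kappa> = "\<alpha> + (\<Sum>j=1..n. \<beta> j)"
  let ?R = "\<lambda>p. (\<Sum>j=1..n. - \<beta> j * of_real (1 - cos (p j)) + \<gamma> j * of_real (sin (p j))) / of_real (dispersion n p)"
  have R: "?R \<in> Lp n 2" by (rule bounded_imp_Lp2[OF *(2) *(4)[OF \<gamma>]])
  have "(\<lambda>p. f p + (-1) * ?R p) \<in> Lp n 2"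
    by (rule fun_subspace_add[OF fun_subspace_Lp2 f fun_subspace_cmult[OF fun_subspace_Lp2 R]])
  then have i: "integrable (torus n) (\<lambda>p. (norm (f p + (-1) * ?R p))\<^sup>2)"
    by (simp only: Lp2_iff)
  have "integrable (torus n) (\<lambda>p. norm (?\<kappa>\<^sup>2) * (1 / dispersion n p ^ 2))"
  proof (rule Bochner_Integration.integrable_bound[OF i])
    show "AE p in torus n. norm (norm (?\<kappa>\<^sup>2) * (1 / dispersion n p ^ 2)) \<le> norm ((norm (f p + (-1) * ?R p))\<^sup>2)"
      using *(1) by eventually_elim (simp add: norm_divide norm_power power_divide)
  qed measurable
  then have "?\<kappa>\<^sup>2 = 0"
    by (rule const_mult_integrable_imp_0) (rule not_integrable_inverse_dispersion, use n in auto)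
  then show ?thesis by simp
qed

text \<open>The moment system, sector by sector. The last two facts stand in for the determinant at
  the threshold: a numerator vanishing at the origin forces A = 0, and for n = 2 integrability makes
  it vanish.\<close>

lemma sol_relations:
  assumes f: "f \<in> sol n lam \<mu> z" and n: "n \<ge> 2" and z: "z \<le> 0"
  shows "j \<in> {1..n} \<Longrightarrow> lam * s_int n z \<noteq> 1 \<Longrightarrow> S_mom n j f = 0"
    and "i \<in> {1..n} \<Longrightarrow> j \<in> {1..n} \<Longrightarrow> lam * c_int n z \<noteq> 1 \<Longrightarrow> C_mom n j f = C_mom n i f"
    and "(\<Sum>j=1..n. C_mom n j f) = of_real (n - z - \<mu>) * A_mom n f"
    and "z < 0 \<or> n \<ge> 3 \<Longrightarrow> sym_det n lam \<mu> z \<noteq> 0 \<Longrightarrow> A_mom n f = 0"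
    and "z = 0 \<Longrightarrow> of_real \<mu> * A_mom n f + (\<Sum>j=1..n. of_real lam * C_mom n j f) = 0 \<Longrightarrow> A_mom n f = 0"
    and "z = 0 \<Longrightarrow> n = 2 \<Longrightarrow> A_mom n f = 0"
proof -
  note eq = sol_eq(1)[OF f] and i = sol_eq(2)[OF f] and m = sol_eq(3)[OF f]
  show "S_mom n j f = 0" if "j \<in> {1..n}" "lam * s_int n z \<noteq> 1"
  proof -
    have "S_mom n j f * of_real (1 - lam * s_int n z) = 0"
      using S_mom_trig[OF n z m eq that(1)] by (simp add: algebra_simps)
    then show ?thesis using that(2) by (auto simp del: of_real_diff of_real_mult)
  qed
  show "C_mom n j f = C_mom n i f" if "i \<in> {1..n}" "j \<in> {1..n}" "lam * c_int n z \<noteq> 1"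
  proof -
    have "(C_mom n j f - C_mom n i f) * of_real (1 - lam * c_int n z) = 0"
      using C_mom_diff_trig[OF n z i eq that(1,2)] by (simp add: algebra_simps)
    then show ?thesis using that(3) by (auto simp del: of_real_diff of_real_mult)
  qed
  show sumC: "(\<Sum>j=1..n. C_mom n j f) = of_real (n - z - \<mu>) * A_mom n f"
    using sum_C_mom_trig[OF n z i eq] by (simp add: algebra_simps)
  show "A_mom n f = 0" if "z < 0 \<or> n \<ge> 3" "sym_det n lam \<mu> z \<noteq> 0"
  proof -
    have s: "(\<Sum>j=1..n. of_real lam * C_mom n j f) = of_real lam * (of_real (n - z - \<mu>) * A_mom n f)"
      unfolding sumC[symmetric] by (rule sum_distrib_left[symmetric])
    have "A_mom n f = of_real \<mu> * A_mom n f * of_real (a_int n z) +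
        of_real lam * (of_real (n - z - \<mu>) * A_mom n f) * of_real (b_int n z)"
      by (rule A_mom_trig[OF n z m eq that(1), unfolded s])
    then have "A_mom n f * of_real (sym_det n lam \<mu> z) = 0"
      by (simp add: sym_det_def algebra_simps)
    then show ?thesis using that(2) by simp
  qed
  show *: "A_mom n f = 0" if "z = 0" "of_real \<mu> * A_mom n f + (\<Sum>j=1..n. of_real lam * C_mom n j f) = 0"
  proof -
    note A_mom_trig_threshold[OF n m eq[unfolded that(1)] that(2)]
    also have "- (\<Sum>j=1..n. of_real lam * C_mom n j f) = of_real \<mu> * A_mom n f"
      using that(2) by (simp add: add_eq_0_iff)
    \<comment> \<open>The threshold formula gives n A = \<mu> A, while the averaged equation gives
      \<Sum> C_j = (n - \<mu>) A. So the C_j sum to 0, and the threshold formula then yields A =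
      0.\<close>
    finally have *: "of_real (n - \<mu>) * A_mom n f = 0"
      using n by (simp add: field_simps)
    then have "(\<Sum>j=1..n. C_mom n j f) = 0" unfolding sumC by (simp add: that(1))
    then have 0: "(\<Sum>j=1..n. of_real lam * C_mom n j f) = 0"
      by (simp add: sum_distrib_left[symmetric])
    show ?thesis
      using A_mom_trig_threshold[OF n m eq[unfolded that(1)] that(2)] unfolding 0 by simp
  qed
  show "A_mom n f = 0" if "z = 0" "n = 2"
  proof -
    have i2: "integrable (torus 2) f" using i unfolding that(2) .
    note threshold_integrable_dim2[OF i2 eq[unfolded that]]
    then show ?thesis by (intro *[OF that(1)]) (simp add: that(2))
  qed
qed

text \<open>Numerators of the explicit solutions. For i = 0 the scale is such that every cosine
  moment equals b; the numerator is then 1 - lam b (n - z) + lam b (n - E), whose constant part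
  equals \<mu> A when the determinant vanishes. Even indices start at 2 because cos p_1 is the
  reference term.\<close>

definition bas :: "nat \<Rightarrow> real \<Rightarrow> real \<Rightarrow> nat \<Rightarrow> (nat \<Rightarrow> real) \<Rightarrow> real" where
  "bas n lam z i p = (if i = 0 then 1 - lam * b_int n z * (dispersion n p - z)
     else if i \<le> n then cos (p i) - cos (p 1) else sin (p (i - n)))"

definition bas_sol :: "nat \<Rightarrow> real \<Rightarrow> real \<Rightarrow> nat \<Rightarrow> (nat \<Rightarrow> real) \<Rightarrow> complex" where
  "bas_sol n lam z i p = of_real (bas n lam z i p / (dispersion n p - z))"

text \<open>Functionals dual to \<open>bas_sol\<close>. Subtracting the mean of the cosine moments
  makes the indices 2..n blind to the symmetric solution, whose cosine moments all agree.\<close>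

definition coord :: "nat \<Rightarrow> nat \<Rightarrow> ((nat \<Rightarrow> real) \<Rightarrow> complex) \<Rightarrow> complex" where
  "coord n i f = (if i = 0 then A_mom n f
     else if i \<le> n then C_mom n i f - (\<Sum>k=1..n. C_mom n k f) / n else S_mom n (i - n) f)"

text \<open>Index \<open>0\<close> stands for the permutation-symmetric even solution, \<open>2..n\<close> for the even solutions with
  vanishing sum of cosine moments, \<open>n+1..2n\<close> for the odd ones.\<close>

definition even_ix :: "nat \<Rightarrow> real \<Rightarrow> real \<Rightarrow> real \<Rightarrow> nat set" where
  "even_ix n lam \<mu> z = (if (z < 0 \<or> n \<ge> 3) \<and> sym_det n lam \<mu> z = 0 then {0} else {}) \<union>
     (if lam * c_int n z = 1 then {2..n} else {})"

definition odd_ix :: "nat \<Rightarrow> real \<Rightarrow> real \<Rightarrow> nat set" where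
  "odd_ix n lam z = (if lam * s_int n z = 1 then {n + 1..2 * n} else {})"

lemma coord_functional:
  assumes V: "\<And>f. f \<in> V \<Longrightarrow> integrable (torus n) f" and i: "i \<in> {0} \<union> {2..n} \<union> {n + 1..2 * n}"
  shows "functional_on V (coord n i)"
  unfolding functional_on_def
proof (intro conjI ballI allI)
  show "coord n i (\<lambda>_. 0) = 0" by (simp add: coord_def mom_zero_complex)
  have in_range: "i \<le> n \<Longrightarrow> i \<noteq> 0 \<Longrightarrow> i \<in> {1..n}" "\<not> i \<le> n \<Longrightarrow> i - n \<in> {1..n}"
    using i by auto
  fix f assume f: "f \<in> V"
  show "coord n i (\<lambda>p. f p + g p) = coord n i f + coord n i g" if g: "g \<in> V" for g
  proof -
    note mom_add_complex[OF V[OF f] V[OF g]]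
    moreover from this have "(\<Sum>k=1..n. C_mom n k (\<lambda>p. f p + g p)) = (\<Sum>k=1..n. C_mom n k f) + (\<Sum>k=1..n. C_mom n k g)"
      by (simp add: sum.distrib[symmetric])
    ultimately show ?thesis
      using in_range by (simp add: coord_def add_divide_distrib)
  qed
  show "coord n i (\<lambda>p. c * f p) = c * coord n i f" for c
    by (simp add: coord_def mom_cmult_complex sum_distrib_left[symmetric] algebra_simps)
qed

lemma coord_null:
  assumes "f \<in> null_functions n" and i: "i \<in> {0} \<union> {2..n} \<union> {n + 1..2 * n}"
  shows "coord n i f = 0"
proof -
  have "i \<le> n \<Longrightarrow> i \<noteq> 0 \<Longrightarrow> i \<in> {1..n}" "\<not> i \<le> n \<Longrightarrow> i - n \<in> {1..n}"
    using i by auto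
  then show ?thesis by (simp add: coord_def mom_null[OF assms(1)])
qed

lemma sol_coord_inactive:
  assumes f: "f \<in> sol n lam \<mu> z" and n: "n \<ge> 2" and z: "z \<le> 0"
    and i: "i \<in> {0} \<union> {2..n} \<union> {n + 1..2 * n}" "i \<notin> even_ix n lam \<mu> z \<union> odd_ix n lam z"
  shows "coord n i f = 0"
proof -
  note r = sol_relations[OF f n z]
  consider "i = 0" | "i \<in> {2..n}" | "i \<in> {n + 1..2 * n}" using i(1) by blast
  then show ?thesis
  proof cases
    case 1
    then have "\<not> ((z < 0 \<or> n \<ge> 3) \<and> sym_det n lam \<mu> z = 0)" using i(2) by (auto simp: even_ix_def)
    then have "A_mom n f = 0" using r(4,6) z n by fastforce
    then show ?thesis using 1 by (simp add: coord_def)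
  next
    case 2
    then have "lam * c_int n z \<noteq> 1" using i(2) by (auto simp: even_ix_def)
    then have "C_mom n k f = C_mom n i f" if "k \<in> {1..n}" for k
      using r(2)[of i k] that 2 by auto
    then have "(\<Sum>k=1..n. C_mom n k f) = of_nat n * C_mom n i f" by simp
    then show ?thesis using 2 by (simp add: coord_def)
  next
    case 3
    then have "lam * s_int n z \<noteq> 1" using i(2) by (auto simp: odd_ix_def)
    moreover have "i - n \<in> {1..n}" using 3 by auto
    ultimately have "S_mom n (i - n) f = 0" using r(1)[of "i - n"] by blast
    then show ?thesis using 3 by (simp add: coord_def)
  qed
qed

text \<open>The coordinates determine all moments of a solution: A fixes the sum of the C_j, the
  deviations from the mean give C_2, ..., C_n, and C_1 follows from the sum. With all moments 0 the
  equation reads (E - z) f = 0.\<close>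

lemma sol_coord_zero:
  assumes f: "f \<in> sol n lam \<mu> z" and n: "n \<ge> 2" and z: "z \<le> 0"
    and 0: "\<And>i. i \<in> {0} \<union> {2..n} \<union> {n + 1..2 * n} \<Longrightarrow> coord n i f = 0"
  shows "f \<in> null_functions n"
proof -
  have A: "A_mom n f = 0" using 0[of 0] by (simp add: coord_def)
  have sC: "(\<Sum>k=1..n. C_mom n k f) = 0" using sol_relations(3)[OF f n z] A by simp
  have C2: "C_mom n k f = 0" if "k \<in> {2..n}" for k using 0[of k] that sC by (simp add: coord_def)
  have "(\<Sum>k=1..n. C_mom n k f) = C_mom n 1 f + (\<Sum>k=2..n. C_mom n k f)"
    using n by (subst sum.atLeast_Suc_atMost) (auto simp: numeral_2_eq_2)
  then have "C_mom n 1 f = 0" using sC C2 by simp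
  then have C: "C_mom n k f = 0" if "k \<in> {1..n}" for k
    using C2[of k] that by (cases "k = 1") auto
  have S: "S_mom n k f = 0" if "k \<in> {1..n}" for k using 0[of "n + k"] that by (auto simp: coord_def)
  have n1: "1 \<le> n" using n by simp
  have "AE p in torus n. f p = 0"
    using sol_eq(1)[OF f] AE_dispersion_pos[OF n1]
  proof eventually_elim
    case (elim p)
    have "trig n (of_real \<mu> * A_mom n f) (\<lambda>j. of_real lam * C_mom n j f) (\<lambda>j. of_real lam * S_mom n j f) p = 0"
      using A C S by (simp add: trig_def)
    then have "of_real (dispersion n p - z) * f p = 0" using elim(1) by simp
    moreover have "dispersion n p - z \<noteq> 0" using elim(2) z by simp
    ultimately show ?case by (simp del: of_real_diff)
  qed
  then show ?thesis using sol_eq(3)[OF f] by (simp add: null_functions_def)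
qed

lemma bas_measurable: "i \<in> {0} \<union> {2..n} \<union> {n + 1..2 * n} \<Longrightarrow> bas n lam z i \<in> borel_measurable (torus n)"
proof -
  assume i: "i \<in> {0} \<union> {2..n} \<union> {n + 1..2 * n}"
  consider "i = 0" | "i \<in> {2..n}" | "i \<in> {n + 1..2 * n}" using i by blast
  then show ?thesis
  proof cases
    case 1
    then show ?thesis by (simp add: bas_def[abs_def])
  next
    case 2
    then show ?thesis by (simp add: bas_def[abs_def])
  next
    case 3
    then have "i - n \<in> {1..n}" by auto
    with 3 show ?thesis by (simp add: bas_def[abs_def])
  qed
qed

lemma bas_sol_moments:
  assumes k: "kint n z (bas n lam z i)" and z: "z \<le> 0"
  shows "integrable (torus n) (bas_sol n lam z i)"
    and "A_mom n (bas_sol n lam z i) = of_real (mom n z (bas n lam z i))"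
    and "C_mom n j (bas_sol n lam z i) = of_real (mom n z (\<lambda>p. bas n lam z i p * cos (p j)))"
    and "S_mom n j (bas_sol n lam z i) = of_real (mom n z (\<lambda>p. bas n lam z i p * sin (p j)))"
proof -
  show "integrable (torus n) (bas_sol n lam z i)"
    unfolding bas_sol_def[abs_def] by (rule integrable_of_real[OF kint_int[OF k]])
  show "A_mom n (bas_sol n lam z i) = of_real (mom n z (bas n lam z i))"
    by (simp add: A_mom_def bas_sol_def[abs_def] mom_def del: of_real_divide of_real_diff)
  show "C_mom n j (bas_sol n lam z i) = of_real (mom n z (\<lambda>p. bas n lam z i p * cos (p j)))"
    unfolding C_mom_def bas_sol_def[abs_def] mom_def of_real_mult[symmetric] avg_of_real
    by (simp add: mult.commute)
  show "S_mom n j (bas_sol n lam z i) = of_real (mom n z (\<lambda>p. bas n lam z i p * sin (p j)))"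
    unfolding S_mom_def bas_sol_def[abs_def] mom_def of_real_mult[symmetric] avg_of_real
    by (simp add: mult.commute)
qed

lemma bas_solI:
  assumes k: "kint n z (bas n lam z i)" and z: "z \<le> 0" and n: "n \<ge> 2"
    and eq: "\<And>p. bas n lam z i p = \<mu> * mom n z (bas n lam z i) + (\<Sum>j=1..n.
      lam * mom n z (\<lambda>p. bas n lam z i p * cos (p j)) * cos (p j) +
      lam * mom n z (\<lambda>p. bas n lam z i p * sin (p j)) * sin (p j))"
  shows "bas_sol n lam z i \<in> sol n lam \<mu> z"
  unfolding sol_def bas_sol_moments[OF k z] mem_Collect_eq
proof
  show "integrable (torus n) (bas_sol n lam z i)" by (rule bas_sol_moments(1)[OF k z])
  have n1: "1 \<le> n" using n by simp
  show "AE p in torus n. of_real (dispersion n p - z) * bas_sol n lam z i p =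
      trig n (of_real \<mu> * of_real (mom n z (bas n lam z i)))
        (\<lambda>j. of_real lam * of_real (mom n z (\<lambda>p. bas n lam z i p * cos (p j))))
        (\<lambda>j. of_real lam * of_real (mom n z (\<lambda>p. bas n lam z i p * sin (p j)))) p"
    using AE_dispersion_pos[OF n1]
  proof eventually_elim
    case (elim p)
    have "of_real (dispersion n p - z) * bas_sol n lam z i p = of_real (bas n lam z i p)"
      unfolding bas_sol_def of_real_mult[symmetric] using elim z by (simp del: of_real_diff)
    also have "\<dots> = trig n (of_real \<mu> * of_real (mom n z (bas n lam z i)))
        (\<lambda>j. of_real lam * of_real (mom n z (\<lambda>p. bas n lam z i p * cos (p j))))
        (\<lambda>j. of_real lam * of_real (mom n z (\<lambda>p. bas n lam z i p * sin (p j)))) p"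
      by (subst eq) (simp add: trig_def)
    finally show ?case .
  qed
qed

text \<open>The term with E - z cancels the kernel and leaves plain averages, which vanish against
  sines and cosines.\<close>

lemma bas_zero_moments:
  assumes z: "z \<le> 0" "z < 0 \<or> n \<ge> 3" and n: "n \<ge> 2"
  shows "kint n z (bas n lam z 0)"
    and "mom n z (bas n lam z 0) = a_int n z - lam * b_int n z"
    and "j \<in> {1..n} \<Longrightarrow> mom n z (\<lambda>p. bas n lam z 0 p * cos (p j)) = b_int n z"
    and "j \<in> {1..n} \<Longrightarrow> mom n z (\<lambda>p. bas n lam z 0 p * sin (p j)) = 0"
proof -
  have n1: "n \<ge> 1" using n by simp
  have k1: "kint n z (\<lambda>_. 1)" by (rule kint_one[OF z n1])
  have kE: "kint n z (\<lambda>p. dispersion n p - z)"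
  proof (rule kint_bound[OF k1])
    show "\<bar>dispersion n p - z\<bar> \<le> (2 * n - z) * \<bar>1\<bar>" for p
      using dispersion_nonneg[of n p] dispersion_le[of n p] z by simp
  qed measurable
  have b: "bas n lam z 0 = (\<lambda>p. 1 - lam * b_int n z * (dispersion n p - z))"
    by (simp add: bas_def[abs_def])
  show "kint n z (bas n lam z 0)"
    unfolding b by (intro kint_diff k1 kint_cmult kE)
  have mE: "mom n z (\<lambda>p. (dispersion n p - z) * h p) = avg n h" if h: "h \<in> borel_measurable (torus n)" for h
    unfolding mom_def
  proof (rule avg_cong_AE[OF _ _ h])
    show "AE p in torus n. (dispersion n p - z) * h p / (dispersion n p - z) = h p"
      using AE_dispersion_pos[OF n1] by eventually_elim (use z in simp)
  qed (use h in measurable)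
  have main: "mom n z (\<lambda>p. bas n lam z 0 p * h p) = mom n z h - lam * b_int n z * avg n h"
    if h: "h \<in> borel_measurable (torus n)" "\<And>p. \<bar>h p\<bar> \<le> 1" for h
  proof -
    have "mom n z (\<lambda>p. bas n lam z 0 p * h p) =
        mom n z (\<lambda>p. 1 * h p - lam * b_int n z * ((dispersion n p - z) * h p))"
      by (simp add: b algebra_simps)
    also have "\<dots> = mom n z (\<lambda>p. 1 * h p) - mom n z (\<lambda>p. lam * b_int n z * ((dispersion n p - z) * h p))"
      using h by (intro mom_diff kint_cmult kint_mult[OF k1] kint_mult[OF kE])
    also have "\<dots> = mom n z h - lam * b_int n z * avg n h"
      by (simp only: mom_cmult mE[OF h(1)] mult_1)
    finally show ?thesis .
  qed
  show "mom n z (bas n lam z 0) = a_int n z - lam * b_int n z"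
    using main[of "\<lambda>_. 1"] by (simp add: a_int_mom)
  show "mom n z (\<lambda>p. bas n lam z 0 p * cos (p j)) = b_int n z" if "j \<in> {1..n}"
    using main[of "\<lambda>p. cos (p j)"] that by (simp add: mom_cos avg_cos)
  show "mom n z (\<lambda>p. bas n lam z 0 p * sin (p j)) = 0" if "j \<in> {1..n}"
    using main[of "\<lambda>p. sin (p j)"] that by (simp add: mom_sin avg_sin)
qed

lemma bas_even_moments:
  assumes i: "i \<in> {2..n}" and z: "z \<le> 0"
  shows "kint n z (bas n lam z i)"
    and "mom n z (bas n lam z i) = 0"
    and "j \<in> {1..n} \<Longrightarrow> mom n z (\<lambda>p. bas n lam z i p * cos (p j)) = c_int n z * ((if j = i then 1 else 0) - (if j = 1 then 1 else 0))"
    and "j \<in> {1..n} \<Longrightarrow> mom n z (\<lambda>p. bas n lam z i p * sin (p j)) = 0"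
proof -
  have b: "bas n lam z i = (\<lambda>p. cos (p i) - cos (p 1))"
    using i by (simp add: bas_def[abs_def])
  have ii: "1 \<in> {1..n}" "i \<in> {1..n}" "1 \<noteq> i" using i by auto
  show "kint n z (bas n lam z i)" unfolding b by (rule kint_cos_diff[OF ii(1,2) z])
  show "mom n z (bas n lam z i) = 0" unfolding b by (rule mom_cos_diff[OF ii(1,2)])
  show "mom n z (\<lambda>p. bas n lam z i p * cos (p j)) = c_int n z * ((if j = i then 1 else 0) - (if j = 1 then 1 else 0))"
    if "j \<in> {1..n}" unfolding b by (rule mom_cos_diff_cos[OF ii that z])
  show "mom n z (\<lambda>p. bas n lam z i p * sin (p j)) = 0" if "j \<in> {1..n}"
    unfolding b by (rule mom_cos_diff_sin[OF ii(1,2) that])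
qed

lemma bas_odd_moments:
  assumes i: "i \<in> {n + 1..2 * n}" and z: "z \<le> 0" and n: "n \<ge> 2"
  shows "kint n z (bas n lam z i)"
    and "mom n z (bas n lam z i) = 0"
    and "j \<in> {1..n} \<Longrightarrow> mom n z (\<lambda>p. bas n lam z i p * cos (p j)) = 0"
    and "j \<in> {1..n} \<Longrightarrow> mom n z (\<lambda>p. bas n lam z i p * sin (p j)) = (if i = n + j then s_int n z else 0)"
proof -
  have b: "bas n lam z i = (\<lambda>p. sin (p (i - n)))"
    using i by (auto simp add: bas_def[abs_def])
  have ii: "i - n \<in> {1..n}" using i by auto
  show "kint n z (bas n lam z i)" unfolding b by (rule kint_sin[OF ii n z])
  show "mom n z (bas n lam z i) = 0" unfolding b by (rule mom_sin[OF ii])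
  show "mom n z (\<lambda>p. bas n lam z i p * cos (p j)) = 0" if "j \<in> {1..n}"
    unfolding b by (rule mom_sin_cos[OF ii that])
  show "mom n z (\<lambda>p. bas n lam z i p * sin (p j)) = (if i = n + j then s_int n z else 0)" if "j \<in> {1..n}"
    unfolding b mom_sin_sin[OF ii that] using i by auto
qed

lemma bas_sol_in_sol:
  assumes i: "i \<in> even_ix n lam \<mu> z \<union> odd_ix n lam z" and z: "z \<le> 0" and n: "n \<ge> 2"
  shows "bas_sol n lam z i \<in> sol n lam \<mu> z"
proof -
  consider "i = 0" "z < 0 \<or> n \<ge> 3" "sym_det n lam \<mu> z = 0"
    | "i \<in> {2..n}" "lam * c_int n z = 1" | "i \<in> {n + 1..2 * n}" "lam * s_int n z = 1"
    using i by (auto simp: even_ix_def odd_ix_def split: if_splits)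
  then show ?thesis
  proof cases
    case 1
    note m = bas_zero_moments[OF z 1(2) n] and det = 1(3)
    show ?thesis
      unfolding 1(1)
    proof (rule bas_solI[OF m(1) z n], goal_cases)
      case (1 p)
      have "(\<Sum>j=1..n. lam * mom n z (\<lambda>p. bas n lam z 0 p * cos (p j)) * cos (p j) +
          lam * mom n z (\<lambda>p. bas n lam z 0 p * sin (p j)) * sin (p j)) =
          (\<Sum>j=1..n. lam * b_int n z * cos (p j))"
        by (intro sum.cong refl) (simp add: m)
      also have "\<dots> = lam * b_int n z * (n - dispersion n p)"
        by (simp only: sum_distrib_left[symmetric] sum_cos_eq)
      finally show ?case
        using det by (simp add: m(2) bas_def sym_det_def algebra_simps)
    qed
  next
    case 2
    note m = bas_even_moments[OF 2(1) z]
    show ?thesis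
    proof (rule bas_solI[OF m(1) z n], goal_cases)
      case (1 p)
      have "(\<Sum>j=1..n. lam * mom n z (\<lambda>p. bas n lam z i p * cos (p j)) * cos (p j) +
          lam * mom n z (\<lambda>p. bas n lam z i p * sin (p j)) * sin (p j)) =
          (\<Sum>j=1..n. (if j = i then cos (p i) else 0) - (if j = 1 then cos (p 1) else 0))"
        using 2(2) by (intro sum.cong refl) (auto simp: m mult.assoc[symmetric])
      also have "\<dots> = cos (p i) - cos (p 1)"
        using 2(1) by (subst sum_subtractf) auto
      finally show ?case
        using 2(1) by (simp add: m(2)) (simp add: bas_def)
    qed
  next
    case 3
    note m = bas_odd_moments[OF 3(1) z n]
    show ?thesis
    proof (rule bas_solI[OF m(1) z n], goal_cases)
      case (1 p)
      have "(\<Sum>j=1..n. lam * mom n z (\<lambda>p. bas n lam z i p * cos (p j)) * cos (p j) +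
          lam * mom n z (\<lambda>p. bas n lam z i p * sin (p j)) * sin (p j)) =
          (\<Sum>j=1..n. if j = i - n then sin (p (i - n)) else 0)"
        using 3 by (intro sum.cong refl) (auto simp: m)
      also have "\<dots> = sin (p (i - n))"
        using 3(1) by (subst sum.delta) auto
      finally show ?case
        using 3(1) by (simp add: m(2)) (auto simp add: bas_def)
    qed
  qed
qed

lemma coord_bas_sol:
  assumes i: "i \<in> even_ix n lam \<mu> z \<union> odd_ix n lam z" and j: "j \<in> {0} \<union> {2..n} \<union> {n + 1..2 * n}"
    and z: "z \<le> 0" and n: "n \<ge> 2"
  shows "i \<noteq> j \<Longrightarrow> coord n j (bas_sol n lam z i) = 0" and "coord n i (bas_sol n lam z i) \<noteq> 0"
proof -
  consider "i = 0" "z < 0 \<or> n \<ge> 3" "sym_det n lam \<mu> z = 0"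
    | "i \<in> {2..n}" "lam * c_int n z = 1" | "i \<in> {n + 1..2 * n}" "lam * s_int n z = 1"
    using i by (auto simp: even_ix_def odd_ix_def split: if_splits)
  note c = this
  have jr: "j \<noteq> 0 \<Longrightarrow> j \<le> n \<Longrightarrow> j \<in> {1..n}" "\<not> j \<le> n \<Longrightarrow> j - n \<in> {1..n}" using j by auto
  have "(i \<noteq> j \<longrightarrow> coord n j (bas_sol n lam z i) = 0) \<and> coord n i (bas_sol n lam z i) \<noteq> 0"
    using c
  proof cases
    case 1
    note m = bas_zero_moments[OF z 1(2) n]
    note M = bas_sol_moments[OF m(1) z]
    have C: "C_mom n k (bas_sol n lam z 0) = of_real (b_int n z)" if "k \<in> {1..n}" for k
      using M(3) m(3)[OF that] by simp
    \<comment> \<open>If a = lam b, the vanishing determinant reduces to (n - z) a = 1, that is, b =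
      0.\<close>
    have "a_int n z - lam * b_int n z \<noteq> 0"
    proof
      assume "a_int n z - lam * b_int n z = 0"
      then have a: "a_int n z = lam * b_int n z" by simp
      have "(n - z) * a_int n z = 1"
        using 1(3) unfolding sym_det_def a by (simp add: algebra_simps)
      then show False using b_int_eq[OF z 1(2)] b_int_pos[OF z 1(2) n] n by simp
    qed
    then have "coord n 0 (bas_sol n lam z 0) \<noteq> 0"
      by (simp add: coord_def M(2) m(2) flip: of_real_mult of_real_diff)
    moreover have "coord n j (bas_sol n lam z 0) = 0" if "j \<noteq> 0"
      using jr that n by (auto simp: coord_def C M(4) m(4))
    ultimately show ?thesis unfolding 1(1) by auto
  next
    case 2
    note m = bas_even_moments[OF 2(1) z]
    note M = bas_sol_moments[OF m(1) z]
    have C: "C_mom n k (bas_sol n lam z i) = of_real (c_int n z * ((if k = i then 1 else 0) - (if k = 1 then 1 else 0)))"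
      if "k \<in> {1..n}" for k
      using M(3) m(3)[OF that] by simp
    have "(\<Sum>k=1..n. C_mom n k (bas_sol n lam z i)) =
        (\<Sum>k=1..n. (if k = i then of_real (c_int n z) else 0) - (if k = 1 then of_real (c_int n z) else 0))"
      by (intro sum.cong refl) (auto simp: C)
    also have "\<dots> = 0" using 2(1) by (subst sum_subtractf) auto
    finally have sC: "(\<Sum>k=1..n. C_mom n k (bas_sol n lam z i)) = 0" .
    have "coord n i (bas_sol n lam z i) \<noteq> 0"
      using 2 C[of i] sC by (auto simp: coord_def)
    moreover have "coord n j (bas_sol n lam z i) = 0" if "i \<noteq> j"
      using jr that j C[of j] sC by (auto simp: coord_def M(2,4) m(2,4))
    ultimately show ?thesis by auto
  next
    case 3
    note m = bas_odd_moments[OF 3(1) z n]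
    note M = bas_sol_moments[OF m(1) z]
    have C: "C_mom n k (bas_sol n lam z i) = 0" if "k \<in> {1..n}" for k
      using M(3) m(3)[OF that] by simp
    have "i - n \<in> {1..n}" "i = n + (i - n)" "\<not> i \<le> n" "i \<noteq> 0" using 3(1) by auto
    then have "coord n i (bas_sol n lam z i) = of_real (s_int n z)"
      unfolding coord_def M(4) by (simp only: m(4) if_True if_False simp_thms)
    then have "coord n i (bas_sol n lam z i) \<noteq> 0" using 3(2) by auto
    moreover have "coord n j (bas_sol n lam z i) = 0" if "i \<noteq> j"
      using jr that j by (auto simp: coord_def M(2,4) m(2,4) C)
    ultimately show ?thesis by auto
  qed
  then show "i \<noteq> j \<Longrightarrow> coord n j (bas_sol n lam z i) = 0" and "coord n i (bas_sol n lam z i) \<noteq> 0"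
    by auto
qed

lemma finite_ix: "finite (even_ix n lam \<mu> z)" "finite (odd_ix n lam z)"
  by (auto simp: even_ix_def odd_ix_def)

lemma ix_subset: "even_ix n lam \<mu> z \<subseteq> {0} \<union> {2..n}" "odd_ix n lam z \<subseteq> {n + 1..2 * n}"
  by (auto simp: even_ix_def odd_ix_def)

lemma bas_sol_parity:
  assumes n: "n \<ge> 2"
  shows "i \<in> {0} \<union> {2..n} \<Longrightarrow> bas_sol n lam z i \<in> even_functions n"
    and "i \<in> {n + 1..2 * n} \<Longrightarrow> bas_sol n lam z i \<in> odd_functions n"
proof -
  have m: "bas_sol n lam z i \<in> borel_measurable (torus n)" if "i \<in> {0} \<union> {2..n} \<union> {n + 1..2 * n}" for i
    unfolding bas_sol_def[abs_def] using bas_measurable[OF that]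
    by (intro measurable_compose[OF _ borel_measurable_of_real] borel_measurable_divide) auto
  show "bas_sol n lam z i \<in> even_functions n" if i: "i \<in> {0} \<union> {2..n}"
  proof -
    have "bas_sol n lam z i (torus_uminus n p) = bas_sol n lam z i p" for p
    proof (cases "i = 0")
      case False
      then have "i \<in> {1..n}" "1 \<in> {1..n}" using i by auto
      then show ?thesis
        using False i by (simp add: bas_sol_def bas_def dispersion_torus_uminus cos_torus_uminus)
    qed (simp add: bas_sol_def bas_def dispersion_torus_uminus)
    moreover have "bas_sol n lam z i \<in> borel_measurable (torus n)" using m[of i] i by blast
    ultimately show ?thesis by (simp add: even_functions_def)
  qed
  show "bas_sol n lam z i \<in> odd_functions n" if i: "i \<in> {n + 1..2 * n}"
  proof -
    have "i - n \<in> {1..n}" "\<not> i \<le> n" "i \<noteq> 0" using i by auto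
    then have "bas_sol n lam z i (torus_uminus n p) = - bas_sol n lam z i p" for p
      by (simp add: bas_sol_def bas_def dispersion_torus_uminus sin_torus_uminus)
    moreover have "bas_sol n lam z i \<in> borel_measurable (torus n)" using m[of i] i by blast
    ultimately show ?thesis by (simp add: odd_functions_def)
  qed
qed

subsection \<open>Multiplicities\<close>

lemma coord_all_zero:
  assumes f: "f \<in> sol n lam \<mu> z" and n: "n \<ge> 2" and z: "z \<le> 0"
    and 0: "\<And>i. i \<in> even_ix n lam \<mu> z \<union> odd_ix n lam z \<Longrightarrow> coord n i f = 0"
  shows "f \<in> null_functions n"
proof (rule sol_coord_zero[OF f n z])
  fix i assume i: "i \<in> {0} \<union> {2..n} \<union> {n + 1..2 * n}"
  show "coord n i f = 0"
    using 0[of i] sol_coord_inactive[OF f n z i] by blast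
qed

lemma even_coord:
  assumes "f \<in> even_functions n" "i \<in> {n + 1..2 * n}"
  shows "coord n i f = 0"
proof -
  have "i - n \<in> {1..n}" "\<not> i \<le> n" "i \<noteq> 0" using assms(2) by auto
  then show ?thesis by (simp add: coord_def even_S_mom[OF assms(1)])
qed

lemma odd_coord:
  assumes "f \<in> odd_functions n" "i \<in> {0} \<union> {2..n}"
  shows "coord n i f = 0"
proof -
  have "i \<in> {1..n} \<or> i = 0" using assms(2) by auto
  then show ?thesis
    using assms(2) by (auto simp: coord_def odd_C_mom[OF assms(1)] odd_A_mom[OF assms(1)])
qed

text \<open>Explicit solutions and coordinates are biorthogonal, so each dimension count reduces to
  choosing the indices I that contribute and checking that the rest of V falls into W.\<close>

lemma sol_sub_quotient_dim:
  assumes n: "n \<ge> 2" and z: "z \<le> 0"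
    and V: "fun_subspace V" "V \<subseteq> sol n lam \<mu> z"
    and I: "I \<subseteq> even_ix n lam \<mu> z \<union> odd_ix n lam z"
    and b: "\<And>i. i \<in> I \<Longrightarrow> bas_sol n lam z i \<in> V"
    and ker: "\<And>f. f \<in> V \<Longrightarrow> (\<And>i. i \<in> I \<Longrightarrow> coord n i f = 0) \<Longrightarrow> f \<in> W"
    and W: "\<And>f i. f \<in> W \<Longrightarrow> i \<in> I \<Longrightarrow> coord n i f = 0"
  shows "quotient_dim V W = enat (card I)"
proof -
  have I': "i \<in> {0} \<union> {2..n} \<union> {n + 1..2 * n}" if "i \<in> I" for i
    using I ix_subset(1)[of n lam \<mu> z] ix_subset(2)[of n lam z] that by blast
  show ?thesis
  proof (rule quotient_dim_eq[where l = "coord n" and b = "bas_sol n lam z"])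
    show "finite I" using I finite_ix by (rule finite_subset[OF _ finite_UnI])
    show "functional_on V (coord n j)" if "j \<in> I" for j
      using V(2) sol_eq(2) by (intro coord_functional I'[OF that]) auto
    show "coord n j (bas_sol n lam z i) = 0" if "i \<in> I" "j \<in> I" "i \<noteq> j" for i j
      using coord_bas_sol(1)[OF _ I'[OF that(2)] z n] I that by blast
    show "coord n i (bas_sol n lam z i) \<noteq> 0" if "i \<in> I" for i
      using coord_bas_sol(2)[OF _ I'[OF that] z n] I that by blast
  qed (use V b ker W in blast)+
qed

lemma card_ix:
  assumes "n \<ge> 2"
  shows "card (even_ix n lam \<mu> z) =
      (if (z < 0 \<or> n \<ge> 3) \<and> sym_det n lam \<mu> z = 0 then 1 else 0) + (if lam * c_int n z = 1 then n - 1 else 0)"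
    and "card (odd_ix n lam z) = (if lam * s_int n z = 1 then n else 0)"
    and "card (even_ix n lam \<mu> z \<union> odd_ix n lam z) = card (even_ix n lam \<mu> z) + card (odd_ix n lam z)"
proof -
  show "card (even_ix n lam \<mu> z) =
      (if (z < 0 \<or> n \<ge> 3) \<and> sym_det n lam \<mu> z = 0 then 1 else 0) + (if lam * c_int n z = 1 then n - 1 else 0)"
    by (simp add: even_ix_def)
  show "card (odd_ix n lam z) = (if lam * s_int n z = 1 then n else 0)"
    by (simp add: odd_ix_def)
  show "card (even_ix n lam \<mu> z \<union> odd_ix n lam z) = card (even_ix n lam \<mu> z) + card (odd_ix n lam z)"
    using ix_subset(1)[of n lam \<mu> z] ix_subset(2)[of n lam z] by (intro card_Un_disjoint finite_ix) fastforce
qed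

section \<open>Square integrability of threshold solutions\<close>

lemma even_sol_Lp2:
  assumes f: "f \<in> even_functions n \<inter> sol n lam \<mu> 0" and n: "n \<ge> 2" and A: "n \<ge> 5 \<or> A_mom n f = 0"
  shows "f \<in> Lp n 2"
proof -
  have fs: "f \<in> sol n lam \<mu> 0" and fe: "f \<in> even_functions n" using f by auto
  note eq = sol_eq(1)[OF fs] and m = sol_eq(3)[OF fs]
  have n1: "1 \<le> n" using n by simp
  show ?thesis
  proof (cases "A_mom n f = 0")
    case True
    \<comment> \<open>With A = 0 the averaged equation makes the C_j sum to 0, so the numerator
      vanishes at the origin and only the bounded remainder is left.\<close>
    have "(\<Sum>j=1..n. C_mom n j f) = 0"
      using sol_relations(3)[OF fs n order_refl] True by simp
    then have k: "of_real \<mu> * A_mom n f + (\<Sum>j=1..n. of_real lam * C_mom n j f) = 0"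
      unfolding sum_distrib_left[symmetric] using True by simp
    note * = threshold_split[OF n eq]
    have S0: "of_real lam * S_mom n j f = 0" if "j \<in> {1..n}" for j
      using even_S_mom[OF fe that] by simp
    have bd: "AE p in torus n. norm ((\<Sum>j=1..n. - (of_real lam * C_mom n j f) * of_real (1 - cos (p j)) +
        of_real lam * S_mom n j f * of_real (sin (p j))) / of_real (dispersion n p)) \<le>
        (\<Sum>j=1..n. norm (of_real lam * C_mom n j f))"
      by (rule *(4)) (rule S0)
    show ?thesis
    proof (rule bounded_imp_Lp2[OF m])
      show "AE p in torus n. norm (f p) \<le> (\<Sum>j=1..n. norm (of_real lam * C_mom n j f))"
        using *(1) bd
      proof eventually_elim
        case (elim p)
        from elim(1) have "f p = (\<Sum>j=1..n. - (of_real lam * C_mom n j f) * of_real (1 - cos (p j)) +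
            of_real lam * S_mom n j f * of_real (sin (p j))) / of_real (dispersion n p)"
          unfolding k by simp
        then show ?case using elim(2) by simp
      qed
    qed
  next
    case False
    then have n5: "n \<ge> 5" using A by simp
    let ?K = "norm (of_real \<mu> * A_mom n f) + (\<Sum>j=1..n. norm (of_real lam * C_mom n j f) + norm (of_real lam * S_mom n j f))"
    have "integrable (torus n) (\<lambda>p. (norm (f p))\<^sup>2)"
    proof (rule Bochner_Integration.integrable_bound)
      show "integrable (torus n) (\<lambda>p. ?K\<^sup>2 * (1 / dispersion n p ^ 2))"
        using n5 by (intro integrable_mult_right integrable_inverse_dispersion) simp
      show "AE p in torus n. norm ((norm (f p))\<^sup>2) \<le> norm (?K\<^sup>2 * (1 / dispersion n p ^ 2))"
        using eq AE_dispersion_pos[OF n1]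
      proof eventually_elim
        case (elim p)
        have "dispersion n p * norm (f p) = norm (of_real (dispersion n p - 0) * f p)"
          using elim(2) by (simp add: norm_mult)
        also have "\<dots> \<le> ?K" unfolding elim(1) by (rule norm_trig_le)
        finally have "norm (f p) \<le> ?K / dispersion n p" using elim(2) by (simp add: field_simps)
        then have "(norm (f p))\<^sup>2 \<le> (?K / dispersion n p)\<^sup>2" by (intro power_mono) auto
        then show ?case by (simp add: power_divide)
      qed
    qed (use m in measurable)
    then show ?thesis using m by (simp add: Lp2_iff)
  qed
qed

lemma even_sol_Lp2_imp:
  assumes f: "f \<in> even_functions n \<inter> sol n lam \<mu> 0" and n: "n \<ge> 2" "n \<le> 4" and f2: "f \<in> Lp n 2"
  shows "A_mom n f = 0"
proof -
  have fs: "f \<in> sol n lam \<mu> 0" and fe: "f \<in> even_functions n" using f by auto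
  have "of_real \<mu> * A_mom n f + (\<Sum>j=1..n. of_real lam * C_mom n j f) = 0"
    using even_S_mom[OF fe] by (intro threshold_Lp2_dim34[OF n f2 sol_eq(1)[OF fs]]) simp
  then show ?thesis using sol_relations(5)[OF fs n(1) order_refl] by simp
qed

lemma odd_sol_eq:
  assumes f: "f \<in> odd_functions n \<inter> sol n lam \<mu> 0"
  shows "AE p in torus n. of_real (dispersion n p) * f p = (\<Sum>j=1..n. of_real lam * S_mom n j f * of_real (sin (p j)))"
proof -
  have fs: "f \<in> sol n lam \<mu> 0" and fo: "f \<in> odd_functions n" using f by auto
  show ?thesis
    using sol_eq(1)[OF fs] by (simp add: trig_def odd_A_mom[OF fo] odd_C_mom[OF fo])
qed

text \<open>Each sine is at most sqrt (2 E), so \<bar>f\<bar>^2 is bounded by a multiple of 1/E,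
  which is integrable from n = 3 on.\<close>

lemma odd_sol_Lp2:
  assumes f: "f \<in> odd_functions n \<inter> sol n lam \<mu> 0" and n: "n \<ge> 3"
  shows "f \<in> Lp n 2"
proof -
  have m: "f \<in> borel_measurable (torus n)" using f by (auto simp: odd_functions_def)
  have n1: "1 \<le> n" using n by simp
  let ?K = "\<Sum>j=1..n. norm (of_real lam * S_mom n j f)"
  have "integrable (torus n) (\<lambda>p. (norm (f p))\<^sup>2)"
  proof (rule Bochner_Integration.integrable_bound)
    show "integrable (torus n) (\<lambda>p. 2 * ?K\<^sup>2 * (1 / dispersion n p ^ 1))"
      using n by (intro integrable_mult_right integrable_inverse_dispersion) simp
    show "AE p in torus n. norm ((norm (f p))\<^sup>2) \<le> norm (2 * ?K\<^sup>2 * (1 / dispersion n p ^ 1))"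
      using odd_sol_eq[OF f] AE_dispersion_pos[OF n1]
    proof eventually_elim
      case (elim p)
      let ?r = "sqrt (2 * dispersion n p)"
      have "dispersion n p * norm (f p) = norm (of_real (dispersion n p) * f p)"
        using elim(2) by (simp add: norm_mult)
      also have "\<dots> \<le> (\<Sum>j=1..n. norm (of_real lam * S_mom n j f) * ?r)"
        unfolding elim(1)
      proof (rule sum_norm_le)
        fix j assume j: "j \<in> {1..n}"
        have "(sin (p j))\<^sup>2 \<le> 2 * dispersion n p"
          using sin_sq_le[of "p j"] one_minus_cos_le_dispersion[OF j, of p] by simp
        then have "\<bar>sin (p j)\<bar> \<le> ?r" by (rule real_le_rsqrt[of "\<bar>sin (p j)\<bar>", simplified])
        then show "norm (of_real lam * S_mom n j f * of_real (sin (p j))) \<le> norm (of_real lam * S_mom n j f) * ?r"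
          unfolding norm_mult[of _ "of_real (sin (p j))"] norm_of_real by (intro mult_left_mono) auto
      qed
      also have "\<dots> = ?K * ?r" by (rule sum_distrib_right[symmetric])
      finally have "norm (f p) \<le> ?K * ?r / dispersion n p" using elim(2) by (simp add: field_simps)
      then have "(norm (f p))\<^sup>2 \<le> (?K * ?r / dispersion n p)\<^sup>2" by (intro power_mono) auto
      also have "\<dots> = ?K\<^sup>2 * (2 * dispersion n p) / (dispersion n p)\<^sup>2"
        using elim(2) by (simp add: power_divide power_mult_distrib)
      also have "\<dots> = 2 * ?K\<^sup>2 * (1 / dispersion n p ^ 1)"
        using elim(2) by (simp add: power2_eq_square)
      finally show ?case using elim(2) by simp
    qed
  qed (use m in measurable)
  then show ?thesis using m by (simp add: Lp2_iff)
qed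

text \<open>By symmetry one integrable term would make both integrable. Their numerators add up to
  at least 2 E - E^2, so 1/E would be bounded by the sum of the two quotients plus 1.\<close>

lemma not_integrable_sin_sq_dim2:
  assumes j: "j \<in> {1..2}"
  shows "\<not> integrable (torus 2) (\<lambda>p. (sin (p j))\<^sup>2 / (dispersion 2 p)\<^sup>2)"
proof
  let ?g = "\<lambda>i p. (sin (p i))\<^sup>2 / (dispersion 2 p)\<^sup>2"
  assume int: "integrable (torus 2) (?g j)"
  have m: "?g i \<in> borel_measurable (torus 2)" if "i \<in> {1..2}" for i
    using that by (intro borel_measurable_divide borel_measurable_power) auto
  have all: "integrable (torus 2) (?g i)" if i: "i \<in> {1..2}" for i
  proof -
    have t: "Transposition.transpose i j permutes {1..2}" using i j by (intro permutes_swap_id)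
    from integrable_torus_map[OF t circle_map_id m[OF j]] int
    have "integrable (torus 2) (\<lambda>p. ?g j (torus_map 2 (Transposition.transpose i j) (\<lambda>_ x. x) p))"
      by blast
    moreover have "?g j (torus_map 2 (Transposition.transpose i j) (\<lambda>_ x. x) p) = ?g i p" for p
      using j by (simp add: torus_map_apply dispersion_torus_map[OF t])
    ultimately show ?thesis by simp
  qed
  have "integrable (torus 2) (\<lambda>p. 1 / dispersion 2 p ^ 1)"
  proof (rule Bochner_Integration.integrable_bound)
    show "integrable (torus 2) (\<lambda>p. ?g 1 p + ?g 2 p + 1)"
      by (intro Bochner_Integration.integrable_add all torus.integrable_const) auto
    have pos: "AE p in torus 2. 0 < dispersion 2 p" by (rule AE_dispersion_pos) simp
    then show "AE p in torus 2. norm (1 / dispersion 2 p ^ 1) \<le> norm (?g 1 p + ?g 2 p + 1)"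
    proof eventually_elim
      case (elim p)
      have E: "dispersion 2 p = (1 - cos (p 1)) + (1 - cos (p 2))"
        by (simp add: dispersion_def numeral_2_eq_2)
      have eq: "(sin (p 1))\<^sup>2 + (sin (p 2))\<^sup>2 = 2 * dispersion 2 p - ((1 - cos (p 1))\<^sup>2 + (1 - cos (p 2))\<^sup>2)"
        by (simp add: E sin_squared_eq power2_eq_square algebra_simps)
      have "0 \<le> (1 - cos (p 1)) * (1 - cos (p 2))" by (intro mult_nonneg_nonneg) auto
      then have "(1 - cos (p 1))\<^sup>2 + (1 - cos (p 2))\<^sup>2 \<le> (dispersion 2 p)\<^sup>2"
        by (simp add: E power2_eq_square algebra_simps)
      then have "dispersion 2 p \<le> (sin (p 1))\<^sup>2 + (sin (p 2))\<^sup>2 + (dispersion 2 p)\<^sup>2"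
        unfolding eq using elim by simp
      then have "dispersion 2 p / (dispersion 2 p)\<^sup>2 \<le> ((sin (p 1))\<^sup>2 + (sin (p 2))\<^sup>2 + (dispersion 2 p)\<^sup>2) / (dispersion 2 p)\<^sup>2"
        by (intro divide_right_mono) auto
      also have "\<dots> = ?g 1 p + ?g 2 p + 1" using elim by (simp add: add_divide_distrib)
      finally have "1 / dispersion 2 p \<le> ?g 1 p + ?g 2 p + 1"
        using elim by (simp add: power2_eq_square)
      then show ?case using elim by simp
    qed
  qed measurable
  then show False using not_integrable_inverse_dispersion[of 2 1] by simp
qed

lemma norm_add_sub_sq: "(norm (x + y))\<^sup>2 + (norm (y - x))\<^sup>2 = 2 * (norm x)\<^sup>2 + 2 * (norm y)\<^sup>2" for x y :: complex
  by (simp only: cmod_power2) (simp add: power2_eq_square algebra_simps)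

text \<open>Reflecting one coordinate and averaging removes the cross term of the two sine waves.\<close>

lemma odd_sol_Lp2_dim2:
  assumes f: "f \<in> odd_functions 2 \<inter> sol 2 lam \<mu> 0" and f2: "f \<in> Lp 2 2"
  shows "f \<in> null_functions 2"
proof -
  define g where "g j = of_real lam * S_mom 2 j f" for j
  have m: "f \<in> borel_measurable (torus 2)" using f2 by (simp add: Lp2_iff)
  have eq: "AE p in torus 2. of_real (dispersion 2 p) * f p = g 1 * of_real (sin (p 1)) + g 2 * of_real (sin (p 2))"
    using odd_sol_eq[OF f] by (simp add: g_def numeral_2_eq_2)
  have flip: "AE p in torus 2. of_real (dispersion 2 p) * f (flip 2 1 p) = g 2 * of_real (sin (p 2)) - g 1 * of_real (sin (p 1))"
    using AE_torus_map[where \<phi> = "\<lambda>k. if k = 1 then circle_neg else (\<lambda>x. x)",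
        OF permutes_id flip_map eq, folded flip_def]
  proof eventually_elim
    case (elim p)
    have d: "dispersion 2 (flip 2 1 p) = dispersion 2 p"
      unfolding flip_def by (rule dispersion_torus_map[OF permutes_id]) simp
    from elim show ?case unfolding d by (simp add: sin_flip)
  qed
  have fm: "(\<lambda>p. (norm (f p))\<^sup>2) \<in> borel_measurable (torus 2)" using m by measurable
  have int: "integrable (torus 2) (\<lambda>p. (norm (f p))\<^sup>2)" using f2 by (simp add: Lp2_iff)
  have int': "integrable (torus 2) (\<lambda>p. (norm (f (flip 2 1 p)))\<^sup>2)"
    unfolding flip_def by (rule iffD2[OF integrable_torus_map[OF permutes_id flip_map fm] int])
  have pos: "AE p in torus 2. 0 < dispersion 2 p" by (rule AE_dispersion_pos) simp
  have sum: "AE p in torus 2. (norm (f p))\<^sup>2 + (norm (f (flip 2 1 p)))\<^sup>2 =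
      2 * ((norm (g 1))\<^sup>2 * (sin (p 1))\<^sup>2 + (norm (g 2))\<^sup>2 * (sin (p 2))\<^sup>2) / (dispersion 2 p)\<^sup>2"
    using eq flip pos
  proof eventually_elim
    case (elim p)
    have "(dispersion 2 p)\<^sup>2 * ((norm (f p))\<^sup>2 + (norm (f (flip 2 1 p)))\<^sup>2) =
        (norm (of_real (dispersion 2 p) * f p))\<^sup>2 + (norm (of_real (dispersion 2 p) * f (flip 2 1 p)))\<^sup>2"
      by (simp add: norm_mult power_mult_distrib distrib_left)
    also have "\<dots> = 2 * (norm (g 1 * of_real (sin (p 1))))\<^sup>2 + 2 * (norm (g 2 * of_real (sin (p 2))))\<^sup>2"
      unfolding elim(1,2) by (rule norm_add_sub_sq)
    also have "\<dots> = 2 * ((norm (g 1))\<^sup>2 * (sin (p 1))\<^sup>2 + (norm (g 2))\<^sup>2 * (sin (p 2))\<^sup>2)"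
      unfolding norm_mult norm_of_real power_mult_distrib power2_abs by simp
    finally show ?case using elim(3) by (simp add: field_simps)
  qed
  have g0: "g j = 0" if j: "j \<in> {1..2}" for j
  proof -
    have "integrable (torus 2) (\<lambda>p. norm ((g j)\<^sup>2) * ((sin (p j))\<^sup>2 / (dispersion 2 p)\<^sup>2))"
    proof (rule Bochner_Integration.integrable_bound[OF Bochner_Integration.integrable_add[OF int int']])
      show "AE p in torus 2. norm (norm ((g j)\<^sup>2) * ((sin (p j))\<^sup>2 / (dispersion 2 p)\<^sup>2)) \<le>
          norm ((norm (f p))\<^sup>2 + (norm (f (flip 2 1 p)))\<^sup>2)"
        using sum
      proof eventually_elim
        case (elim p)
        have "(norm (g j))\<^sup>2 * (sin (p j))\<^sup>2 \<le> 2 * ((norm (g 1))\<^sup>2 * (sin (p 1))\<^sup>2 + (norm (g 2))\<^sup>2 * (sin (p 2))\<^sup>2)"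
        proof -
          have gen: "x \<le> 2 * (x + y)" "y \<le> 2 * (x + y)" if "0 \<le> x" "0 \<le> y" for x y :: real
            using that by simp_all
          have "j = 1 \<or> j = 2" using j by auto
          then show ?thesis
          proof
            assume j1: "j = 1"
            show ?thesis unfolding j1 by (rule gen(1)) simp_all
          next
            assume j2: "j = 2"
            show ?thesis unfolding j2 by (rule gen(2)) simp_all
          qed
        qed
        then have "(norm (g j))\<^sup>2 * (sin (p j))\<^sup>2 / (dispersion 2 p)\<^sup>2 \<le>
            2 * ((norm (g 1))\<^sup>2 * (sin (p 1))\<^sup>2 + (norm (g 2))\<^sup>2 * (sin (p 2))\<^sup>2) / (dispersion 2 p)\<^sup>2"
          by (intro divide_right_mono) auto
        then show ?case unfolding elim by (simp add: norm_power abs_of_nonneg)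
      qed
      show "(\<lambda>p. norm ((g j)\<^sup>2) * ((sin (p j))\<^sup>2 / (dispersion 2 p)\<^sup>2)) \<in> borel_measurable (torus 2)"
        using j by (intro borel_measurable_times borel_measurable_const borel_measurable_divide borel_measurable_power) auto
    qed
    then have "(g j)\<^sup>2 = 0"
      by (rule const_mult_integrable_imp_0) (rule not_integrable_sin_sq_dim2[OF j])
    then show ?thesis by simp
  qed
  have "AE p in torus 2. f p = 0"
    using eq pos by eventually_elim (simp add: g0)
  then show ?thesis using m by (simp add: null_functions_def)
qed

section \<open>Dimensions of eigenspaces and of threshold solution spaces\<close>

lemma Lp1_sol: "sol n lam \<mu> z \<inter> Lp n 1 = sol n lam \<mu> z"
  using sol_eq(2) by (auto simp: Lp1_iff)

lemma quotient_dim_eigenspace: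
  assumes n: "n \<ge> 2" and z: "z < 0"
  shows "quotient_dim (eigenspace n lam \<mu> z) (null_functions n) =
    enat (card (even_ix n lam \<mu> z \<union> odd_ix n lam z))"
  unfolding eigenspace_eq_sol[OF z]
proof (rule sol_sub_quotient_dim[OF n less_imp_le[OF z] fun_subspace_sol order_refl order_refl])
  show "coord n i f = 0" if "f \<in> null_functions n" "i \<in> even_ix n lam \<mu> z \<union> odd_ix n lam z" for f i
    using ix_subset(1)[of n lam \<mu> z] ix_subset(2)[of n lam z] that by (intro coord_null) auto
qed (use bas_sol_in_sol coord_all_zero n z in \<open>auto simp: less_imp_le\<close>)

lemma even_eigenvalue_mult:
  assumes n: "n \<ge> 2"
  shows "quotient_dim (even_solutions n lam \<mu> \<inter> Lp n 2) (null_functions n) =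
    enat ((if n \<ge> 5 \<and> sym_det n lam \<mu> 0 = 0 then 1 else 0) + (if lam * c_int n 0 = 1 then n - 1 else 0))"
proof -
  \<comment> \<open>Up to n = 4 a square integrable even solution has A = 0, so index 0 drops out;
    from n = 5 on every even solution is square integrable.\<close>
  define I where "I = (if n \<ge> 5 then even_ix n lam \<mu> 0 else even_ix n lam \<mu> 0 - {0})"
  have I: "I \<subseteq> even_ix n lam \<mu> 0" by (auto simp: I_def)
  have I': "i \<in> {0} \<union> {2..n}" if "i \<in> I" for i using I ix_subset(1)[of n lam \<mu> 0] that by blast
  have "quotient_dim (even_functions n \<inter> sol n lam \<mu> 0 \<inter> Lp n 2) (null_functions n) = enat (card I)"
  proof (rule sol_sub_quotient_dim[OF n order_refl])
    show "fun_subspace (even_functions n \<inter> sol n lam \<mu> 0 \<inter> Lp n 2)"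
      by (intro fun_subspace_Int fun_subspace_even fun_subspace_sol fun_subspace_Lp2)
    show "I \<subseteq> even_ix n lam \<mu> 0 \<union> odd_ix n lam 0" using I by blast
    show "bas_sol n lam 0 i \<in> even_functions n \<inter> sol n lam \<mu> 0 \<inter> Lp n 2" if i: "i \<in> I" for i
    proof -
      have b: "bas_sol n lam 0 i \<in> even_functions n \<inter> sol n lam \<mu> 0"
        using bas_sol_parity(1)[OF n I'[OF i]] bas_sol_in_sol[OF _ order_refl n, of i lam \<mu>] I i by blast
      have "n \<ge> 5 \<or> i \<noteq> 0" using i by (auto simp: I_def split: if_splits)
      moreover have "A_mom n (bas_sol n lam 0 i) = 0" if "i \<noteq> 0"
        using coord_bas_sol(1)[of i n lam \<mu> 0 0] that I i n by (auto simp: coord_def)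
      ultimately show ?thesis using even_sol_Lp2[OF b n] b by blast
    qed
    show "f \<in> null_functions n"
      if f: "f \<in> even_functions n \<inter> sol n lam \<mu> 0 \<inter> Lp n 2" and 0: "\<And>i. i \<in> I \<Longrightarrow> coord n i f = 0" for f
    proof (rule coord_all_zero[OF _ n order_refl])
      show "f \<in> sol n lam \<mu> 0" using f by blast
      fix i assume i: "i \<in> even_ix n lam \<mu> 0 \<union> odd_ix n lam 0"
      show "coord n i f = 0"
      proof (cases "i \<in> odd_ix n lam 0")
        case True
        then show ?thesis using f ix_subset(2)[of n lam 0] by (intro even_coord) auto
      next
        case False
        then have i: "i \<in> even_ix n lam \<mu> 0" using i by blast
        show ?thesis
        proof (cases "i \<in> I")
          case True
          then show ?thesis by (rule 0)
        next
          case False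
          then have "i = 0" "n \<le> 4" using i by (auto simp: I_def split: if_splits)
          then show ?thesis using even_sol_Lp2_imp[of f n lam \<mu>] f n by (auto simp: coord_def)
        qed
      qed
    qed
    show "coord n i f = 0" if "f \<in> null_functions n" "i \<in> I" for f i
      using I'[OF that(2)] that(1) by (intro coord_null) auto
  qed blast
  moreover have "card I = (if n \<ge> 5 \<and> sym_det n lam \<mu> 0 = 0 then 1 else 0) + (if lam * c_int n 0 = 1 then n - 1 else 0)"
    by (auto simp: I_def even_ix_def)
  ultimately show ?thesis by (simp add: even_solutions_eq[OF n])
qed

lemma odd_eigenvalue_mult:
  assumes n: "n \<ge> 2"
  shows "quotient_dim (odd_solutions n lam \<inter> Lp n 2) (null_functions n) =
    enat (if n \<ge> 3 \<and> lam * s_int n 0 = 1 then n else 0)"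
proof -
  \<comment> \<open>For n = 2 the only square integrable odd solutions are null functions; from n =
    3 on all odd solutions qualify. The value \<mu> = 0 below is a placeholder, since odd solutions
    do not depend on it.\<close>
  define I where "I = (if n \<ge> 3 then odd_ix n lam 0 else {})"
  have I: "I \<subseteq> odd_ix n lam 0" by (auto simp: I_def)
  have I': "i \<in> {n + 1..2 * n}" if "i \<in> I" for i using I ix_subset(2)[of n lam 0] that by blast
  have "quotient_dim (odd_functions n \<inter> sol n lam 0 0 \<inter> Lp n 2) (null_functions n) = enat (card I)"
  proof (rule sol_sub_quotient_dim[OF n order_refl])
    show "fun_subspace (odd_functions n \<inter> sol n lam 0 0 \<inter> Lp n 2)"
      by (intro fun_subspace_Int fun_subspace_odd fun_subspace_sol fun_subspace_Lp2)
    show "I \<subseteq> even_ix n lam 0 0 \<union> odd_ix n lam 0" using I by blast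
    show "bas_sol n lam 0 i \<in> odd_functions n \<inter> sol n lam 0 0 \<inter> Lp n 2" if i: "i \<in> I" for i
    proof -
      have b: "bas_sol n lam 0 i \<in> odd_functions n \<inter> sol n lam 0 0"
        using bas_sol_parity(2)[OF n I'[OF i]] bas_sol_in_sol[OF _ order_refl n, of i lam 0] I i by blast
      have "n \<ge> 3" using i by (auto simp: I_def split: if_splits)
      then show ?thesis using odd_sol_Lp2[OF b] b by blast
    qed
    show "f \<in> null_functions n"
      if f: "f \<in> odd_functions n \<inter> sol n lam 0 0 \<inter> Lp n 2" and 0: "\<And>i. i \<in> I \<Longrightarrow> coord n i f = 0" for f
    proof (cases "n = 2")
      case True
      then show ?thesis using odd_sol_Lp2_dim2[of f lam 0] f by auto
    next
      case False
      show ?thesis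
      proof (rule coord_all_zero[OF _ n order_refl])
        show "f \<in> sol n lam 0 0" using f by blast
        fix i assume i: "i \<in> even_ix n lam 0 0 \<union> odd_ix n lam 0"
        show "coord n i f = 0"
        proof (cases "i \<in> odd_ix n lam 0")
          case True
          then show ?thesis using 0[of i] False n by (auto simp: I_def)
        next
          case False
          then show ?thesis using f i ix_subset(1)[of n lam 0 0] by (intro odd_coord) auto
        qed
      qed
    qed
    show "coord n i f = 0" if "f \<in> null_functions n" "i \<in> I" for f i
      using I'[OF that(2)] that(1) by (intro coord_null) auto
  qed blast
  moreover have "card I = (if n \<ge> 3 \<and> lam * s_int n 0 = 1 then n else 0)"
    by (auto simp: I_def odd_ix_def)
  ultimately show ?thesis by (simp add: odd_solutions_eq[OF n, of lam 0])
qed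

lemma even_resonance_mult:
  assumes n: "n \<ge> 2"
  shows "quotient_dim (even_solutions n lam \<mu> \<inter> Lp n 1) (even_solutions n lam \<mu> \<inter> Lp n 2) =
    enat (if (n = 3 \<or> n = 4) \<and> sym_det n lam \<mu> 0 = 0 then 1 else 0)"
proof -
  \<comment> \<open>Modulo square integrable functions only the symmetric solution can survive, and
    only for n = 3, 4: for n = 2 every even solution has A = 0 and is bounded, and for n \<ge> 5
    every even solution is square integrable.\<close>
  define I where "I = (if n = 3 \<or> n = 4 then even_ix n lam \<mu> 0 \<inter> {0} else {})"
  have I: "I \<subseteq> even_ix n lam \<mu> 0" "I \<subseteq> {0}" by (auto simp: I_def)
  let ?V = "even_functions n \<inter> sol n lam \<mu> 0"
  have "quotient_dim ?V (?V \<inter> Lp n 2) = enat (card I)"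
  proof (rule sol_sub_quotient_dim[OF n order_refl])
    show "fun_subspace ?V"
      by (intro fun_subspace_Int fun_subspace_even fun_subspace_sol)
    show "I \<subseteq> even_ix n lam \<mu> 0 \<union> odd_ix n lam 0" using I by blast
    show "bas_sol n lam 0 i \<in> ?V" if i: "i \<in> I" for i
      using bas_sol_parity(1)[OF n, of i lam 0] bas_sol_in_sol[OF _ order_refl n, of i lam \<mu>] I i by blast
    show "f \<in> ?V \<inter> Lp n 2" if f: "f \<in> ?V" and 0: "\<And>i. i \<in> I \<Longrightarrow> coord n i f = 0" for f
    proof -
      have "n \<ge> 5 \<or> A_mom n f = 0"
      proof (cases "0 \<in> I")
        case True
        then show ?thesis using 0[of 0] by (simp add: coord_def)
      next
        case False
        then have "n \<ge> 5 \<or> 0 \<notin> even_ix n lam \<mu> 0 \<union> odd_ix n lam 0"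
          using n by (auto simp: I_def even_ix_def odd_ix_def split: if_splits)
        then show ?thesis
          using sol_coord_inactive[of f n lam \<mu> 0 0] f n by (auto simp: coord_def)
      qed
      then show ?thesis using even_sol_Lp2[OF f n] f by blast
    qed
    show "coord n i f = 0" if f: "f \<in> ?V \<inter> Lp n 2" and i: "i \<in> I" for f i
    proof -
      have "i = 0" "n \<le> 4" using i I by (auto simp: I_def split: if_splits)
      then show ?thesis using even_sol_Lp2_imp[of f n lam \<mu>] f n by (auto simp: coord_def)
    qed
  qed blast
  moreover have "card I = (if (n = 3 \<or> n = 4) \<and> sym_det n lam \<mu> 0 = 0 then 1 else 0)"
    by (auto simp: I_def even_ix_def)
  moreover have "?V \<inter> Lp n 1 = ?V" using Lp1_sol by blast
  ultimately show ?thesis by (simp add: even_solutions_eq[OF n])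
qed

lemma odd_resonance_mult:
  assumes n: "n \<ge> 2"
  shows "quotient_dim (odd_solutions n lam \<inter> Lp n 1) (odd_solutions n lam \<inter> Lp n 2) =
    enat (if n = 2 \<and> lam * s_int n 0 = 1 then n else 0)"
proof -
  \<comment> \<open>For n = 2 the whole odd solution space counts, because its square integrable
    part is null; for n \<ge> 3 the quotient is trivial.\<close>
  define I where "I = (if n = 2 then odd_ix n lam 0 else {})"
  have I: "I \<subseteq> odd_ix n lam 0" by (auto simp: I_def)
  have I': "i \<in> {n + 1..2 * n}" if "i \<in> I" for i using I ix_subset(2)[of n lam 0] that by blast
  let ?V = "odd_functions n \<inter> sol n lam 0 0"
  have "quotient_dim ?V (?V \<inter> Lp n 2) = enat (card I)"
  proof (rule sol_sub_quotient_dim[OF n order_refl])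
    show "fun_subspace ?V"
      by (intro fun_subspace_Int fun_subspace_odd fun_subspace_sol)
    show "I \<subseteq> even_ix n lam 0 0 \<union> odd_ix n lam 0" using I by blast
    show "bas_sol n lam 0 i \<in> ?V" if i: "i \<in> I" for i
      using bas_sol_parity(2)[OF n I'[OF i]] bas_sol_in_sol[OF _ order_refl n, of i lam 0] I i by blast
    show "f \<in> ?V \<inter> Lp n 2" if f: "f \<in> ?V" and 0: "\<And>i. i \<in> I \<Longrightarrow> coord n i f = 0" for f
    proof (cases "n = 2")
      case True
      have "f \<in> null_functions n"
      proof (rule coord_all_zero[OF _ n order_refl])
        show "f \<in> sol n lam 0 0" using f by blast
        fix i assume i: "i \<in> even_ix n lam 0 0 \<union> odd_ix n lam 0"
        show "coord n i f = 0"
        proof (cases "i \<in> odd_ix n lam 0")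
          case True
          then show ?thesis using 0[of i] \<open>n = 2\<close> by (auto simp: I_def)
        next
          case False
          then show ?thesis using f i ix_subset(1)[of n lam 0 0] by (intro odd_coord) auto
        qed
      qed
      then show ?thesis using f null_subset_Lp2 by blast
    next
      case False
      then show ?thesis using odd_sol_Lp2[OF f] f n by simp
    qed
    show "coord n i f = 0" if f: "f \<in> ?V \<inter> Lp n 2" and i: "i \<in> I" for f i
    proof -
      have n2: "n = 2" using i by (auto simp: I_def split: if_splits)
      then have "f \<in> null_functions n" using odd_sol_Lp2_dim2[of f lam 0] f by auto
      then show ?thesis using I'[OF i] by (intro coord_null) auto
    qed
  qed blast
  moreover have "card I = (if n = 2 \<and> lam * s_int n 0 = 1 then n else 0)"
    by (auto simp: I_def odd_ix_def)
  moreover have "?V \<inter> Lp n 1 = ?V" using Lp1_sol by blast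
  ultimately show ?thesis by (simp add: odd_solutions_eq[OF n, of lam 0])
qed

lemma coupling_critical:
  assumes n: "n \<ge> 2"
  shows "lam * s_int n 0 = 1 \<longleftrightarrow> lam = lam_s n" and "lam * c_int n 0 = 1 \<longleftrightarrow> lam = lam_c n"
    and "n \<ge> 3 \<Longrightarrow> sym_det n lam \<mu> 0 = 0 \<longleftrightarrow> H0_bar n lam \<mu> = 0"
  using s_int_pos[OF n] c_int_pos[OF n] sym_det_eq_0_iff[of 0 n lam \<mu>] n
  by (auto simp: lam_s_eq lam_c_eq field_simps H0_bar_def X_asym_eq)

lemma threshold_eigenvalue_mult_eq:
  assumes n: "n \<ge> 2"
  shows "threshold_eigenvalue_mult n lam \<mu> = enat ((if n \<ge> 5 \<and> H0_bar n lam \<mu> = 0 then 1 else 0) +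
    (if lam = lam_c n then n - 1 else 0) + (if n \<ge> 3 \<and> lam = lam_s n then n else 0))"
  unfolding threshold_eigenvalue_mult_def even_eigenvalue_mult[OF n] odd_eigenvalue_mult[OF n] coupling_critical(1,2)[OF n]
  using coupling_critical(3)[OF n, of lam \<mu>] by auto

lemma threshold_resonance_mult_eq:
  assumes n: "n \<ge> 2"
  shows "threshold_resonance_mult n lam \<mu> = enat ((if (n = 3 \<or> n = 4) \<and> H0_bar n lam \<mu> = 0 then 1 else 0) +
    (if n = 2 \<and> lam = lam_s n then n else 0))"
  unfolding threshold_resonance_mult_def even_resonance_mult[OF n] odd_resonance_mult[OF n] coupling_critical(1,2)[OF n]
  using coupling_critical(3)[OF n, of lam \<mu>] by auto

lemma fun_subspace_solutions:
  assumes n: "n \<ge> 2"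
  shows "fun_subspace (even_solutions n lam \<mu>)" "fun_subspace (odd_solutions n lam)"
  unfolding even_solutions_eq[OF n] odd_solutions_eq[OF n, of lam 0]
  by (intro fun_subspace_Int fun_subspace_even fun_subspace_odd fun_subspace_sol)+

lemma solutions_subset_Lp1:
  assumes n: "n \<ge> 2"
  shows "even_solutions n lam \<mu> \<subseteq> Lp n 1" "odd_solutions n lam \<subseteq> Lp n 1"
  unfolding even_solutions_eq[OF n] odd_solutions_eq[OF n, of lam 0] using Lp1_sol by blast+

lemma threshold_eigenvalue_iff:
  assumes n: "n \<ge> 2"
  shows "threshold_eigenvalue n lam \<mu> \<longleftrightarrow> threshold_eigenvalue_mult n lam \<mu> \<noteq> 0"
proof -
  let ?e = "even_solutions n lam \<mu> \<inter> Lp n 2" and ?o = "odd_solutions n lam \<inter> Lp n 2"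
  have s: "fun_subspace ?e" "fun_subspace ?o"
    by (intro fun_subspace_Int fun_subspace_solutions[OF n] fun_subspace_Lp2)+
  have e: "quotient_dim ?e (null_functions n) \<noteq> 0 \<longleftrightarrow> \<not> ?e \<subseteq> null_functions n"
    and o: "quotient_dim ?o (null_functions n) \<noteq> 0 \<longleftrightarrow> \<not> ?o \<subseteq> null_functions n"
    using quotient_dim_eq_0[OF s(1), of "null_functions n"] quotient_dim_pos[OF s(1) fun_subspace_null]
      quotient_dim_eq_0[OF s(2), of "null_functions n"] quotient_dim_pos[OF s(2) fun_subspace_null]
    by blast+
  have "threshold_eigenvalue n lam \<mu> \<longleftrightarrow> \<not> ?e \<subseteq> null_functions n \<or> \<not> ?o \<subseteq> null_functions n"
    unfolding threshold_eigenvalue_def by blast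
  then show ?thesis
    unfolding threshold_eigenvalue_mult_def using e o by auto
qed

lemma threshold_resonance_iff:
  assumes n: "n \<ge> 2"
  shows "threshold_resonance n lam \<mu> \<longleftrightarrow> threshold_resonance_mult n lam \<mu> \<noteq> 0"
proof -
  let ?e = "even_solutions n lam \<mu>" and ?o = "odd_solutions n lam"
  have L: "?e \<inter> Lp n 1 = ?e" "?o \<inter> Lp n 1 = ?o" using solutions_subset_Lp1[OF n] by blast+
  have s: "fun_subspace ?e" "fun_subspace ?o"
    by (rule fun_subspace_solutions[OF n])+
  have s2: "fun_subspace (?e \<inter> Lp n 2)" "fun_subspace (?o \<inter> Lp n 2)"
    by (intro fun_subspace_Int s fun_subspace_Lp2)+
  have e: "quotient_dim ?e (?e \<inter> Lp n 2) \<noteq> 0 \<longleftrightarrow> \<not> ?e \<subseteq> Lp n 2"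
    and o: "quotient_dim ?o (?o \<inter> Lp n 2) \<noteq> 0 \<longleftrightarrow> \<not> ?o \<subseteq> Lp n 2"
    using quotient_dim_eq_0[OF s(1), of "?e \<inter> Lp n 2"] quotient_dim_pos[OF s(1) s2(1)]
      quotient_dim_eq_0[OF s(2), of "?o \<inter> Lp n 2"] quotient_dim_pos[OF s(2) s2(2)]
    by blast+
  have "threshold_resonance n lam \<mu> \<longleftrightarrow> \<not> ?e \<subseteq> Lp n 2 \<or> \<not> ?o \<subseteq> Lp n 2"
    unfolding threshold_resonance_def using null_subset_Lp2[of n] solutions_subset_Lp1[OF n] by blast
  then show ?thesis
    unfolding threshold_resonance_mult_def L using e o by auto
qed

lemma not_super_threshold_resonance:
  assumes n: "n \<ge> 2"
  shows "\<not> super_threshold_resonance n lam \<mu>"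
  unfolding super_threshold_resonance_def using solutions_subset_Lp1[OF n] by blast

section \<open>Counting the negative eigenvalues\<close>

lemma number_of_negative_eigenvalues_eq:
  assumes n: "n \<ge> 2"
  shows "number_of_negative_eigenvalues n lam \<mu> = enat (
    (if H0_bar n lam \<mu> \<ge> 0 \<and> lam < X_asym n then 0 else 1) +
    (if H0_bar n lam \<mu> > 0 \<and> lam > X_asym n then 1 else 0) +
    (if lam > lam_c n then n - 1 else 0) + (if lam > lam_s n then n else 0))"
proof -
  let ?I = "\<lambda>z. even_ix n lam \<mu> z \<union> odd_ix n lam z"
  define R0 where "R0 = {z. z < 0 \<and> sym_det n lam \<mu> z = 0}"
  define Rc where "Rc = {z. z < 0 \<and> lam * c_int n z = 1}"
  define Rs where "Rs = {z. z < 0 \<and> lam * s_int n z = 1}"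
  have R0: "finite R0" "card R0 = (if H0_bar n lam \<mu> \<ge> 0 \<and> lam < X_asym n then 0 else 1) +
      (if H0_bar n lam \<mu> > 0 \<and> lam > X_asym n then 1 else 0)"
    unfolding R0_def using sym_det_roots[OF n] by auto
  have n1: "1 \<le> n" "1 \<in> {1..n}" "2 \<in> {1..n}" using n by auto
  have ks: "kint n 0 (\<lambda>p. (sin (p 1))\<^sup>2)"
    using n1 n kint_mult[OF kint_sin[of 1 n 0], of "\<lambda>p. sin (p 1)" 1] by (simp add: power2_eq_square)
  have "finite {z. z < 0 \<and> lam * mom n z (\<lambda>p. (sin (p 1))\<^sup>2) = 1}"
    "card {z. z < 0 \<and> lam * mom n z (\<lambda>p. (sin (p 1))\<^sup>2) = 1} = (if lam > inverse (mom n 0 (\<lambda>p. (sin (p 1))\<^sup>2)) then 1 else 0)"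
    by (rule mom_roots[OF ks, where K = 1]; use not_AE_sin n1 in \<open>simp add: abs_square_le_1\<close>)+
  then have Rs: "finite Rs" "card Rs = (if lam > lam_s n then 1 else 0)"
    by (simp_all add: Rs_def lam_s_eq s_int_def)
  have kc: "kint n 0 (\<lambda>p. (cos (p 1) - cos (p 2))\<^sup>2 / 2)"
  proof -
    have "kint n 0 (\<lambda>p. (1/2) * ((cos (p 1) - cos (p 2)) * (cos (p 1) - cos (p 2))))"
      using n1 abs_cos_diff_le_2 by (intro kint_cmult kint_mult[where K = 2] kint_cos_diff) auto
    then show ?thesis by (simp add: power2_eq_square)
  qed
  have ceq: "mom n z (\<lambda>p. (cos (p 1) - cos (p 2))\<^sup>2 / 2) = c_int n z" for z
    using mom_cmult[of n z "1/2" "\<lambda>p. (cos (p 1) - cos (p 2))\<^sup>2"] by (simp add: c_int_def)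
  have cb: "(cos x - cos y)\<^sup>2 / 2 \<le> 2" for x y :: real
  proof -
    have "\<bar>cos x - cos y\<bar>\<^sup>2 \<le> 2\<^sup>2" by (intro power_mono abs_cos_diff_le_2) simp
    then show ?thesis by simp
  qed
  have "finite {z. z < 0 \<and> lam * mom n z (\<lambda>p. (cos (p 1) - cos (p 2))\<^sup>2 / 2) = 1}"
    "card {z. z < 0 \<and> lam * mom n z (\<lambda>p. (cos (p 1) - cos (p 2))\<^sup>2 / 2) = 1} =
      (if lam > inverse (mom n 0 (\<lambda>p. (cos (p 1) - cos (p 2))\<^sup>2 / 2)) then 1 else 0)"
    by (rule mom_roots[OF kc, where K = 2]; use not_AE_cos_diff[OF n] n1 cb in simp)+
  then have Rc: "finite Rc" "card Rc = (if lam > lam_c n then 1 else 0)"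
    by (simp_all only: Rc_def lam_c_eq ceq)
  \<comment> \<open>Roots of different sectors may coincide. At such a point the multiplicities 1, n
    - 1 and n add up, so summing over the union counts each sector with its own weight.\<close>
  define U where "U = R0 \<union> Rc \<union> Rs"
  have U: "finite U" "\<And>z. z \<in> U \<Longrightarrow> z < 0" using R0 Rc Rs by (auto simp: U_def R0_def Rc_def Rs_def)
  have neg: "negative_eigenvalues n lam \<mu> = {z. z < 0 \<and> ?I z \<noteq> {}}"
  proof -
    have "eigenspace n lam \<mu> z - null_functions n \<noteq> {} \<longleftrightarrow> ?I z \<noteq> {}" if z: "z < 0" for z
    proof -
      have s: "fun_subspace (eigenspace n lam \<mu> z)" unfolding eigenspace_eq_sol[OF z] by (rule fun_subspace_sol)
      have "eigenspace n lam \<mu> z - null_functions n \<noteq> {} \<longleftrightarrow> quotient_dim (eigenspace n lam \<mu> z) (null_functions n) \<noteq> 0"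
        using quotient_dim_eq_0[OF s, of "null_functions n"] quotient_dim_pos[OF s fun_subspace_null] by blast
      also have "\<dots> \<longleftrightarrow> ?I z \<noteq> {}"
        unfolding quotient_dim_eigenspace[OF n z] using finite_ix by (simp add: zero_enat_def card_eq_0_iff)
      finally show ?thesis .
    qed
    then show ?thesis unfolding negative_eigenvalues_def by blast
  qed
  have sub: "negative_eigenvalues n lam \<mu> \<subseteq> U"
    unfolding neg U_def R0_def Rc_def Rs_def by (auto simp: even_ix_def odd_ix_def split: if_splits)
  have "number_of_negative_eigenvalues n lam \<mu> = (\<Sum>z\<in>negative_eigenvalues n lam \<mu>. enat (card (?I z)))"
  proof -
    have "number_of_negative_eigenvalues n lam \<mu> =
        (\<Sum>z\<in>negative_eigenvalues n lam \<mu>. quotient_dim (eigenspace n lam \<mu> z) (null_functions n))"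
      unfolding number_of_negative_eigenvalues_def by (rule if_P) (rule finite_subset[OF sub U(1)])
    also have "\<dots> = (\<Sum>z\<in>negative_eigenvalues n lam \<mu>. enat (card (?I z)))"
      using sub U(2) by (intro sum.cong refl quotient_dim_eigenspace[OF n]) blast
    finally show ?thesis .
  qed
  also have "\<dots> = (\<Sum>z\<in>U. enat (card (?I z)))"
    using sub U by (intro sum.mono_neutral_left) (auto simp: neg zero_enat_def)
  also have "\<dots> = enat (\<Sum>z\<in>U. card (?I z))"
    using U(1) by (induction U rule: finite_induct) (auto simp: zero_enat_def)
  also have "(\<Sum>z\<in>U. card (?I z)) = (\<Sum>z\<in>U. (if z \<in> R0 then 1 else 0) + (if z \<in> Rc then n - 1 else 0) + (if z \<in> Rs then n else 0))"
    using U(2) by (intro sum.cong refl) (auto simp: card_ix[OF n] R0_def Rc_def Rs_def)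
  also have "\<dots> = card R0 + (n - 1) * card Rc + n * card Rs"
  proof -
    have "(\<Sum>z\<in>U. if z \<in> R then c else 0) = c * card R" if "R \<subseteq> U" for R and c :: nat
      using that U(1) by (simp add: sum.If_cases Int_absorb1 mult.commute)
    from this[of R0 1] this[of Rc "n - 1"] this[of Rs n] show ?thesis
      by (simp add: sum.distrib U_def subset_Un_eq Un_ac)
  qed
  finally show ?thesis by (simp add: R0 Rc Rs)
qed

section \<open>The phase diagram\<close>

lemma \<Gamma>r_fiber:
  assumes "lam0 > X_asym n"
  shows "\<Gamma>r n \<inter> {(lam, \<mu>). lam = lam0} = {(lam0, n + n / (lam0 - X_asym n))}"
  using assms by (auto simp: \<Gamma>r_def H0_bar_def field_simps)

theorem theorem5p2:
  fixes n :: nat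
  assumes "n \<ge> 2"
  shows
    "(\<forall>(D, k) \<in>
        {(G0 n, 0),
         (G1 n \<inter> S_minus n, 1),
         (G2 n \<inter> S_minus n, 2),
         (G1 n \<inter> S_plus n \<inter> C_minus n, n + 1),
         (G2 n \<inter> S_plus n \<inter> C_minus n, n + 2),
         (G1 n \<inter> C_plus n, 2 * n),
         (G2 n \<inter> C_plus n, 2 * n + 1)}.
        \<forall>(lam, \<mu>) \<in> D.
          number_of_negative_eigenvalues n lam \<mu> = enat k \<and>
          \<not> threshold_eigenvalue n lam \<mu> \<and> \<not> threshold_resonance n lam \<mu>)
     \<and>
     (\<forall>lam \<mu>. \<not> super_threshold_resonance n lam \<mu>)
     \<and>
     (\<forall>(B, k) \<in>
        {(\<Gamma>l n, 0),
         (\<Gamma>r n \<inter> S_minus n, 1),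
         (\<Gamma>r n \<inter> S_plus n \<inter> C_minus n, n + 1),
         (\<Gamma>r n \<inter> C_plus n, 2 * n)}.
        \<forall>(lam, \<mu>) \<in> B.
          number_of_negative_eigenvalues n lam \<mu> = enat k \<and>
          (n = 2 \<longrightarrow> \<not> threshold_resonance n lam \<mu> \<and> \<not> threshold_eigenvalue n lam \<mu>) \<and>
          (n = 3 \<or> n = 4 \<longrightarrow>
             threshold_resonance_of_mult n lam \<mu> 1 \<and> \<not> threshold_eigenvalue n lam \<mu>) \<and>
          (n \<ge> 5 \<longrightarrow>
             threshold_eigenvalue_of_mult n lam \<mu> 1 \<and> \<not> threshold_resonance n lam \<mu>))
     \<and>
     (\<forall>(S, k) \<in> {(S_zero n \<inter> G1 n, 1), (S_zero n \<inter> G2 n, 2)}.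
        \<forall>(lam, \<mu>) \<in> S.
          number_of_negative_eigenvalues n lam \<mu> = enat k \<and>
          (n = 2 \<longrightarrow>
             threshold_resonance_of_mult n lam \<mu> 2 \<and> \<not> threshold_eigenvalue n lam \<mu>) \<and>
          (n \<ge> 3 \<longrightarrow>
             threshold_eigenvalue_of_mult n lam \<mu> n \<and> \<not> threshold_resonance n lam \<mu>))
     \<and>
     (\<forall>(C, k) \<in> {(C_zero n \<inter> G1 n, n + 1), (C_zero n \<inter> G2 n, n + 2)}.
        \<forall>(lam, \<mu>) \<in> C.
          number_of_negative_eigenvalues n lam \<mu> = enat k \<and>
          threshold_eigenvalue_of_mult n lam \<mu> (n - 1) \<and> \<not> threshold_resonance n lam \<mu>)
     \<and>
     (\<exists>lam \<mu>. \<Gamma>r n \<inter> S_zero n = {(lam, \<mu>)} \<and>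
        number_of_negative_eigenvalues n lam \<mu> = 1 \<and>
        (n = 2 \<longrightarrow>
           threshold_resonance_of_mult n lam \<mu> 2 \<and> \<not> threshold_eigenvalue n lam \<mu>) \<and>
        (n = 3 \<or> n = 4 \<longrightarrow>
           threshold_resonance_of_mult n lam \<mu> 1 \<and> threshold_eigenvalue_of_mult n lam \<mu> n) \<and>
        (n \<ge> 5 \<longrightarrow>
           threshold_eigenvalue_of_mult n lam \<mu> (n + 1) \<and> \<not> threshold_resonance n lam \<mu>))
     \<and>
     (\<exists>lam \<mu>. \<Gamma>r n \<inter> C_zero n = {(lam, \<mu>)} \<and>
        number_of_negative_eigenvalues n lam \<mu> = enat (n + 1) \<and>
        (n = 2 \<longrightarrow>
           threshold_eigenvalue_of_mult n lam \<mu> 1 \<and> \<not> threshold_resonance n lam \<mu>) \<and>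
        (n = 3 \<or> n = 4 \<longrightarrow>
           threshold_resonance_of_mult n lam \<mu> 1 \<and>
           threshold_eigenvalue_of_mult n lam \<mu> (n - 1)) \<and>
        (n \<ge> 5 \<longrightarrow>
           threshold_eigenvalue_of_mult n lam \<mu> n \<and> \<not> threshold_resonance n lam \<mu>))"
proof -
  note n = assms
  note ord = X_asym_less_lam_s[OF n] lam_s_less_lam_c[OF n]
  note sets = G0_def G1_def G2_def \<Gamma>l_def \<Gamma>r_def S_minus_def S_zero_def S_plus_def C_minus_def C_zero_def C_plus_def
  note val = number_of_negative_eigenvalues_eq[OF n] threshold_eigenvalue_iff[OF n] threshold_resonance_iff[OF n]
    threshold_eigenvalue_of_mult_def threshold_resonance_of_mult_def
    threshold_eigenvalue_mult_eq[OF n] threshold_resonance_mult_eq[OF n]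
  \<comment> \<open>Above any coupling beyond X the right branch has exactly one point, so both
    intersection points exist because X < \<open>lam_s\<close> < \<open>lam_c\<close>.\<close>
  have A: "\<exists>lam \<mu>. \<Gamma>r n \<inter> S_zero n = {(lam, \<mu>)} \<and> lam = lam_s n \<and> H0_bar n lam \<mu> = 0"
    and B: "\<exists>lam \<mu>. \<Gamma>r n \<inter> C_zero n = {(lam, \<mu>)} \<and> lam = lam_c n \<and> H0_bar n lam \<mu> = 0"
    unfolding S_zero_def C_zero_def using \<Gamma>r_fiber[of n "lam_s n"] \<Gamma>r_fiber[of n "lam_c n"] ord
    by (auto simp: H0_bar_def)
  have ball_insert: "(\<forall>x\<in>insert a B. P x) \<longleftrightarrow> P a \<and> (\<forall>x\<in>B. P x)" for a B and P :: "'a \<Rightarrow> bool"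
    by blast
  have ball_empty: "(\<forall>x\<in>{}. P x) \<longleftrightarrow> True" for P :: "'a \<Rightarrow> bool"
    by simp
  have pairI: "(\<And>a b. (a, b) \<in> D \<Longrightarrow> P a b) \<Longrightarrow> \<forall>(a, b)\<in>D. P a b" for D and P :: "real \<Rightarrow> real \<Rightarrow> bool"
    by blast
  \<comment> \<open>The formulas depend only on the sign of \<open>H0_bar\<close>, on n, and on the
    position of lam relative to X, \<open>lam_s\<close> and \<open>lam_c\<close>; with the ordering
    of these three, each region becomes a finite case check.\<close>
  note unf = sets val Int_iff mem_Collect_eq case_prod_conv
  show ?thesis
  proof (intro conjI, goal_cases)
    case 1
    show ?case
      unfolding ball_insert ball_empty case_prod_conv
      by (intro conjI TrueI; rule pairI; unfold unf; insert ord n; simp add: zero_enat_def; auto)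
  next
    case 2
    show ?case using not_super_threshold_resonance[OF n] by blast
  next
    case 3
    show ?case
      unfolding ball_insert ball_empty case_prod_conv
      by (intro conjI TrueI; rule pairI; unfold unf; insert ord n; simp add: zero_enat_def; auto)
  next
    case 4
    show ?case
      unfolding ball_insert ball_empty case_prod_conv
      by (intro conjI TrueI; rule pairI; unfold unf; insert ord n; simp add: zero_enat_def; auto)
  next
    case 5
    show ?case
      unfolding ball_insert ball_empty case_prod_conv
      by (intro conjI TrueI; rule pairI; unfold unf; insert ord n; simp add: zero_enat_def; auto)
  next
    case 6
    obtain lam \<mu> where *: "\<Gamma>r n \<inter> S_zero n = {(lam, \<mu>)}" "lam = lam_s n" "H0_bar n lam \<mu> = 0"
      using A by blast
    show ?case
      by (rule exI[of _ lam], rule exI[of _ \<mu>], intro conjI *(1); unfold val; insert ord n *(2,3);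
          simp add: zero_enat_def one_enat_def; auto)
  next
    case 7
    obtain lam \<mu> where *: "\<Gamma>r n \<inter> C_zero n = {(lam, \<mu>)}" "lam = lam_c n" "H0_bar n lam \<mu> = 0"
      using B by blast
    show ?case
      by (rule exI[of _ lam], rule exI[of _ \<mu>], intro conjI *(1); unfold val; insert ord n *(2,3);
          simp add: zero_enat_def one_enat_def; auto)
  qed
qed

end
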